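(* Let $a\in{\rm BMO}_{\rm dyadic}$, $0<\alpha<n$, $1<q\le p<\infty$, $1<t\le s<\infty$ with $\frac ts=\frac qp$ and $\frac1s=\frac1p-\frac\alpha n$. Then the operator norm of the commutator $[a,I_{\alpha,{\rm dyadic}}]$ as a map from $\mathcal M^p_q$ to $\mathcal M^s_t$ satisfies \[ \|[a,I_{\alpha,{\rm dyadic}}]\|_{B(\mathcal M^p_q,\mathcal M^s_t)}\sim\|a\|_{{\rm BMO}_{\rm dyadic}}, \] with implicit constants depending only on $n,p,q,s,t,\alpha$.
   Context: Dyadic cubes: $Q_{jm}=\prod_{\nu=1}^n[m_\nu2^{-j},(m_\nu+1)2^{-j})$, $\mathcal D_j=\{Q_{jm}:m\in\mathbb Z^n\}$, $\mathcal D=\bigcup_j\mathcal D_j$. Haar functions: $h^{\epsilon_i}(t)=\chi_{[0,1)}(2t)+(-1)^{\epsilon_i}\chi_{[1,2)}(2t)$ for $\epsilon_i\in\{0,1\}$; $E=\{0,1\}^n\setminus\{(0,\dots,0)\}$; $h^\varepsilon(x)=\prod_i h^{\varepsilon_i}(x_i)$; $h^\varepsilon_{Q_{jm}}(x)=2^{jn/2}h^\varepsilon(2^jx-m)$. $\langle f,g\rangle=\int fg$, $m_Q(f)=|Q|^{-1}\int_Qf$. Morrey space: $\|f\|_{\mathcal M^p_q}=\sup_{Q\in\mathcal D}|Q|^{1/p-1/q}(\int_Q|f|^q)^{1/q}$, $\mathcal M^p_q=\{f\in L^q_{\rm loc}:\|f\|_{\mathcal M^p_q}<\infty\}$. Dyadic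 BMO: $M^{\sharp,{\rm dyadic}}a(x)=\sup_{Q\in\mathcal D,\,x\in Q}m_Q(|a-m_Q(a)|)$, $\|a\|_{{\rm BMO}_{\rm dyadic}}=\|M^{\sharp,{\rm dyadic}}a\|_{L^\infty}$. Dyadic fractional integral: $I_{\alpha,{\rm dyadic}}f=\lim_{M\to\infty}\sum_{\varepsilon\in E}\sum_{j=-M}^{M}\sum_{Q\in\mathcal D_j}|Q|^{\alpha/n}\langle f,h^\varepsilon_Q\rangle h^\varepsilon_Q$. Commutator: $[a,I_{\alpha,{\rm dyadic}}]f=\lim_{M\to\infty}\sum_{\varepsilon\in E}\sum_{j=-M}^{M}\sum_{Q\in\mathcal D_j}\langle a\cdot I_{\alpha,{\rm dyadic}}f-I_{\alpha,{\rm dyadic}}[a f],h^\varepsilon_Q\rangle h^\varepsilon_Q$ (limit in $L^q_{\rm loc}$). $\|T\|_{B(X,Y)}$ denotes the operator norm of $T:X\to Y$. *)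

theory Defs
  imports "HOL-Analysis.Analysis" "HOL-Probability.Essential_Supremum"
begin

definition dyadic_cube :: "int \<Rightarrow> int^'n \<Rightarrow> (real^'n::finite) set" where
  "dyadic_cube j m = {x. \<forall>i. of_int (m$i) * 2 powr (- real_of_int j) \<le> x$i
                            \<and> x$i < (of_int (m$i) + 1) * 2 powr (- real_of_int j)}"

definition dyadic_cubes :: "(real^'n::finite) set set" where
  "dyadic_cubes = {dyadic_cube j m | j m. True}"

text \<open>one-dimensional Haar function; the boolean b encodes epsilon_i (True = 1)\<close>
definition haar1 :: "bool \<Rightarrow> real \<Rightarrow> real" where
  "haar1 b t = indicator {0..<1} (2*t) + (if b then -1 else 1) * indicator {1..<2} (2*t)"

definition haar_E :: "('n::finite \<Rightarrow> bool) set" where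
  "haar_E = {e. \<exists>i. e i}"

definition haar :: "('n::finite \<Rightarrow> bool) \<Rightarrow> real^'n \<Rightarrow> real" where
  "haar e x = (\<Prod>i\<in>UNIV. haar1 (e i) (x$i))"

definition haar_cube :: "('n::finite \<Rightarrow> bool) \<Rightarrow> int \<Rightarrow> int^'n \<Rightarrow> real^'n \<Rightarrow> real" where
  "haar_cube e j m x = 2 powr (real_of_int j * real CARD('n) / 2)
      * haar e ((2 powr real_of_int j) *\<^sub>R x - (\<chi> i. of_int (m$i)))"

definition pairing :: "((real^'n::finite) \<Rightarrow> real) \<Rightarrow> (real^'n \<Rightarrow> real) \<Rightarrow> real" where
  "pairing f g = (LINT x|lborel. f x * g x)"

definition cube_mean :: "(real^'n::finite) set \<Rightarrow> (real^'n \<Rightarrow> real) \<Rightarrow> real" where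
  "cube_mean Q f = (LINT x:Q|lborel. f x) / measure lborel Q"

definition Lloc :: "real \<Rightarrow> ((real^'n::finite) \<Rightarrow> real) \<Rightarrow> bool" where
  "Lloc r f \<longleftrightarrow> f \<in> borel_measurable lborel \<and>
     (\<forall>K. compact K \<longrightarrow> set_integrable lborel K (\<lambda>x. \<bar>f x\<bar> powr r))"

definition Lloc_conv :: "real \<Rightarrow> (nat \<Rightarrow> (real^'n::finite) \<Rightarrow> real) \<Rightarrow> (real^'n \<Rightarrow> real) \<Rightarrow> bool" where
  "Lloc_conv r F g \<longleftrightarrow> Lloc r g \<and> (\<forall>M. Lloc r (F M)) \<and>
     (\<forall>K. compact K \<longrightarrow>
        ((\<lambda>M. LINT x:K|lborel. \<bar>F M x - g x\<bar> powr r) \<longlongrightarrow> 0) sequentially)"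

definition morrey_norm :: "real \<Rightarrow> real \<Rightarrow> ((real^'n::finite) \<Rightarrow> real) \<Rightarrow> ereal" where
  "morrey_norm p q f = (SUP Q\<in>dyadic_cubes. ereal (measure lborel Q powr (1/p - 1/q)
        * (LINT x:Q|lborel. \<bar>f x\<bar> powr q) powr (1/q)))"

definition morrey :: "real \<Rightarrow> real \<Rightarrow> ((real^'n::finite) \<Rightarrow> real) set" where
  "morrey p q = {f. Lloc q f \<and> morrey_norm p q f < \<infinity>}"

definition sharp_dyadic :: "((real^'n::finite) \<Rightarrow> real) \<Rightarrow> real^'n \<Rightarrow> ereal" where
  "sharp_dyadic a x = (SUP Q\<in>{Q\<in>dyadic_cubes. x \<in> Q}.
       ereal (cube_mean Q (\<lambda>y. \<bar>a y - cube_mean Q a\<bar>)))"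

definition bmo_norm :: "((real^'n::finite) \<Rightarrow> real) \<Rightarrow> ereal" where
  "bmo_norm a = esssup lborel (sharp_dyadic a)"

definition bmo_dyadic :: "((real^'n::finite) \<Rightarrow> real) set" where
  "bmo_dyadic = {a. Lloc 1 a \<and> bmo_norm a < \<infinity>}"

text \<open>partial sums of the dyadic fractional integral (the sum over Q in D_j is pointwise,
  at each point only one term is nonzero)\<close>
definition frac_partial :: "real \<Rightarrow> ((real^'n::finite) \<Rightarrow> real) \<Rightarrow> nat \<Rightarrow> real^'n \<Rightarrow> real" where
  "frac_partial \<alpha> f M x = (\<Sum>e\<in>haar_E. \<Sum>j\<in>{- int M..int M}. \<Sum>\<^sub>\<infinity> m.
      measure lborel (dyadic_cube j m) powr (\<alpha> / real CARD('n))
      * pairing f (haar_cube e j m) * haar_cube e j m x)"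

text \<open>I_alpha f, as the L^1_loc limit of the partial sums (unique up to a.e. equality)\<close>
definition frac_int :: "real \<Rightarrow> ((real^'n::finite) \<Rightarrow> real) \<Rightarrow> real^'n \<Rightarrow> real" where
  "frac_int \<alpha> f = (SOME g. Lloc_conv 1 (frac_partial \<alpha> f) g)"

definition comm_partial :: "((real^'n::finite) \<Rightarrow> real) \<Rightarrow> real \<Rightarrow> (real^'n \<Rightarrow> real) \<Rightarrow> nat \<Rightarrow> real^'n \<Rightarrow> real" where
  "comm_partial a \<alpha> f M x = (\<Sum>e\<in>haar_E. \<Sum>j\<in>{- int M..int M}. \<Sum>\<^sub>\<infinity> m.
      pairing (\<lambda>y. a y * frac_int \<alpha> f y - frac_int \<alpha> (\<lambda>y. a y * f y) y) (haar_cube e j m)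
      * haar_cube e j m x)"

definition commutator :: "((real^'n::finite) \<Rightarrow> real) \<Rightarrow> real \<Rightarrow> real \<Rightarrow> (real^'n \<Rightarrow> real) \<Rightarrow> real^'n \<Rightarrow> real" where
  "commutator a \<alpha> r f = (SOME g. Lloc_conv r (comm_partial a \<alpha> f) g)"

definition op_norm_morrey :: "real \<Rightarrow> real \<Rightarrow> real \<Rightarrow> real \<Rightarrow>
    (((real^'n::finite) \<Rightarrow> real) \<Rightarrow> (real^'n \<Rightarrow> real)) \<Rightarrow> ereal" where
  "op_norm_morrey p q s t T =
     (SUP f\<in>{f\<in>morrey p q. morrey_norm p q f \<le> 1}. morrey_norm s t (T f))"

end

theory Submission
  imports Defs "HOL-Probability.Probability_Measure"
begin

text \<open>
  Write \<open>E\<^sub>j f\<close> for the average of \<open>f\<close> over the cubes of side \<open>2\<^sup>-\<^sup>j\<close>. The Haar functions of level \<open>j\<close>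
  produce the martingale difference \<open>E\<^sub>j\<^sub>+\<^sub>1 f - E\<^sub>j f\<close>, so the kernel of the commutator at \<open>(x, y)\<close> carries the
  factor \<open>a x - a y\<close> and \<open>|[a, I] f x|\<close> is at most a constant times the sum over the cubes \<open>Q \<ni> x\<close> of
  \<open>\<ell>(Q)\<^sup>\<alpha>\<close> times the mean over \<open>Q\<close> of \<open>|a x - a y| |f y|\<close>.

  Upper bound: insert the mean of \<open>a\<close> over \<open>Q\<close>. The John--Nirenberg inequality and Hoelder's inequality
  replace \<open>|a y - m\<^sub>Q a|\<close> by the BMO norm, at the cost of an \<open>r\<close>-mean of \<open>f\<close> with \<open>1 < r < q\<close>; the
  resulting sum is controlled by Hedberg's trick and the dyadic maximal inequality. The terms with
  \<open>|a x - m\<^sub>Q a|\<close> are handled on a fixed cube by duality for small \<open>Q\<close>, and by geometric series for large \<open>Q\<close>.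

  Lower bound: if \<open>f\<close> is the indicator of a cube \<open>Q'\<close> with the same parent as \<open>Q\<close>, then on \<open>Q\<close> the
  commutator is a positive constant of size \<open>\<ell>(Q)\<^sup>\<alpha>\<close> times \<open>a - m\<^bsub>Q'\<^esub> a\<close>, whose mean absolute value dominates
  half of the oscillation of \<open>a\<close> on \<open>Q\<close>.
\<close>

section \<open>Dyadic cubes and averages\<close>

text \<open>\<open>frac_int\<close> and \<open>commutator\<close> are limits picked by choice, so
  they are known only almost everywhere. The norm estimates are therefore proved for finitely many
  levels, with constants independent of their number, and carried over by Fatou's lemma along an
  almost everywhere convergent subsequence. Finiteness also keeps integrable whatever has to be
  absorbed. The intermediate exponent r needs room on both sides: r > 1 leaves a finite conjugate
  exponent for the oscillation of a, and r < q makes the maximal function of |f|^r bounded at the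
  exponent q/r > 1. The factor |a x - m_Q a| stands outside the average over Q, where Hoelder's
  inequality on Q cannot reach it, and it has no pointwise bound; hence the duality argument. For
  large Q, m_Q a differs from the mean over the fixed cube by at most 2^n b per level. The relation
  1/s = 1/p - \<alpha>/n gives level i the weight 2^(i n/s), which decays towards large cubes; t/s =
  q/p makes the power of the maximal function in Hedberg's estimate come out as q/r.\<close>

definition dcube :: "int \<Rightarrow> real^'n \<Rightarrow> (real^'n::finite) set" where
  "dcube j x = {y. \<forall>i. \<lfloor>2 powr real_of_int j * y$i\<rfloor> = \<lfloor>2 powr real_of_int j * x$i\<rfloor>}"

text \<open>With floors, membership, nesting and disjointness of cubes become equalities of
  integers. For this reason \<open>dcube\<close> is written with floors and indexed by any of its
  points. A larger \<open>j\<close> means a smaller cube.\<close>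

lemma dyadic_cube_eq_floor:
  "dyadic_cube j m = {y::real^'n::finite. \<forall>i. \<lfloor>2 powr real_of_int j * y$i\<rfloor> = m$i}"
proof -
  have *: "(of_int k * 2 powr (- real_of_int j) \<le> u \<and> u < (of_int k + 1) * 2 powr (- real_of_int j))
     \<longleftrightarrow> \<lfloor>2 powr real_of_int j * u\<rfloor> = k" for k :: int and u :: real
    unfolding floor_eq_iff by (auto simp: powr_minus field_simps)
  show ?thesis unfolding dyadic_cube_def * ..
qed

lemma dcube_eq_dyadic_cube: "dcube j x = dyadic_cube j (\<chi> i. \<lfloor>2 powr real_of_int j * x$i\<rfloor>)"
  unfolding dyadic_cube_eq_floor dcube_def by simp

lemma dyadic_cube_eq_dcube: "x \<in> dyadic_cube j m \<Longrightarrow> dyadic_cube j m = dcube j x"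
  unfolding dyadic_cube_eq_floor dcube_def by auto

lemma dyadic_cube_nonempty: "dyadic_cube j m \<noteq> ({} :: (real^'n::finite) set)"
proof -
  have "(\<chi> i. of_int (m$i) * 2 powr (- real_of_int j)) \<in> dyadic_cube j m"
    unfolding dyadic_cube_def by auto
  then show ?thesis by auto
qed

lemma dyadic_cubes_eq: "dyadic_cubes = {dcube j x | j (x::real^'n::finite). True}"
proof -
  have "\<exists>x. dyadic_cube j m = dcube j x" for j and m :: "int^'n"
    using dyadic_cube_nonempty[of j m] dyadic_cube_eq_dcube by blast
  moreover have "dcube j x \<in> dyadic_cubes" for j and x :: "real^'n"
    unfolding dcube_eq_dyadic_cube dyadic_cubes_def by auto
  ultimately show ?thesis unfolding dyadic_cubes_def by blast
qed

lemma dcube_self [simp]: "x \<in> dcube j x"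
  by (simp add: dcube_def)

lemma dcube_eq: "y \<in> dcube j x \<Longrightarrow> dcube j y = dcube j x"
  by (auto simp: dcube_def)

lemma dcube_sym: "y \<in> dcube j x \<longleftrightarrow> x \<in> dcube j y"
  by (auto simp: dcube_def)

lemma dcube_disjoint: "y \<notin> dcube j x \<Longrightarrow> dcube j y \<inter> dcube j x = {}"
  by (auto simp: dcube_def)

lemma floor_halves: "\<lfloor>2 powr real_of_int j * u\<rfloor> = \<lfloor>2 powr real_of_int (j+1) * u\<rfloor> div 2"
proof -
  have "\<lfloor>(2 powr real_of_int (j+1) * u) / real_of_int 2\<rfloor> = \<lfloor>2 powr real_of_int (j+1) * u\<rfloor> div 2"
    by (rule floor_divide_real_eq_div) simp
  then show ?thesis by (simp add: powr_add)
qed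

lemma dcube_Suc_subset: "dcube (j+1) x \<subseteq> dcube j x"
  by (auto simp: dcube_def floor_halves)

lemma dcube_mono: assumes "j \<le> k" shows "dcube k x \<subseteq> dcube j x"
  using assms
proof (induction k rule: int_ge_induct)
  case (step k)
  then show ?case using dcube_Suc_subset[of k x] by blast
qed simp

lemma dcube_measurable [measurable, simp]: "dcube j x \<in> sets borel"
proof -
  have "dcube j x = {y \<in> space borel. \<forall>i\<in>UNIV. \<lfloor>2 powr real_of_int j * y$i\<rfloor> = \<lfloor>2 powr real_of_int j * x$i\<rfloor>}"
    by (simp add: dcube_def)
  also have "\<dots> \<in> sets borel" by measurable
  finally show ?thesis .
qed

text \<open>The half-open cube lies between an open and a closed box of the same volume.\<close>

lemma emeasure_dcube: "emeasure lborel (dcube j (x::real^'n::finite)) = ennreal (2 powr (- real_of_int j * real CARD('n)))"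
proof -
  define c where "c = (\<chi> i. of_int \<lfloor>2 powr real_of_int j * x$i\<rfloor> * 2 powr (- real_of_int j))"
  define d where "d = (\<chi> i. (of_int \<lfloor>2 powr real_of_int j * x$i\<rfloor> + 1) * 2 powr (- real_of_int j))"
  have le: "c $ i \<le> d $ i" for i by (auto simp: c_def d_def)
  have lB: "\<And>b. b \<in> Basis \<Longrightarrow> c \<bullet> b \<le> d \<bullet> b" using le by (auto simp: Basis_vec_def inner_axis)
  have "box c d \<subseteq> dcube j x" "dcube j x \<subseteq> cbox c d"
    unfolding dcube_eq_dyadic_cube dyadic_cube_def c_def d_def
    by (auto simp: mem_box_cart less_imp_le)
  then have "emeasure lborel (box c d) \<le> emeasure lborel (dcube j x)"
    "emeasure lborel (dcube j x) \<le> emeasure lborel (cbox c d)"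
    by (auto intro!: emeasure_mono)
  moreover have "(\<Prod>b\<in>Basis. (d - c) \<bullet> b) = 2 powr (- real_of_int j * real CARD('n))"
  proof -
    have "(\<Prod>b\<in>Basis. (d - c) \<bullet> b) = (\<Prod>b\<in>(Basis::(real^'n) set). 2 powr (- real_of_int j))"
      by (intro prod.cong refl) (auto simp: Basis_vec_def inner_axis c_def d_def algebra_simps)
    also have "\<dots> = 2 powr (- real_of_int j * real CARD('n))"
      by (simp add: powr_power mult.commute)
    finally show ?thesis .
  qed
  ultimately show ?thesis
    using lB by (simp add: emeasure_lborel_box emeasure_lborel_cbox)
qed

lemma measure_dcube: "measure lborel (dcube j (x::real^'n::finite)) = 2 powr (- real_of_int j * real CARD('n))"
  by (simp add: measure_def emeasure_dcube)

section \<open>Averages as expectations under the uniform probability measure on a cube\<close>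

definition dmeas :: "int \<Rightarrow> real^'n \<Rightarrow> (real^'n::finite) measure" where
  "dmeas j x = uniform_measure lborel (dcube j x)"

lemma sets_dmeas [measurable_cong, simp]: "sets (dmeas j x) = sets borel"
  and space_dmeas [simp]: "space (dmeas j x) = UNIV"
  by (simp_all add: dmeas_def)

lemma prob_space_dmeas: "prob_space (dmeas j x)"
  unfolding dmeas_def by (rule prob_space_uniform_measure) (auto simp: emeasure_dcube)

interpretation dmeas: prob_space "dmeas j x" for j x
  by (rule prob_space_dmeas)

definition dmean :: "int \<Rightarrow> (real^'n \<Rightarrow> real) \<Rightarrow> real^'n::finite \<Rightarrow> real" where
  "dmean j f x = integral\<^sup>L (dmeas j x) f"

lemma dmeas_density: "dmeas j (x::real^'n::finite) = density lborel (\<lambda>y. ennreal (indicator (dcube j x) y * 2 powr (real_of_int j * real CARD('n))))"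
  unfolding dmeas_def uniform_measure_def emeasure_dcube
  by (intro arg_cong[where f="density lborel"] ext)
     (auto simp: indicator_def powr_minus divide_ennreal_def inverse_ennreal)

lemma integrable_dmeas_iff:
  assumes "f \<in> borel_measurable borel"
  shows "integrable (dmeas j x) f \<longleftrightarrow> set_integrable lborel (dcube j (x::real^'n::finite)) (f::_\<Rightarrow>real)"
proof -
  have "integrable (dmeas j x) f \<longleftrightarrow> integrable lborel (\<lambda>y. (indicator (dcube j x) y * 2 powr (real_of_int j * real CARD('n))) *\<^sub>R f y)"
    unfolding dmeas_density using assms by (intro integrable_density) auto
  also have "\<dots> \<longleftrightarrow> integrable lborel (\<lambda>y. 2 powr (real_of_int j * real CARD('n)) * (indicator (dcube j x) y *\<^sub>R f y))"
    unfolding real_scaleR_def by (intro arg_cong[where f="integrable lborel"] ext) (simp only: mult_ac)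
  also have "\<dots> \<longleftrightarrow> set_integrable lborel (dcube j x) f"
    unfolding set_integrable_def by (subst integrable_mult_left_iff) auto
  finally show ?thesis .
qed

lemma dmean_eq_set_integral:
  assumes "f \<in> borel_measurable borel"
  shows "(LINT y:dcube j x|lborel. f y) = 2 powr (- real_of_int j * real CARD('n)) * dmean j f (x::real^'n::finite)"
proof -
  have "dmean j f x = integral\<^sup>L lborel (\<lambda>y. (indicator (dcube j x) y * 2 powr (real_of_int j * real CARD('n))) *\<^sub>R f y)"
    unfolding dmean_def dmeas_density using assms by (intro integral_density) auto
  also have "\<dots> = 2 powr (real_of_int j * real CARD('n)) * (LINT y:dcube j x|lborel. f y)"
    unfolding set_lebesgue_integral_def by (simp flip: integral_mult_right_zero add: mult_ac)
  finally show ?thesis by (simp add: powr_minus)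
qed

lemma cube_mean_dcube:
  assumes "f \<in> borel_measurable borel"
  shows "cube_mean (dcube j x) f = dmean j f (x::real^'n::finite)"
  unfolding cube_mean_def dmean_eq_set_integral[OF assms] measure_dcube by simp

lemma dmean_dcube_cong: "y \<in> dcube j x \<Longrightarrow> dmean j f y = dmean j f x"
  by (simp add: dmean_def dmeas_def dcube_eq)

lemma AE_dmeas: "AE y in dmeas j x. y \<in> dcube j x"
  unfolding dmeas_def by (rule AE_uniform_measureI) auto

lemma AE_dmeasI: "(\<And>y. y \<in> dcube j x \<Longrightarrow> P y) \<Longrightarrow> AE y in dmeas j x. P y"
  using AE_dmeas[of j x] by eventually_elim auto

lemma AE_dmeas_lborel: "AE y in lborel. P y \<Longrightarrow> AE y in dmeas j x. P y"
  unfolding dmeas_def by (rule AE_uniform_measureI) (auto elim: eventually_mono)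

lemma countable_vec_int: "countable (UNIV :: (int^'n::finite) set)"
proof -
  have "countable (PiE UNIV (\<lambda>_. UNIV) :: ('n \<Rightarrow> int) set)" by (rule countable_PiE) auto
  then have "countable (vec_lambda ` (UNIV :: ('n \<Rightarrow> int) set))" by (simp add: PiE_UNIV_domain)
  moreover have "vec_lambda ` (UNIV :: ('n \<Rightarrow> int) set) = UNIV" by (metis surj_def vec_lambda_eta)
  ultimately show ?thesis by simp
qed

text \<open>Countably many cubes of the fixed level \<open>j\<close> cover the space, so their
  exceptional null sets can be united. This is the way back from cubes to Lebesgue measure.\<close>

lemma AE_lborel_dmeas: assumes "\<And>x. AE y in dmeas j x. P y" shows "AE y in lborel. P (y::real^'n::finite)"
proof -
  define c :: "int^'n \<Rightarrow> real^'n" where "c m = (SOME x. x \<in> dyadic_cube j m)" for m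
  have c: "dyadic_cube j m = dcube j (c m)" for m
    using dyadic_cube_nonempty[of j m] unfolding c_def by (meson dyadic_cube_eq_dcube ex_in_conv someI_ex)
  have "AE y in lborel. y \<in> dcube j x \<longrightarrow> P y" for x
  proof -
    have "AE y in dmeas j x. P y" by (rule assms)
    then show ?thesis unfolding dmeas_density by (subst (asm) AE_density) (auto elim!: eventually_mono)
  qed
  then have "AE y in lborel. \<forall>m\<in>UNIV. y \<in> dcube j (c m) \<longrightarrow> P y"
    by (subst AE_ball_countable[OF countable_vec_int]) auto
  then show ?thesis
  proof eventually_elim
    case (elim y)
    have "y \<in> dcube j (c (\<chi> i. \<lfloor>2 powr real_of_int j * y$i\<rfloor>))"
      by (simp flip: c dcube_eq_dyadic_cube)
    with elim show ?case by blast
  qed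
qed

lemma dmean_cong:
  assumes [measurable]: "f \<in> borel_measurable borel" "g \<in> borel_measurable borel"
    and "\<And>y. y \<in> dcube j x \<Longrightarrow> f y = g y"
  shows "dmean j f x = dmean j g x"
  unfolding dmean_def by (intro integral_cong_AE AE_dmeasI assms) auto

lemma measure_dmeas_UNIV [simp]: "measure (dmeas j x) UNIV = 1"
  using dmeas.prob_space[of j x] by simp

section \<open>Subdivision of a cube into finitely many cubes of a finer level\<close>

definition corner :: "int \<Rightarrow> int^'n \<Rightarrow> real^'n::finite" where
  "corner k m = (\<chi> i. of_int (m$i) * 2 powr (- real_of_int k))"

lemma dyadic_cube_corner: "dyadic_cube k m = dcube k (corner k m)"
  by (rule dyadic_cube_eq_dcube) (auto simp: dyadic_cube_def corner_def)

lemma in_dcube_corner: "x \<in> dcube k (corner k (\<chi> i. \<lfloor>2 powr real_of_int k * x$i\<rfloor>))"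
  by (simp flip: dyadic_cube_corner dcube_eq_dyadic_cube)

definition subcubes :: "int \<Rightarrow> int \<Rightarrow> real^'n \<Rightarrow> (int^'n::finite) set" where
  "subcubes j k x = {m. corner k m \<in> dcube j x}"

text \<open>If \<open>l\<close> is the index of the large cube in some coordinate, the corresponding
  index of a subcube lies between 2^(k-j) l and 2^(k-j) (l+1), which leaves finitely many
  choices.\<close>

lemma finite_subcubes: assumes "j \<le> k" shows "finite (subcubes j k (x::real^'n::finite))"
proof -
  define l where "l i = \<lfloor>2 powr real_of_int j * x$i\<rfloor>" for i
  define A where "A i = {\<lfloor>2 powr real_of_int (k-j) * l i\<rfloor>..\<lfloor>2 powr real_of_int (k-j) * (l i + 1)\<rfloor>}" for i
  have "subcubes j k x \<subseteq> vec_lambda ` (PiE UNIV A)"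
  proof
    fix m assume m: "m \<in> subcubes j k x"
    have "m $ i \<in> A i" for i
    proof -
      have fl: "\<lfloor>2 powr real_of_int j * (of_int (m$i) * 2 powr (- real_of_int k))\<rfloor> = l i"
        using m by (auto simp: subcubes_def dcube_def corner_def l_def)
      have "2 powr real_of_int (k-j) * (2 powr real_of_int j * (of_int (m$i) * 2 powr (- real_of_int k)))
          = of_int (m$i) * 2 powr (real_of_int (k-j) + real_of_int j + (- real_of_int k))"
        unfolding powr_add by simp
      then have eq: "2 powr real_of_int (k-j) * (2 powr real_of_int j * (of_int (m$i) * 2 powr (- real_of_int k))) = of_int (m$i)"
        by simp
      have "of_int (l i) \<le> 2 powr real_of_int j * (of_int (m$i) * 2 powr (- real_of_int k))"
        "2 powr real_of_int j * (of_int (m$i) * 2 powr (- real_of_int k)) \<le> of_int (l i) + 1"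
        using fl by linarith+
      from this[THEN mult_left_mono, of "2 powr real_of_int (k-j)"]
      have "2 powr real_of_int (k-j) * of_int (l i) \<le> of_int (m$i)"
         "of_int (m$i) \<le> 2 powr real_of_int (k-j) * (of_int (l i) + 1)"
        unfolding eq by simp_all
      then show ?thesis unfolding A_def by (auto simp: floor_le_iff le_floor_iff)
    qed
    then have "vec_nth m \<in> PiE UNIV A" by auto
    then show "m \<in> vec_lambda ` (PiE UNIV A)" by (metis image_eqI vec_nth_inverse)
  qed
  moreover have "finite (vec_lambda ` (PiE UNIV A) :: (int^'n) set)"
    by (intro finite_imageI finite_PiE) (auto simp: A_def)
  ultimately show ?thesis by (rule finite_subset)
qed

lemma subcubes_subset: "j \<le> k \<Longrightarrow> m \<in> subcubes j k x \<Longrightarrow> dcube k (corner k m) \<subseteq> dcube j x"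
  unfolding subcubes_def using dcube_mono dcube_eq by blast

lemma dcube_partition:
  assumes "j \<le> k" shows "dcube j x = (\<Union>m\<in>subcubes j k x. dcube k (corner k m))"
proof (intro equalityI subsetI)
  fix y assume y: "y \<in> dcube j x"
  define m where "m = (\<chi> i. \<lfloor>2 powr real_of_int k * y$i\<rfloor>)"
  have ym: "y \<in> dcube k (corner k m)" unfolding m_def by (rule in_dcube_corner)
  then have "corner k m \<in> dcube j y" using dcube_mono[OF assms, of y] by (auto simp: dcube_sym)
  then have "m \<in> subcubes j k x" unfolding subcubes_def using dcube_eq[OF y] by auto
  with ym show "y \<in> (\<Union>m\<in>subcubes j k x. dcube k (corner k m))" by blast
qed (use subcubes_subset[OF assms] in blast)

lemma corner_inj: "dcube k (corner k m) \<inter> dcube k (corner k m') \<noteq> {} \<Longrightarrow> m = m'"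
  unfolding dyadic_cube_corner[symmetric] dyadic_cube_eq_floor by (auto simp: vec_eq_iff)

lemma sum_indicator_subcubes:
  assumes "j \<le> k" "y \<in> dcube j x"
  shows "(\<Sum>m\<in>subcubes j k x. indicator (dcube k (corner k m)) y) = (1::real)"
proof -
  obtain m where m: "m \<in> subcubes j k x" "y \<in> dcube k (corner k m)"
    using assms dcube_partition[OF assms(1), of x] by blast
  have "(\<Sum>m\<in>subcubes j k x. indicator (dcube k (corner k m)) y) = (\<Sum>m'\<in>subcubes j k x. if m' = m then 1 else (0::real))"
  proof (intro sum.cong refl)
    fix m' show "indicator (dcube k (corner k m')) y = (if m' = m then 1 else (0::real))"
      using corner_inj[of k m m'] m(2) by (auto simp: indicator_def)
  qed
  also have "\<dots> = 1" using m(1) finite_subcubes[OF assms(1), of x] by simp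
  finally show ?thesis .
qed

section \<open>Functions constant on the cubes of one level, in place of measurability for a
  filtration\<close>

definition dlevel :: "int \<Rightarrow> (real^'n::finite \<Rightarrow> 'b) \<Rightarrow> bool" where
  "dlevel k \<phi> \<longleftrightarrow> (\<forall>x y. y \<in> dcube k x \<longrightarrow> \<phi> y = \<phi> x)"

lemma dlevelD: "dlevel k \<phi> \<Longrightarrow> y \<in> dcube k x \<Longrightarrow> \<phi> y = \<phi> x"
  by (auto simp: dlevel_def)

lemma dlevel_dmean [simp]: "dlevel k (dmean k f)"
  by (auto simp: dlevel_def dmean_dcube_cong)

lemma dlevel_mono: "dlevel j \<phi> \<Longrightarrow> j \<le> k \<Longrightarrow> dlevel k \<phi>"
  unfolding dlevel_def using dcube_mono by blast

lemma dlevel_dmean_le: "j \<le> k \<Longrightarrow> dlevel k (dmean j f)"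
  using dlevel_mono dlevel_dmean by blast

lemma dlevel_const [simp]: "dlevel k (\<lambda>x. c)"
  by (simp add: dlevel_def)

lemma dlevel_indicator: "dlevel k (indicator (dcube k c))"
proof -
  have "y \<in> dcube k c \<longleftrightarrow> x \<in> dcube k c" if "y \<in> dcube k x" for x y
    using dcube_eq[OF that] dcube_sym[of c k x] dcube_sym[of c k y] by simp
  then show ?thesis unfolding dlevel_def indicator_def by auto
qed

lemma dlevel_comp: "dlevel k \<phi> \<Longrightarrow> dlevel k (\<lambda>x. h (\<phi> x))"
  by (auto simp: dlevel_def)

lemma dlevel_comp2: "dlevel k \<phi> \<Longrightarrow> dlevel k \<psi> \<Longrightarrow> dlevel k (\<lambda>x. h (\<phi> x) (\<psi> x))"
  by (auto simp: dlevel_def)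

lemma dlevel_sum: "(\<And>i. i \<in> A \<Longrightarrow> dlevel k (\<phi> i)) \<Longrightarrow> dlevel k (\<lambda>x. \<Sum>i\<in>A. \<phi> i x)"
  unfolding dlevel_def by (intro allI impI sum.cong) auto

text \<open>The preimage of any set whatsoever is a countable union of cubes of level
  \<open>k\<close>.\<close>

lemma dlevel_borel_measurable:
  fixes \<phi> :: "real^'n::finite \<Rightarrow> 'b::topological_space"
  assumes "dlevel k \<phi>" shows "\<phi> \<in> borel_measurable borel"
proof (rule borel_measurableI)
  fix S :: "'b set"
  have "\<phi> -` S = (\<Union>m\<in>{m. \<phi> (corner k m) \<in> S}. dcube k (corner k m))"
  proof (intro equalityI subsetI)
    fix x assume x: "x \<in> \<phi> -` S"
    define m where "m = (\<chi> i. \<lfloor>2 powr real_of_int k * x$i\<rfloor>)"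
    have m: "x \<in> dcube k (corner k m)" unfolding m_def by (rule in_dcube_corner)
    then have "\<phi> (corner k m) \<in> S" using dlevelD[OF assms m] x by simp
    with m show "x \<in> (\<Union>m\<in>{m. \<phi> (corner k m) \<in> S}. dcube k (corner k m))" by blast
  qed (use dlevelD[OF assms] in auto)
  also have "\<dots> \<in> sets borel"
    by (intro sets.countable_UN'' countable_subset[OF subset_UNIV countable_vec_int]) auto
  finally show "\<phi> -` S \<inter> space borel \<in> sets borel" by simp
qed

lemma dmean_borel_measurable [measurable]: "dmean k f \<in> borel_measurable borel"
  using dlevel_borel_measurable dlevel_dmean by blast

text \<open>At the finer of the two levels the cube splits into finitely many pieces on which the
  function is constant. Consequently every expression in finitely many averages is integrable on
  every cube, which settles most integrability conditions below.\<close>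

lemma dlevel_bounded:
  fixes \<phi> :: "real^'n::finite \<Rightarrow> real"
  assumes "dlevel k \<phi>" shows "\<exists>B. \<forall>y\<in>dcube j x. \<bar>\<phi> y\<bar> \<le> B"
proof -
  define k' where "k' = max j k"
  have k': "j \<le> k'" "dlevel k' \<phi>" using dlevel_mono[OF assms, of k'] by (auto simp: k'_def)
  have "\<bar>\<phi> y\<bar> \<le> (\<Sum>m\<in>subcubes j k' x. \<bar>\<phi> (corner k' m)\<bar>)" if y: "y \<in> dcube j x" for y
  proof -
    obtain m where m: "m \<in> subcubes j k' x" "y \<in> dcube k' (corner k' m)"
      using y unfolding dcube_partition[OF k'(1), of x] by blast
    have "\<bar>\<phi> (corner k' m)\<bar> \<le> (\<Sum>m\<in>subcubes j k' x. \<bar>\<phi> (corner k' m)\<bar>)"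
      by (rule member_le_sum[OF m(1)]) (auto intro: finite_subcubes[OF k'(1)])
    then show ?thesis unfolding dlevelD[OF k'(2) m(2)] .
  qed
  then show ?thesis by blast
qed

lemma dlevel_mult_integrable:
  fixes \<phi> f :: "real^'n::finite \<Rightarrow> real"
  assumes "dlevel k \<phi>" "integrable (dmeas j x) f"
  shows "integrable (dmeas j x) (\<lambda>y. \<phi> y * f y)"
proof -
  obtain B where B: "\<forall>y\<in>dcube j x. \<bar>\<phi> y\<bar> \<le> B" using dlevel_bounded[OF assms(1)] by blast
  have [measurable]: "\<phi> \<in> borel_measurable borel" "f \<in> borel_measurable borel"
    using dlevel_borel_measurable[OF assms(1)] borel_measurable_integrable[OF assms(2)]
    by (auto cong: measurable_cong_sets)
  show ?thesis
  proof (rule Bochner_Integration.integrable_bound)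
    show "integrable (dmeas j x) (\<lambda>y. B * f y)" using assms(2) by simp
    show "AE y in dmeas j x. norm (\<phi> y * f y) \<le> norm (B * f y)"
      by (rule AE_dmeasI) (use B in \<open>force simp: abs_mult intro!: mult_right_mono\<close>)
  qed auto
qed

lemma dlevel_integrable:
  fixes \<phi> :: "real^'n::finite \<Rightarrow> real"
  shows "dlevel k \<phi> \<Longrightarrow> integrable (dmeas j x) \<phi>"
  using dlevel_mult_integrable[of k \<phi> j x "\<lambda>_. 1"] by simp

lemma dmean_integrable [simp]: "integrable (dmeas j x) (dmean k f)"
  using dlevel_integrable dlevel_dmean by blast

lemma dmeas_integrableD: "integrable (dmeas j x) f \<Longrightarrow> f \<in> borel_measurable borel"
  using borel_measurable_integrable by (auto cong: measurable_cong_sets)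

lemma integrable_dmeas_mono:
  assumes "integrable (dmeas j x) (f :: _ \<Rightarrow> real)" "dcube k y \<subseteq> dcube j x"
  shows "integrable (dmeas k y) f"
proof -
  note m = dmeas_integrableD[OF assms(1)]
  show ?thesis using assms(1) unfolding integrable_dmeas_iff[OF m]
    by (rule set_integrable_subset) (use assms(2) in auto)
qed

lemma integrable_dmeas_sub:
  assumes "integrable (dmeas j x) (f :: _ \<Rightarrow> real)" "j \<le> k" "y \<in> dcube j x"
  shows "integrable (dmeas k y) f"
  using assms(1) by (rule integrable_dmeas_mono) (use dcube_mono[OF assms(2), of y] dcube_eq[OF assms(3)] in auto)

lemma dmean_indicator_subcube:
  assumes [measurable]: "f \<in> borel_measurable borel" and "dcube k c \<subseteq> dcube j x"
  shows "dmean j (\<lambda>y. indicator (dcube k c) y * f y) x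
     = 2 powr (real_of_int (j - k) * real CARD('n)) * dmean k f (c::real^'n::finite)"
proof -
  have "2 powr (- real_of_int j * real CARD('n)) * dmean j (\<lambda>y. indicator (dcube k c) y * f y) x
      = (LINT y:dcube j x|lborel. indicator (dcube k c) y * f y)"
    by (rule dmean_eq_set_integral[symmetric]) auto
  also have "\<dots> = (LINT y:dcube k c|lborel. f y)"
    unfolding set_lebesgue_integral_def
    by (intro Bochner_Integration.integral_cong refl) (use assms(2) in \<open>auto simp: indicator_def\<close>)
  also have "\<dots> = 2 powr (- real_of_int k * real CARD('n)) * dmean k f c"
    by (rule dmean_eq_set_integral) auto
  finally have *: "2 powr (- real_of_int j * real CARD('n)) * dmean j (\<lambda>y. indicator (dcube k c) y * f y) x
      = 2 powr (- real_of_int k * real CARD('n)) * dmean k f c" .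
  have "dmean j (\<lambda>y. indicator (dcube k c) y * f y) x
    = 2 powr (real_of_int j * real CARD('n)) * (2 powr (- real_of_int j * real CARD('n)) * dmean j (\<lambda>y. indicator (dcube k c) y * f y) x)"
    by (simp add: powr_minus)
  also have "\<dots> = 2 powr (real_of_int j * real CARD('n) + (- real_of_int k * real CARD('n))) * dmean k f c"
    unfolding * powr_add by simp
  finally show ?thesis by (simp add: algebra_simps)
qed

lemma dmean_eq_sum_subcubes:
  assumes "j \<le> k" "integrable (dmeas j x) (f :: real^'n::finite \<Rightarrow> real)"
  shows "dmean j f x = (\<Sum>m\<in>subcubes j k x. 2 powr (real_of_int (j - k) * real CARD('n)) * dmean k f (corner k m))"
proof -
  have [measurable]: "f \<in> borel_measurable borel" by (rule dmeas_integrableD[OF assms(2)])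
  have "dmean j f x = dmean j (\<lambda>y. \<Sum>m\<in>subcubes j k x. indicator (dcube k (corner k m)) y * f y) x"
    by (rule dmean_cong) (auto simp: sum_distrib_right[symmetric] sum_indicator_subcubes[OF assms(1)])
  also have "\<dots> = (\<Sum>m\<in>subcubes j k x. dmean j (\<lambda>y. indicator (dcube k (corner k m)) y * f y) x)"
    unfolding dmean_def
    by (intro Bochner_Integration.integral_sum dlevel_mult_integrable[OF _ assms(2), of k])
       (rule dlevel_indicator)
  also have "\<dots> = (\<Sum>m\<in>subcubes j k x. 2 powr (real_of_int (j - k) * real CARD('n)) * dmean k f (corner k m))"
    by (intro sum.cong refl dmean_indicator_subcube subcubes_subset[OF assms(1)]) auto
  finally show ?thesis .
qed

lemma dmean_dmean:
  assumes "j \<le> k" "integrable (dmeas j x) f"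
  shows "dmean j (dmean k f) x = dmean j f x"
proof -
  have "dmean k (dmean k f) y = dmean k f y" for y
  proof -
    have "dmean k (dmean k f) y = dmean k (\<lambda>_. dmean k f y) y"
      by (rule dmean_cong) (auto simp: dmean_dcube_cong)
    then show ?thesis by (simp add: dmean_def)
  qed
  then show ?thesis
    unfolding dmean_eq_sum_subcubes[OF assms] dmean_eq_sum_subcubes[OF assms(1) dmean_integrable] by simp
qed

lemma dmean_dlevel_mult:
  assumes "dlevel j \<phi>" and [measurable]: "f \<in> borel_measurable borel"
  shows "dmean j (\<lambda>y. \<phi> y * f y) x = \<phi> x * dmean j f x"
proof -
  have [measurable]: "\<phi> \<in> borel_measurable borel" using assms(1) by (rule dlevel_borel_measurable)
  have "dmean j (\<lambda>y. \<phi> y * f y) x = dmean j (\<lambda>y. \<phi> x * f y) x"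
    by (rule dmean_cong) (auto simp: dlevelD[OF assms(1)])
  then show ?thesis by (simp add: dmean_def)
qed

lemma dmean_dlevel: "dlevel j \<phi> \<Longrightarrow> dmean j \<phi> x = \<phi> x"
  using dmean_dlevel_mult[of j \<phi> "\<lambda>_. 1" x] by (simp add: dmean_def)

text \<open>Averaging at level \<open>k\<close> is self-adjoint and leaves factors of level
  \<open>k\<close> alone. The maximal inequality, the John--Nirenberg induction and the duality
  argument all use this to trade a function for its average under an integral.\<close>

lemma dmean_dlevel_dmean:
  assumes "j \<le> k" "dlevel k \<phi>" "integrable (dmeas j x) f"
  shows "dmean j (\<lambda>y. \<phi> y * dmean k f y) x = dmean j (\<lambda>y. \<phi> y * f y) x"
proof -
  have "(\<lambda>y. \<phi> y * dmean k f y) = dmean k (\<lambda>y. \<phi> y * f y)"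
    by (rule ext, rule dmean_dlevel_mult[symmetric, OF assms(2) dmeas_integrableD[OF assms(3)]])
  then show ?thesis using dmean_dmean[OF assms(1) dlevel_mult_integrable[OF assms(2,3)]] by simp
qed

text \<open>If \<open>f\<close> is not integrable its integral is 0 by default, and the sign
  condition on \<open>g\<close> covers that case. The variant \<open>dmean_mono'\<close> trades the
  sign condition for integrability of \<open>f\<close>.\<close>

lemma dmean_mono:
  assumes "integrable (dmeas j x) g" "f \<in> borel_measurable borel"
    and "\<And>y. y \<in> dcube j x \<Longrightarrow> f y \<le> g y" "\<And>y. y \<in> dcube j x \<Longrightarrow> 0 \<le> g y"
  shows "dmean j f x \<le> dmean j g x"
  unfolding dmean_def by (rule integral_mono_AE') (auto intro!: AE_dmeasI assms)

lemma dmean_mono':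
  assumes "integrable (dmeas j x) g" "integrable (dmeas j x) f"
    and "\<And>y. y \<in> dcube j x \<Longrightarrow> f y \<le> g y"
  shows "dmean j f x \<le> dmean j g x"
  unfolding dmean_def by (rule integral_mono_AE) (auto intro!: AE_dmeasI assms)

lemma dmean_nonneg:
  assumes "\<And>y. y \<in> dcube j x \<Longrightarrow> 0 \<le> f y" shows "0 \<le> dmean j f x"
  unfolding dmean_def by (rule integral_nonneg_AE) (auto intro!: AE_dmeasI assms)

lemma integrable_dmeas_bound:
  assumes "integrable (dmeas j x) (g :: _ \<Rightarrow> real)" "f \<in> borel_measurable borel"
    and "\<And>y. y \<in> dcube j x \<Longrightarrow> \<bar>f y :: real\<bar> \<le> g y"
  shows "integrable (dmeas j x) f"
proof (rule Bochner_Integration.integrable_bound[OF assms(1)])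
  show "AE y in dmeas j x. norm (f y) \<le> norm (g y)"
    by (rule AE_dmeasI) (use assms(3) in force)
qed (use assms(2) in auto)

lemma dmean_abs_le: "\<bar>dmean j f x\<bar> \<le> dmean j (\<lambda>y. \<bar>f y\<bar>) x"
  unfolding dmean_def by (rule integral_abs_bound)

lemma dmean_const [simp]: "dmean j (\<lambda>_. c) x = c"
  by (simp add: dmean_def)

lemma dmean_add: "integrable (dmeas j x) f \<Longrightarrow> integrable (dmeas j x) g \<Longrightarrow> dmean j (\<lambda>y. f y + g y) x = dmean j f x + dmean j g x"
  by (simp add: dmean_def)

lemma dmean_diff: "integrable (dmeas j x) f \<Longrightarrow> integrable (dmeas j x) g \<Longrightarrow> dmean j (\<lambda>y. f y - g y) x = dmean j f x - dmean j g x"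
  by (simp add: dmean_def)

lemma dmean_cmult [simp]: "dmean j (\<lambda>y. c * f y) x = c * dmean j f x"
  by (simp add: dmean_def)

lemma dmean_sum: "(\<And>i. i \<in> A \<Longrightarrow> integrable (dmeas j x) (f i)) \<Longrightarrow> dmean j (\<lambda>y. \<Sum>i\<in>A. f i y) x = (\<Sum>i\<in>A. dmean j (f i) x)"
  by (simp add: dmean_def)

text \<open>Extending the integral of a nonnegative function to the larger cube can only increase
  it; the factor is the ratio of the two volumes.\<close>

lemma dmean_subcube_le:
  assumes "j \<le> k" "integrable (dmeas j x) f" "\<And>y. y \<in> dcube j x \<Longrightarrow> 0 \<le> f y" "z \<in> dcube j x"
  shows "dmean k f z \<le> 2 powr (real_of_int (k - j) * real CARD('n)) * dmean j f (x::real^'n::finite)"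
proof -
  have sub: "dcube k z \<subseteq> dcube j x" using dcube_mono[OF assms(1), of z] dcube_eq[OF assms(4)] by auto
  have [measurable]: "f \<in> borel_measurable borel" by (rule dmeas_integrableD[OF assms(2)])
  have "2 powr (real_of_int (j - k) * real CARD('n)) * dmean k f z = dmean j (\<lambda>y. indicator (dcube k z) y * f y) x"
    by (rule dmean_indicator_subcube[symmetric]) (use sub in auto)
  also have "\<dots> \<le> dmean j f x"
    by (rule dmean_mono[OF assms(2)]) (auto simp: indicator_def assms(3))
  finally have "2 powr (real_of_int (k - j) * real CARD('n)) * (2 powr (real_of_int (j - k) * real CARD('n)) * dmean k f z)
     \<le> 2 powr (real_of_int (k - j) * real CARD('n)) * dmean j f x" by (intro mult_left_mono) auto
  moreover have "2 powr (real_of_int (k - j) * real CARD('n)) * 2 powr (real_of_int (j - k) * real CARD('n)) = 1"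
    by (simp flip: powr_add add: algebra_simps)
  ultimately show ?thesis by (simp only: mult.assoc[symmetric] mult_1)
qed

text \<open>Young's inequality is applied to s f and g / s, and the resulting bound is optimised
  over the scale s > 0.\<close>

lemma Hoelder:
  fixes f g :: "'a \<Rightarrow> real"
  assumes pq: "p > 1" "q > 1" "1/p + 1/q = 1"
    and [measurable]: "f \<in> borel_measurable M" "g \<in> borel_measurable M"
    and f: "integrable M (\<lambda>x. \<bar>f x\<bar> powr p)" and g: "integrable M (\<lambda>x. \<bar>g x\<bar> powr q)"
  shows "integrable M (\<lambda>x. f x * g x)"
    and "(\<integral>x. \<bar>f x * g x\<bar> \<partial>M) \<le> (\<integral>x. \<bar>f x\<bar> powr p \<partial>M) powr (1/p) * (\<integral>x. \<bar>g x\<bar> powr q \<partial>M) powr (1/q)"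
proof -
  have Y: "\<bar>a * b\<bar> \<le> \<bar>a\<bar> powr p / p + \<bar>b\<bar> powr q / q" for a b :: real
    using Youngs_inequality[of p q "\<bar>a\<bar>" "\<bar>b\<bar>"] pq by (simp add: abs_mult)
  show i: "integrable M (\<lambda>x. f x * g x)"
  proof (rule Bochner_Integration.integrable_bound)
    show "integrable M (\<lambda>x. \<bar>f x\<bar> powr p / p + \<bar>g x\<bar> powr q / q)" using f g by simp
    show "AE x in M. norm (f x * g x) \<le> norm (\<bar>f x\<bar> powr p / p + \<bar>g x\<bar> powr q / q)"
      unfolding real_norm_def by (intro AE_I2 order_trans[OF Y abs_ge_self])
  qed auto
  define A B where "A = (\<integral>x. \<bar>f x\<bar> powr p \<partial>M)" and "B = (\<integral>x. \<bar>g x\<bar> powr q \<partial>M)"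
  have AB: "A \<ge> 0" "B \<ge> 0" by (auto simp: A_def B_def)
  have young: "(\<integral>x. \<bar>f x * g x\<bar> \<partial>M) \<le> (s powr p) * A / p + (s powr - q) * B / q" if "s > 0" for s
  proof -
    have "(\<integral>x. \<bar>f x * g x\<bar> \<partial>M) \<le> (\<integral>x. s powr p * \<bar>f x\<bar> powr p / p + s powr -q * \<bar>g x\<bar> powr q / q \<partial>M)"
    proof (rule integral_mono)
      show "\<bar>f x * g x\<bar> \<le> s powr p * \<bar>f x\<bar> powr p / p + s powr -q * \<bar>g x\<bar> powr q / q" for x
      proof -
        have "\<bar>f x * g x\<bar> = \<bar>(s * f x) * (inverse s * g x)\<bar>" using that by (simp add: field_simps)
        also have "\<dots> \<le> \<bar>s * f x\<bar> powr p / p + \<bar>inverse s * g x\<bar> powr q / q" by (rule Y)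
        finally show ?thesis using that by (simp add: abs_mult powr_mult powr_minus inverse_powr)
      qed
    qed (use f g i in auto)
    also have "\<dots> = (s powr p) * A / p + (s powr - q) * B / q"
      using f g by (simp add: A_def B_def)
    finally show ?thesis .
  qed
  show "(\<integral>x. \<bar>f x * g x\<bar> \<partial>M) \<le> A powr (1/p) * B powr (1/q)"
  proof (cases "A = 0 \<or> B = 0")
    case True
    have "AE x in M. f x * g x = 0"
      using True
    proof
      assume "A = 0"
      then have "AE x in M. \<bar>f x\<bar> powr p = 0" using f unfolding A_def
        by (subst (asm) integral_nonneg_eq_0_iff_AE) auto
      then show ?thesis by eventually_elim auto
    next
      assume "B = 0"
      then have "AE x in M. \<bar>g x\<bar> powr q = 0" using g unfolding B_def
        by (subst (asm) integral_nonneg_eq_0_iff_AE) auto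
      then show ?thesis by eventually_elim auto
    qed
    then have "(\<integral>x. \<bar>f x * g x\<bar> \<partial>M) = (\<integral>x. 0 \<partial>M)" by (intro integral_cong_AE) auto
    then show ?thesis by simp
  next
    case False
    then have pos: "A > 0" "B > 0" using AB by auto
    \<comment> \<open>For this scale both terms of \<open>young\<close> equal A^(1/p) B^(1/q), up to
      the factors 1/p and 1/q, which add up to 1.\<close>
    define s where "s = (B / A) powr (1 / (p*q))"
    have s: "s > 0" using pos by (simp add: s_def)
    have qe: "1/q = 1 - 1/p" "1/p = 1 - 1/q" using pq(3) by auto
    have e1: "s powr p * A = A powr (1/p) * B powr (1/q)"
    proof -
      have "s powr p = B powr (1/q) / A powr (1/q)"
        unfolding s_def powr_powr using pos pq by (simp add: powr_divide)
      then show ?thesis using pos by (simp add: qe(2) powr_diff)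
    qed
    have e2: "s powr -q * B = A powr (1/p) * B powr (1/q)"
    proof -
      have "s powr -q = A powr (1/p) / B powr (1/p)"
        unfolding powr_minus s_def powr_powr using pos pq by (simp add: powr_divide)
      then show ?thesis using pos by (simp add: qe(1) powr_diff)
    qed
    have "(\<integral>x. \<bar>f x * g x\<bar> \<partial>M) \<le> A powr (1/p) * B powr (1/q) / p + A powr (1/p) * B powr (1/q) / q"
      using young[OF s] unfolding e1 e2 .
    also have "\<dots> = A powr (1/p) * B powr (1/q) * (1/p + 1/q)" by (simp add: distrib_left)
    finally show ?thesis unfolding pq by simp
  qed
qed

section \<open>Martingale convergence and the dyadic maximal function\<close>

text \<open>Jensen's inequality, obtained from Hoelder's inequality against the constant 1. The
  exponent 1 is separate because its conjugate is infinite.\<close>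

lemma powr_dmean_le:
  assumes "q \<ge> 1" and [measurable]: "f \<in> borel_measurable borel"
    and i: "integrable (dmeas j x) (\<lambda>y. \<bar>f y\<bar> powr q)"
  shows "integrable (dmeas j x) f" "(dmean j (\<lambda>y. \<bar>f y\<bar>) x) powr q \<le> dmean j (\<lambda>y. \<bar>f y\<bar> powr q) x"
proof -
  have "integrable (dmeas j x) f \<and> (dmean j (\<lambda>y. \<bar>f y\<bar>) x) powr q \<le> dmean j (\<lambda>y. \<bar>f y\<bar> powr q) x"
  proof (cases "q = 1")
    case True
    then show ?thesis using i dmean_nonneg[of j x "\<lambda>y. \<bar>f y\<bar>"] by (simp add: integrable_abs_iff)
  next
    case False
    define q' where "q' = q / (q - 1)"
    have q: "q > 1" using False assms by simp
    have q': "q' > 1" "1/q + 1/q' = 1" using q by (auto simp: q'_def field_simps)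
    have 1: "integrable (dmeas j x) (\<lambda>y. \<bar>1::real\<bar> powr q')" by simp
    note H = Hoelder[OF q q' _ _ i 1]
    have "integrable (dmeas j x) f" using H(1) by simp
    have "dmean j (\<lambda>y. \<bar>f y\<bar>) x \<le> dmean j (\<lambda>y. \<bar>f y\<bar> powr q) x powr (1/q)"
      using H(2) by (simp add: dmean_def)
    then have "(dmean j (\<lambda>y. \<bar>f y\<bar>) x) powr q \<le> (dmean j (\<lambda>y. \<bar>f y\<bar> powr q) x powr (1/q)) powr q"
      by (intro powr_mono2) (use q in \<open>auto intro: dmean_nonneg\<close>)
    also have "\<dots> = dmean j (\<lambda>y. \<bar>f y\<bar> powr q) x"
      using q by (simp add: powr_powr dmean_nonneg)
    finally show ?thesis using \<open>integrable (dmeas j x) f\<close> by simp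
  qed
  then show "integrable (dmeas j x) f" "(dmean j (\<lambda>y. \<bar>f y\<bar>) x) powr q \<le> dmean j (\<lambda>y. \<bar>f y\<bar> powr q) x"
    by auto
qed

lemma abs_dmean_powr_le:
  assumes "q \<ge> 1" "f \<in> borel_measurable borel" "integrable (dmeas j x) (\<lambda>y. \<bar>f y\<bar> powr q)"
  shows "\<bar>dmean j f x\<bar> powr q \<le> dmean j (\<lambda>y. \<bar>f y\<bar> powr q) x"
  using powr_dmean_le(2)[OF assms] powr_mono2[OF _ _ dmean_abs_le[of j f x], of q] assms(1) by fastforce

lemma dmean_Hoelder:
  assumes pq: "p > 1" "q > 1" "1/p + 1/q = 1"
    and [measurable]: "f \<in> borel_measurable borel" "g \<in> borel_measurable borel"
    and f: "integrable (dmeas j x) (\<lambda>x. \<bar>f x\<bar> powr p)" and g: "integrable (dmeas j x) (\<lambda>x. \<bar>g x\<bar> powr q)"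
  shows "dmean j (\<lambda>y. \<bar>f y * g y\<bar>) x \<le> (dmean j (\<lambda>y. \<bar>f y\<bar> powr p) x) powr (1/p) * (dmean j (\<lambda>y. \<bar>g y\<bar> powr q) x) powr (1/q)"
  using Hoelder(2)[OF pq _ _ f g] by (simp add: dmean_def)

lemma integrable_powr_mono:
  assumes "integrable (dmeas j x) (\<lambda>y. \<bar>f y :: real\<bar> powr q)" "0 < r" "r \<le> q" and [measurable]: "f \<in> borel_measurable borel"
  shows "integrable (dmeas j x) (\<lambda>y. \<bar>f y\<bar> powr r)"
proof (rule integrable_dmeas_bound[where g="\<lambda>y. 1 + \<bar>f y\<bar> powr q"])
  show "integrable (dmeas j x) (\<lambda>y. 1 + \<bar>f y\<bar> powr q)" using assms by simp
  show "\<bar>\<bar>f y\<bar> powr r\<bar> \<le> 1 + \<bar>f y\<bar> powr q" for y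
    using powr_mono[OF assms(3), of "\<bar>f y\<bar>"] powr_mono2[of r "\<bar>f y\<bar>" 1] powr_ge_zero[of "\<bar>f y\<bar>" q] assms(2)
    unfolding abs_of_nonneg[OF powr_ge_zero] by (cases "\<bar>f y\<bar> \<ge> 1") (auto simp del: powr_ge_zero)
qed auto

lemma dmean_powr_mono:
  assumes i: "integrable (dmeas j x) (\<lambda>y. \<bar>f y\<bar> powr q)" and "0 < r" "r \<le> q" and [measurable]: "f \<in> borel_measurable borel"
  shows "(dmean j (\<lambda>y. \<bar>f y\<bar> powr r) x) powr (1/r) \<le> (dmean j (\<lambda>y. \<bar>f y\<bar> powr q) x) powr (1/q)"
proof -
  have e: "\<bar>\<bar>f y\<bar> powr r\<bar> powr (q/r) = \<bar>f y\<bar> powr q" for y using assms by (simp add: powr_powr)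
  have "(dmean j (\<lambda>y. \<bar>\<bar>f y\<bar> powr r\<bar>) x) powr (q/r) \<le> dmean j (\<lambda>y. \<bar>\<bar>f y\<bar> powr r\<bar> powr (q/r)) x"
    by (rule powr_dmean_le(2)) (use assms in \<open>auto simp: powr_powr\<close>)
  then have "((dmean j (\<lambda>y. \<bar>f y\<bar> powr r) x) powr (q/r)) powr (1/q) \<le> (dmean j (\<lambda>y. \<bar>f y\<bar> powr q) x) powr (1/q)"
    unfolding e using assms by (intro powr_mono2) auto
  then show ?thesis using assms by (simp add: powr_powr)
qed

text \<open>The sum is at most three times the largest term. Unlike convexity, this also works for
  exponents below 1.\<close>

lemma add3_powr_le: "(a + b + c) powr q \<le> 3 powr q * (a powr q + b powr q + c powr q)"
  if "a \<ge> 0" "b \<ge> 0" "c \<ge> 0" "q \<ge> 0" for a b c q :: real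
proof -
  define m where "m = max a (max b c)"
  have "(a + b + c) powr q \<le> (3 * m) powr q" using that by (intro powr_mono2) (auto simp: m_def)
  also have "\<dots> = 3 powr q * m powr q" using that by (simp add: powr_mult m_def)
  also have "m powr q \<le> a powr q + b powr q + c powr q" by (auto simp: m_def max_def)
  finally show ?thesis by simp
qed

definition Lq_martingale_limit :: "real \<Rightarrow> int \<Rightarrow> real^'n::finite \<Rightarrow> (real^'n \<Rightarrow> real) \<Rightarrow> bool" where
  "Lq_martingale_limit q j x g \<longleftrightarrow> g \<in> borel_measurable borel \<and> integrable (dmeas j x) (\<lambda>y. \<bar>g y\<bar> powr q)
     \<and> (\<lambda>N::nat. dmean j (\<lambda>y. \<bar>dmean (int N) g y - g y\<bar> powr q) x) \<longlonglongrightarrow> 0"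

text \<open>Averaging does not increase L^q means, so the functions with L^q convergent averages are
  closed under L^q approximation: the error for \<open>f\<close> splits into the average of
  \<open>f - g\<close>, the error for \<open>g\<close>, and \<open>f - g\<close> itself.\<close>

lemma dmean_Lq_approx:
  assumes q: "q \<ge> 1" and [measurable]: "f \<in> borel_measurable borel"
    and fi: "integrable (dmeas j x) (\<lambda>y. \<bar>f y\<bar> powr q)"
    and ap: "\<And>e. e > 0 \<Longrightarrow> \<exists>g. Lq_martingale_limit q j x g \<and> dmean j (\<lambda>y. \<bar>f y - g y\<bar> powr q) x \<le> e"
  shows "(\<lambda>N::nat. dmean j (\<lambda>y. \<bar>dmean (int N) f y - f y\<bar> powr q) x) \<longlonglongrightarrow> 0"
proof (rule LIMSEQ_I)
  fix e :: real assume "e > 0"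
  \<comment> \<open>Three errors of size \<open>d\<close> and the factor 3^q of
    \<open>add3_powr_le\<close> give 3/4 of \<open>e\<close>, hence a strict inequality.\<close>
  define d where "d = e / (4 * 3 powr q)"
  have d: "d > 0" using \<open>e > 0\<close> by (simp add: d_def)
  obtain g where [measurable]: "g \<in> borel_measurable borel" and gi: "integrable (dmeas j x) (\<lambda>y. \<bar>g y\<bar> powr q)"
    and gc: "(\<lambda>N::nat. dmean j (\<lambda>y. \<bar>dmean (int N) g y - g y\<bar> powr q) x) \<longlonglongrightarrow> 0"
    and fg: "dmean j (\<lambda>y. \<bar>f y - g y\<bar> powr q) x \<le> d" using ap[OF d] unfolding Lq_martingale_limit_def by blast
  have diffi: "integrable (dmeas j x) (\<lambda>y. \<bar>u y - v y\<bar> powr q)"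
    if [measurable]: "u \<in> borel_measurable borel" "v \<in> borel_measurable borel" and
      "integrable (dmeas j x) (\<lambda>y. \<bar>u y\<bar> powr q)" "integrable (dmeas j x) (\<lambda>y. \<bar>v y\<bar> powr q)" for u v
  proof (rule integrable_dmeas_bound[where g="\<lambda>y. 3 powr q * (\<bar>u y\<bar> powr q + \<bar>v y\<bar> powr q)"])
    show "integrable (dmeas j x) (\<lambda>y. 3 powr q * (\<bar>u y\<bar> powr q + \<bar>v y\<bar> powr q))" using that by simp
    show "\<bar>\<bar>u y - v y\<bar> powr q\<bar> \<le> 3 powr q * (\<bar>u y\<bar> powr q + \<bar>v y\<bar> powr q)" for y
      using add3_powr_le[of "\<bar>u y\<bar>" "\<bar>v y\<bar>" 0 q] powr_mono2[of q "\<bar>u y - v y\<bar>" "\<bar>u y\<bar> + \<bar>v y\<bar>"] abs_triangle_ineq4[of "u y" "v y"] q by simp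
  qed auto
  note f1 = powr_dmean_le(1)[OF q _ fi] and g1 = powr_dmean_le(1)[OF q _ gi]
  obtain N0 where N0: "\<And>N. N \<ge> N0 \<Longrightarrow> \<bar>dmean j (\<lambda>y. \<bar>dmean (int N) g y - g y\<bar> powr q) x\<bar> < d"
    using LIMSEQ_D[OF gc d] by auto
  show "\<exists>no. \<forall>N\<ge>no. norm (dmean j (\<lambda>y. \<bar>dmean (int N) f y - f y\<bar> powr q) x - 0) < e"
  proof (intro exI allI impI)
    fix N assume N: "N \<ge> max N0 (nat j)"
    then have jN: "j \<le> int N" by auto
    have fgi: "integrable (dmeas j x) (\<lambda>y. \<bar>f y - g y\<bar> powr q)" by (rule diffi[OF _ _ fi gi]) auto
    have bd: "\<bar>dmean (int N) f y - f y\<bar> powr q \<le>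
       3 powr q * (dmean (int N) (\<lambda>y. \<bar>f y - g y\<bar> powr q) y + \<bar>dmean (int N) g y - g y\<bar> powr q + \<bar>f y - g y\<bar> powr q)"
      if y: "y \<in> dcube j x" for y
    proof -
      have "dmean (int N) (\<lambda>y. f y - g y) y = dmean (int N) f y - dmean (int N) g y"
        using integrable_dmeas_sub[OF f1 jN y] integrable_dmeas_sub[OF g1 jN y] by (intro dmean_diff) auto
      then have "\<bar>dmean (int N) f y - f y\<bar> \<le> \<bar>dmean (int N) (\<lambda>y. f y - g y) y\<bar> + \<bar>dmean (int N) g y - g y\<bar> + \<bar>f y - g y\<bar>"
        by linarith
      then have "\<bar>dmean (int N) f y - f y\<bar> powr q \<le> (\<bar>dmean (int N) (\<lambda>y. f y - g y) y\<bar> + \<bar>dmean (int N) g y - g y\<bar> + \<bar>f y - g y\<bar>) powr q"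
        using q by (intro powr_mono2) auto
      also have "\<dots> \<le> 3 powr q * (\<bar>dmean (int N) (\<lambda>y. f y - g y) y\<bar> powr q + \<bar>dmean (int N) g y - g y\<bar> powr q + \<bar>f y - g y\<bar> powr q)"
        using q by (intro add3_powr_le) auto
      also have "\<bar>dmean (int N) (\<lambda>y. f y - g y) y\<bar> powr q \<le> dmean (int N) (\<lambda>y. \<bar>f y - g y\<bar> powr q) y"
        by (rule abs_dmean_powr_le[OF q]) (use integrable_dmeas_sub[OF fgi jN y] in auto)
      finally show ?thesis by simp
    qed
    have gNi: "integrable (dmeas j x) (\<lambda>y. \<bar>dmean (int N) g y - g y\<bar> powr q)"
      by (rule diffi[OF _ _ dlevel_integrable[OF dlevel_comp[OF dlevel_dmean]] gi]) auto
    have "dmean j (\<lambda>y. \<bar>dmean (int N) f y - f y\<bar> powr q) x \<le> dmean j (\<lambda>y. 3 powr q * (dmean (int N) (\<lambda>y. \<bar>f y - g y\<bar> powr q) y + \<bar>dmean (int N) g y - g y\<bar> powr q + \<bar>f y - g y\<bar> powr q)) x"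
      by (rule dmean_mono[OF _ _ bd]) (use fgi gNi in \<open>auto intro!: mult_nonneg_nonneg add_nonneg_nonneg dmean_nonneg\<close>)
    also have "\<dots> = 3 powr q * (dmean j (\<lambda>y. \<bar>f y - g y\<bar> powr q) x + dmean j (\<lambda>y. \<bar>dmean (int N) g y - g y\<bar> powr q) x + dmean j (\<lambda>y. \<bar>f y - g y\<bar> powr q) x)"
      using fgi gNi by (simp add: dmean_add dmean_dmean[OF jN])
    also have "\<dots> \<le> 3 powr q * (d + d + d)"
    proof (rule mult_left_mono)
      show "dmean j (\<lambda>y. \<bar>f y - g y\<bar> powr q) x + dmean j (\<lambda>y. \<bar>dmean (int N) g y - g y\<bar> powr q) x + dmean j (\<lambda>y. \<bar>f y - g y\<bar> powr q) x \<le> d + d + d"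
        using fg N0[of N] N by linarith
    qed simp
    also have "\<dots> < e" using \<open>e > 0\<close> by (simp add: d_def)
    finally show "norm (dmean j (\<lambda>y. \<bar>dmean (int N) f y - f y\<bar> powr q) x - 0) < e"
      using dmean_nonneg[of j x "\<lambda>y. \<bar>dmean (int N) f y - f y\<bar> powr q"] by simp
  qed
qed

lemma dcube_subset_open:
  fixes y :: "real^'n::finite"
  assumes "open U" "y \<in> U" shows "\<exists>N::nat. \<forall>k\<ge>N. dcube (int k) y \<subseteq> U"
proof -
  obtain e where e: "e > 0" "ball y e \<subseteq> U" using assms openE by blast
  have "(\<lambda>k. real CARD('n) * (1/2)^k) \<longlonglongrightarrow> real CARD('n) * 0"
    by (intro tendsto_intros LIMSEQ_realpow_zero) auto
  then have "\<forall>\<^sub>F k in sequentially. real CARD('n) * (1/2)^k < e"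
    using e(1) by (intro order_tendstoD(2)) auto
  then obtain N where N: "\<And>k. k \<ge> N \<Longrightarrow> real CARD('n) * (1/2)^k < e"
    by (auto simp: eventually_sequentially)
  have "dcube (int k) y \<subseteq> U" if k: "k \<ge> N" for k
  proof
    fix z assume z: "z \<in> dcube (int k) y"
    have "\<bar>(z - y) $ i\<bar> \<le> (1/2)^k" for i
    proof -
      have "\<bar>2 powr real k * (z $ i) - 2 powr real k * (y $ i)\<bar> < 1"
      proof -
        have "\<lfloor>2 powr real k * (z $ i)\<rfloor> = \<lfloor>2 powr real k * (y $ i)\<rfloor>"
          using z by (simp add: dcube_def)
        then show ?thesis by linarith
      qed
      also have "2 powr real k * (z $ i) - 2 powr real k * (y $ i) = 2 ^ k * (z $ i - y $ i)"
        by (simp add: powr_realpow right_diff_distrib)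
      finally have "2 ^ k * \<bar>z $ i - y $ i\<bar> < 1" by (simp add: abs_mult)
      then show ?thesis by (simp add: field_simps power_one_over)
    qed
    then have "norm (z - y) \<le> (\<Sum>i\<in>(UNIV::'n set). (1/2)^k)"
      by (intro order_trans[OF norm_le_l1_cart] sum_mono) auto
    also have "\<dots> < e" using N[OF k] by simp
    finally show "z \<in> U" using e(2) by (auto simp: dist_norm norm_minus_commute)
  qed
  then show ?thesis by blast
qed

lemma dmean_dlevel_tendsto:
  assumes "dlevel k g" "q > 0" shows "(\<lambda>N::nat. dmean j (\<lambda>y. \<bar>dmean (int N) g y - g y\<bar> powr q) x) \<longlonglongrightarrow> 0"
proof (rule tendsto_eventually, unfold eventually_sequentially, intro exI allI impI)
  fix N assume "N \<ge> nat k"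
  then have "dlevel (int N) g" using dlevel_mono[OF assms(1), of "int N"] by simp
  then show "dmean j (\<lambda>y. \<bar>dmean (int N) g y - g y\<bar> powr q) x = 0" using assms(2) by (simp add: dmean_dlevel)
qed

text \<open>The cubes of level k contained in an open set fill it up as k grows. The indicator of
  their union is constant on cubes of level k and approximates that of the set by dominated
  convergence.\<close>

lemma dmean_open_tendsto:
  assumes U: "open U"
  shows "(\<lambda>N::nat. dmean j (\<lambda>y. \<bar>dmean (int N) (indicator U) y - indicator U y\<bar> powr 1) (x::real^'n::finite)) \<longlonglongrightarrow> 0"
proof (rule dmean_Lq_approx)
  have [measurable]: "U \<in> sets borel" using U by simp
  show "integrable (dmeas j x) (\<lambda>y. \<bar>indicator U y :: real\<bar> powr 1)"
    by (rule dmeas.integrable_const_bound[where B=1]) (simp_all add: indicator_def)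
  fix e :: real assume e: "e > 0"
  define u :: "nat \<Rightarrow> real^'n \<Rightarrow> real" where "u k = (\<lambda>y. of_bool (dcube (int k) y \<subseteq> U))" for k
  have lv: "dlevel (int k) (u k)" for k unfolding dlevel_def u_def by (auto simp: dcube_eq)
  have [measurable]: "u k \<in> borel_measurable borel" for k using lv by (rule dlevel_borel_measurable)
  have "(\<lambda>k. dmean j (\<lambda>y. \<bar>indicator U y - u k y\<bar> powr 1) x) \<longlonglongrightarrow> dmean j (\<lambda>y. 0) x"
    unfolding dmean_def
  proof (rule integral_dominated_convergence[where w="\<lambda>_. 2"])
    show "AE y in dmeas j x. (\<lambda>k. \<bar>indicator U y - u k y\<bar> powr 1) \<longlonglongrightarrow> 0"
    proof (intro AE_I2 tendsto_eventually)
      fix y show "\<forall>\<^sub>F k in sequentially. \<bar>indicator U y - u k y\<bar> powr 1 = 0"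
      proof (cases "y \<in> U")
        case True
        then show ?thesis using dcube_subset_open[OF U True] by (auto simp: eventually_sequentially u_def)
      next
        case False
        then have "\<not> dcube (int k) y \<subseteq> U" for k using dcube_self by blast
        then have "u k y = 0" for k unfolding u_def by simp
        then show ?thesis using False by simp
      qed
    qed
    show "AE y in dmeas j x. norm (\<bar>indicator U y - u k y\<bar> powr 1) \<le> 2" for k
      by (intro AE_I2) (auto simp: indicator_def u_def)
  qed auto
  then have "\<forall>\<^sub>F k in sequentially. dmean j (\<lambda>y. \<bar>indicator U y - u k y\<bar> powr 1) x < e"
    using e by (intro order_tendstoD(2)) auto
  then obtain k where "dmean j (\<lambda>y. \<bar>indicator U y - u k y\<bar> powr 1) x < e"
    by (auto simp: eventually_sequentially)
  moreover have "integrable (dmeas j x) (\<lambda>y. \<bar>u k y\<bar> powr 1)"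
    using lv by (rule dlevel_integrable[OF dlevel_comp])
  ultimately show "\<exists>g. Lq_martingale_limit 1 j x g \<and> dmean j (\<lambda>y. \<bar>indicator U y - g y\<bar> powr 1) x \<le> e"
    using dmean_dlevel_tendsto[OF lv[of k], of 1 j x] by (intro exI[of _ "u k"]) (auto simp: Lq_martingale_limit_def)
qed (use U in auto)

text \<open>A density argument along the construction of integrable functions. A measurable set is
  approximated from outside by open sets, by outer regularity of the finite Borel measure
  \<open>dmeas j x\<close>; pointwise dominated limits fall under
  \<open>dmean_Lq_approx\<close>.\<close>

lemma dmean_tendsto_L1:
  assumes "integrable (dmeas j (x::real^'n::finite)) f"
  shows "(\<lambda>N::nat. dmean j (\<lambda>y. \<bar>dmean (int N) f y - f y\<bar>) x) \<longlonglongrightarrow> 0"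
proof -
  have "(\<lambda>N::nat. dmean j (\<lambda>y. \<bar>dmean (int N) f y - f y\<bar> powr 1) x) \<longlonglongrightarrow> 0"
    using assms
  proof (induction rule: integrable_induct)
    case (base A c)
    then have [measurable]: "A \<in> sets borel" by simp
    have ind: "(\<lambda>N::nat. dmean j (\<lambda>y. \<bar>dmean (int N) (indicator A) y - indicator A y\<bar> powr 1) x) \<longlonglongrightarrow> 0"
    proof (rule dmean_Lq_approx)
      show "integrable (dmeas j x) (\<lambda>y. \<bar>indicator A y :: real\<bar> powr 1)"
        by (rule dmeas.integrable_const_bound[where B=1]) (simp_all add: indicator_def)
      fix e :: real assume e: "e > 0"
      have oreg: "emeasure (dmeas j x) A = (INF U\<in>{U. A \<subseteq> U \<and> open U}. emeasure (dmeas j x) U)"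
        by (rule outer_regular) auto
      then have "(INF U\<in>{U. A \<subseteq> U \<and> open U}. emeasure (dmeas j x) U) < emeasure (dmeas j x) A + ennreal e"
        using e unfolding oreg[symmetric] by (simp add: dmeas.emeasure_eq_measure ennreal_less_iff flip: ennreal_plus)
      then obtain U where U: "A \<subseteq> U" "open U" "emeasure (dmeas j x) U < emeasure (dmeas j x) A + ennreal e"
        by (auto simp: INF_less_iff)
      have [measurable]: "U \<in> sets borel" using U by simp
      have "measure (dmeas j x) U < measure (dmeas j x) A + e"
        using U(3) e by (simp add: dmeas.emeasure_eq_measure ennreal_less_iff flip: ennreal_plus)
      moreover have "dmean j (\<lambda>y. \<bar>indicator A y - indicator U y\<bar> powr 1) x = dmean j (\<lambda>y. indicator U y - indicator A y) x"
        unfolding dmean_def by (intro Bochner_Integration.integral_cong refl) (use U(1) in \<open>auto simp: indicator_def\<close>)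
      moreover have "dmean j (\<lambda>y. indicator U y - indicator A y) x = measure (dmeas j x) U - measure (dmeas j x) A"
        unfolding dmean_def by (subst Bochner_Integration.integral_diff) (auto simp: dmeas.emeasure_eq_measure)
      moreover have "integrable (dmeas j x) (\<lambda>y. \<bar>indicator U y :: real\<bar> powr 1)"
        by (rule dmeas.integrable_const_bound[where B=1]) (simp_all add: indicator_def)
      ultimately show "\<exists>g. Lq_martingale_limit 1 j x g \<and> dmean j (\<lambda>y. \<bar>indicator A y - g y\<bar> powr 1) x \<le> e"
        using dmean_open_tendsto[OF U(2), of j x] by (intro exI[of _ "indicator U"]) (auto simp: Lq_martingale_limit_def)
    qed auto
    have e: "dmean (int N) (\<lambda>y. indicator A y *\<^sub>R c) y = c * dmean (int N) (indicator A) y" for N y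
      using dmean_cmult[of "int N" c "indicator A" y] by (simp add: mult.commute)
    have e2: "\<bar>dmean (int N) (\<lambda>y. indicator A y *\<^sub>R c) y - indicator A y *\<^sub>R c\<bar> powr 1 = \<bar>c\<bar> * \<bar>dmean (int N) (indicator A) y - indicator A y\<bar> powr 1" for N y
      unfolding e by (simp add: abs_mult algebra_simps flip: abs_mult)
    show ?case unfolding e2 using tendsto_mult[OF tendsto_const[of "\<bar>c\<bar>"] ind] by simp
  next
    case (add f g)
    then have [measurable]: "f \<in> borel_measurable borel" "g \<in> borel_measurable borel" by (auto dest: dmeas_integrableD)
    show ?case
    proof (rule tendsto_sandwich[OF _ _ tendsto_const])
      show "(\<lambda>N. dmean j (\<lambda>y. \<bar>dmean (int N) f y - f y\<bar> powr 1) x + dmean j (\<lambda>y. \<bar>dmean (int N) g y - g y\<bar> powr 1) x) \<longlonglongrightarrow> 0"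
        using tendsto_add[OF add(3,4)] by simp
      show "\<forall>\<^sub>F N in sequentially. dmean j (\<lambda>y. \<bar>dmean (int N) (\<lambda>x. f x + g x) y - (f y + g y)\<bar> powr 1) x
          \<le> dmean j (\<lambda>y. \<bar>dmean (int N) f y - f y\<bar> powr 1) x + dmean j (\<lambda>y. \<bar>dmean (int N) g y - g y\<bar> powr 1) x"
        unfolding eventually_sequentially
      proof (intro exI allI impI)
        fix N assume "N \<ge> nat j"
        then have jN: "j \<le> int N" by simp
        have "dmean j (\<lambda>y. \<bar>dmean (int N) (\<lambda>x. f x + g x) y - (f y + g y)\<bar> powr 1) x
          \<le> dmean j (\<lambda>y. \<bar>dmean (int N) f y - f y\<bar> powr 1 + \<bar>dmean (int N) g y - g y\<bar> powr 1) x"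
        proof (rule dmean_mono)
          fix y assume y: "y \<in> dcube j x"
          have "dmean (int N) (\<lambda>x. f x + g x) y = dmean (int N) f y + dmean (int N) g y"
            by (intro dmean_add integrable_dmeas_sub[OF _ jN y] add)
          then show "\<bar>dmean (int N) (\<lambda>x. f x + g x) y - (f y + g y)\<bar> powr 1 \<le> \<bar>dmean (int N) f y - f y\<bar> powr 1 + \<bar>dmean (int N) g y - g y\<bar> powr 1"
            by simp
        qed (use add in auto)
        also have "\<dots> = dmean j (\<lambda>y. \<bar>dmean (int N) f y - f y\<bar> powr 1) x + dmean j (\<lambda>y. \<bar>dmean (int N) g y - g y\<bar> powr 1) x"
          by (intro dmean_add) (use add in auto)
        finally show "dmean j (\<lambda>y. \<bar>dmean (int N) (\<lambda>x. f x + g x) y - (f y + g y)\<bar> powr 1) x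
          \<le> dmean j (\<lambda>y. \<bar>dmean (int N) f y - f y\<bar> powr 1) x + dmean j (\<lambda>y. \<bar>dmean (int N) g y - g y\<bar> powr 1) x" .
      qed
    qed (auto intro!: always_eventually dmean_nonneg)
  next
    case (lim f s)
    have [measurable]: "f \<in> borel_measurable borel" "\<And>i. s i \<in> borel_measurable borel"
      using lim by (auto dest: dmeas_integrableD)
    show ?case
    proof (rule dmean_Lq_approx)
      fix e :: real assume e: "e > 0"
      have "(\<lambda>k. dmean j (\<lambda>y. \<bar>f y - s k y\<bar> powr 1) x) \<longlonglongrightarrow> dmean j (\<lambda>y. 0) x"
        unfolding dmean_def
      proof (rule integral_dominated_convergence[where w="\<lambda>y. 3 * \<bar>f y\<bar>"])
        show "AE y in dmeas j x. (\<lambda>k. \<bar>f y - s k y\<bar> powr 1) \<longlonglongrightarrow> 0"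
        proof (intro AE_I2)
          fix y
          have "(\<lambda>k. \<bar>f y - s k y\<bar>) \<longlonglongrightarrow> \<bar>f y - f y\<bar>" by (intro tendsto_intros lim.hyps) auto
          then show "(\<lambda>k. \<bar>f y - s k y\<bar> powr 1) \<longlonglongrightarrow> 0" by simp
        qed
        show "AE y in dmeas j x. norm (\<bar>f y - s k y\<bar> powr 1) \<le> 3 * \<bar>f y\<bar>" for k
        proof (intro AE_I2)
          fix y show "norm (\<bar>f y - s k y\<bar> powr 1) \<le> 3 * \<bar>f y\<bar>" using lim.hyps(3)[of y k] by simp
        qed
      qed (use lim in auto)
      then have "\<forall>\<^sub>F k in sequentially. dmean j (\<lambda>y. \<bar>f y - s k y\<bar> powr 1) x < e"
        using e by (intro order_tendstoD(2)) auto
      then obtain k where "dmean j (\<lambda>y. \<bar>f y - s k y\<bar> powr 1) x < e"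
        by (auto simp: eventually_sequentially)
      then show "\<exists>g. Lq_martingale_limit 1 j x g \<and> dmean j (\<lambda>y. \<bar>f y - g y\<bar> powr 1) x \<le> e"
        using lim.hyps(1)[of k] lim.IH[of k] by (intro exI[of _ "s k"]) (auto simp: Lq_martingale_limit_def)
    qed (use lim in auto)
  qed
  then show ?thesis by simp
qed

text \<open>Truncation reduces the claim to bounded functions, for which L^1 convergence implies L^q
  convergence.\<close>

lemma dmean_tendsto_Lq:
  assumes q: "q \<ge> 1" and [measurable]: "f \<in> borel_measurable borel"
    and fi: "integrable (dmeas j (x::real^'n::finite)) (\<lambda>y. \<bar>f y\<bar> powr q)"
  shows "(\<lambda>N::nat. dmean j (\<lambda>y. \<bar>dmean (int N) f y - f y\<bar> powr q) x) \<longlonglongrightarrow> 0"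
proof (rule dmean_Lq_approx[OF q _ fi])
  fix e :: real assume e: "e > 0"
  define g where "g B y = max (- real B) (min (real B) (f y))" for B :: nat and y
  have [measurable]: "g B \<in> borel_measurable borel" for B unfolding g_def by measurable
  have gB: "\<bar>g B y\<bar> \<le> real B" for B y by (auto simp: g_def)
  have gf: "\<bar>f y - g B y\<bar> \<le> \<bar>f y\<bar>" for B y by (auto simp: g_def)
  have "(\<lambda>B. dmean j (\<lambda>y. \<bar>f y - g B y\<bar> powr q) x) \<longlonglongrightarrow> dmean j (\<lambda>y. 0) x"
    unfolding dmean_def
  proof (rule integral_dominated_convergence[where w="\<lambda>y. \<bar>f y\<bar> powr q"])
    show "AE y in dmeas j x. (\<lambda>B. \<bar>f y - g B y\<bar> powr q) \<longlonglongrightarrow> 0"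
    proof (intro AE_I2 tendsto_eventually)
      fix y
      have "g B y = f y" if "nat \<lceil>\<bar>f y\<bar>\<rceil> \<le> B" for B
        using that by (auto simp: g_def nat_le_iff ceiling_le_iff)
      then show "\<forall>\<^sub>F B in sequentially. \<bar>f y - g B y\<bar> powr q = 0"
        unfolding eventually_sequentially by (intro exI[of _ "nat \<lceil>\<bar>f y\<bar>\<rceil>"]) simp
    qed
    show "AE y in dmeas j x. norm (\<bar>f y - g k y\<bar> powr q) \<le> \<bar>f y\<bar> powr q" for k
      using q gf by (intro AE_I2) (auto intro!: powr_mono2)
  qed (use fi in auto)
  then have "\<forall>\<^sub>F B in sequentially. dmean j (\<lambda>y. \<bar>f y - g B y\<bar> powr q) x < e"
    using e by (intro order_tendstoD(2)) auto
  then obtain B where B: "dmean j (\<lambda>y. \<bar>f y - g B y\<bar> powr q) x < e"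
    by (auto simp: eventually_sequentially)
  have gi: "integrable (dmeas j x) (\<lambda>y. \<bar>g B y\<bar> powr q)"
    by (rule dmeas.integrable_const_bound[where B="real B powr q"]) (use gB q in \<open>auto intro!: powr_mono2\<close>)
  have gi1: "integrable (dmeas k y) (g B)" for k y
    by (rule dmeas.integrable_const_bound[where B="real B"]) (use gB in auto)
  have "(\<lambda>N::nat. dmean j (\<lambda>y. \<bar>dmean (int N) (g B) y - g B y\<bar> powr q) x) \<longlonglongrightarrow> 0"
  proof (rule tendsto_sandwich[OF _ _ tendsto_const])
    \<comment> \<open>The truncated function and its averages are bounded by B, so q - 1 of the q
      factors of the error can be replaced by 2 B.\<close>
    show "(\<lambda>N. (2 * real B) powr (q - 1) * dmean j (\<lambda>y. \<bar>dmean (int N) (g B) y - g B y\<bar>) x) \<longlonglongrightarrow> 0"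
      using tendsto_mult[OF tendsto_const dmean_tendsto_L1[OF gi1]] by force
    have "dmean j (\<lambda>y. \<bar>dmean (int N) (g B) y - g B y\<bar> powr q) x \<le> (2 * real B) powr (q - 1) * dmean j (\<lambda>y. \<bar>dmean (int N) (g B) y - g B y\<bar>) x" for N
      unfolding dmean_cmult[symmetric]
    proof (rule dmean_mono)
      fix y
      have "\<bar>dmean (int N) (g B) y\<bar> \<le> dmean (int N) (\<lambda>y. real B) y"
        by (rule order_trans[OF dmean_abs_le dmean_mono]) (use gB in auto)
      then have "\<bar>dmean (int N) (g B) y - g B y\<bar> \<le> 2 * real B" using gB[of B y] by simp
      then have "\<bar>dmean (int N) (g B) y - g B y\<bar> powr (q - 1) * \<bar>dmean (int N) (g B) y - g B y\<bar> powr 1 \<le> (2 * real B) powr (q - 1) * \<bar>dmean (int N) (g B) y - g B y\<bar> powr 1"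
        using q by (intro mult_right_mono powr_mono2) auto
      then show "\<bar>dmean (int N) (g B) y - g B y\<bar> powr q \<le> (2 * real B) powr (q - 1) * \<bar>dmean (int N) (g B) y - g B y\<bar>"
        unfolding powr_add[symmetric] by simp
    qed (use gi1 in auto)
    then show "\<forall>\<^sub>F N in sequentially. dmean j (\<lambda>y. \<bar>dmean (int N) (g B) y - g B y\<bar> powr q) x \<le> (2 * real B) powr (q - 1) * dmean j (\<lambda>y. \<bar>dmean (int N) (g B) y - g B y\<bar>) x"
      by simp
  qed (auto intro!: always_eventually dmean_nonneg)
  then show "\<exists>g. Lq_martingale_limit q j x g \<and> dmean j (\<lambda>y. \<bar>f y - g y\<bar> powr q) x \<le> e"
    using B gi by (intro exI[of _ "g B"]) (auto simp: Lq_martingale_limit_def)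
qed auto

text \<open>The means of transfer from finite sums to limits: a uniform bound on the integrals
  yields both integrability and the same bound for an almost everywhere limit.\<close>

lemma Fatou_real:
  fixes F :: "nat \<Rightarrow> 'a \<Rightarrow> real"
  assumes i: "\<And>k. integrable M (F k)" and nn: "\<And>k y. F k y \<ge> 0" and [measurable]: "g \<in> borel_measurable M"
    and le: "\<And>k. (\<integral>y. F k y \<partial>M) \<le> D" and ae: "AE y in M. (\<lambda>k. F k y) \<longlonglongrightarrow> g y"
  shows "integrable M g" "(\<integral>y. g y \<partial>M) \<le> D"
proof -
  have [measurable]: "\<And>k. F k \<in> borel_measurable M" using i by auto
  have D: "D \<ge> 0" using order_trans[OF Bochner_Integration.integral_nonneg le[of 0]] nn by simp
  have g0: "AE y in M. g y \<ge> 0" using ae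
    by eventually_elim (use nn in \<open>auto intro: LIMSEQ_le_const\<close>)
  have "(\<integral>\<^sup>+y. ennreal (g y) \<partial>M) = (\<integral>\<^sup>+y. liminf (\<lambda>k. ennreal (F k y)) \<partial>M)"
  proof (rule nn_integral_cong_AE, use ae in eventually_elim)
    fix y assume "(\<lambda>k. F k y) \<longlonglongrightarrow> g y"
    then have "(\<lambda>k. ennreal (F k y)) \<longlonglongrightarrow> ennreal (g y)" by (rule tendsto_ennrealI)
    then show "ennreal (g y) = liminf (\<lambda>k. ennreal (F k y))" by (simp add: lim_imp_Liminf)
  qed
  also have "\<dots> \<le> liminf (\<lambda>k. \<integral>\<^sup>+y. ennreal (F k y) \<partial>M)" by (rule nn_integral_liminf) auto
  also have "\<dots> \<le> ennreal D"
  proof -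
    have "liminf (\<lambda>k. \<integral>\<^sup>+y. ennreal (F k y) \<partial>M) \<le> liminf (\<lambda>k. ennreal D)"
      using le nn by (intro Liminf_mono always_eventually allI, subst nn_integral_eq_integral[OF i]) (auto intro: ennreal_leI)
    then show ?thesis by (simp add: Liminf_const)
  qed
  finally have le: "(\<integral>\<^sup>+y. ennreal (g y) \<partial>M) \<le> ennreal D" .
  then show gi: "integrable M g" using g0 by (intro integrableI_nonneg) (auto intro: order.strict_trans1)
  show "(\<integral>y. g y \<partial>M) \<le> D" using le D unfolding nn_integral_eq_integral[OF gi g0] by simp
qed

text \<open>The dyadic maximal function truncated to the levels from \<open>j\<close> to
  \<open>j + d\<close>. The truncation makes it constant on cubes of level \<open>j + d\<close>,
  hence bounded on each cube.\<close>

primrec dmaximal :: "int \<Rightarrow> (real^'n \<Rightarrow> real) \<Rightarrow> nat \<Rightarrow> real^'n::finite \<Rightarrow> real" where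
  "dmaximal j g 0 = dmean j g"
| "dmaximal j g (Suc d) = (\<lambda>y. max (dmaximal j g d y) (dmean (j + int (Suc d)) g y))"

lemma dlevel_dmaximal: "dlevel (j + int d) (dmaximal j g d)"
proof (induction d)
  case (Suc d)
  have "dlevel (j + int (Suc d)) (dmaximal j g d)" using Suc by (rule dlevel_mono) simp
  then show ?case unfolding dmaximal.simps by (rule dlevel_comp2[OF _ dlevel_dmean, where h=max])
qed simp

lemma dmean_le_dmaximal: "k \<le> d \<Longrightarrow> dmean (j + int k) g y \<le> dmaximal j g d y"
  by (induction d) (auto simp: le_Suc_eq)

lemma dmaximal_nonneg: "(\<And>y. g y \<ge> 0) \<Longrightarrow> dmaximal j g d y \<ge> 0"
  by (induction d) (auto simp: dmean_nonneg intro: max.coboundedI1)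

text \<open>Pathwise form of Doob's inequality: summed over the levels, the increments on the right
  integrate to \<open>r/(r-1)\<close> times the integral of \<open>M\<^sup>r\<^sup>-\<^sup>1 g\<close>, as they are constant on the cubes of the
  respective level.\<close>
lemma max_powr_increment:
  fixes m x r :: real
  assumes "r > 1" "m \<ge> 0" "x \<ge> 0"
  shows "(max m x) powr r - m powr r \<le> r/(r-1) * (((max m x) powr (r-1) - m powr (r-1)) * x)"
proof (cases "x \<le> m")
  case True
  then show ?thesis by (simp add: max_def)
next
  case False
  define r' where "r' = r/(r-1)"
  have r': "r' > 1" "1/r + 1/r' = 1" "(r-1)*r' = r" using assms by (auto simp: r'_def field_simps)
  have "x * m powr (r-1) \<le> x powr r / r + (m powr (r-1)) powr r' / r'"
    by (rule Youngs_inequality) (use assms r' in auto)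
  also have "(m powr (r-1)) powr r' = m powr r" by (simp add: powr_powr r'(3))
  finally have "r' * (x * m powr (r-1)) \<le> r' * (x powr r / r + m powr r / r')"
    using r' by (intro mult_left_mono) auto
  also have "\<dots> = r' * (1/r) * x powr r + m powr r" using r' by (simp add: distrib_left)
  also have "r' * (1/r) = r' - 1" using r' assms by (simp add: r'_def field_simps)
  finally have "r' * (x * m powr (r-1)) \<le> (r' - 1) * x powr r + m powr r" .
  moreover have "x powr r = x powr (r-1) * x"
    using assms powr_add[of x "r-1" 1] by simp
  ultimately show ?thesis using False unfolding r'_def[symmetric] by (simp add: max_def algebra_simps)
qed

text \<open>Dividing by \<open>X powr (1/t')\<close> leaves the power 1/t of X on the left. This is
  legitimate because X is a real number, so the finiteness of the absorbed integral has to be known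
  beforehand.\<close>

lemma powr_absorb:
  fixes X K G t t' :: real
  assumes "X \<ge> 0" "K \<ge> 0" "G \<ge> 0" "t > 1" "1/t + 1/t' = 1" "X \<le> K * G powr (1/t) * X powr (1/t')"
  shows "X \<le> K powr t * G"
proof (cases "X = 0")
  case False
  with assms have Xp: "X > 0" by simp
  have "1/t = 1 - 1/t'" using assms(5) by linarith
  then have "X powr (1/t) = X / X powr (1/t')" using Xp by (simp add: powr_diff)
  also have "\<dots> \<le> K * G powr (1/t)" using assms(6) Xp by (simp add: field_simps)
  finally have "(X powr (1/t)) powr t \<le> (K * G powr (1/t)) powr t"
    using assms by (intro powr_mono2) auto
  then show ?thesis using Xp assms by (simp add: powr_powr powr_mult)
qed (use assms in simp)

text \<open>Telescoping over the levels bounds the mean of m^r by r' times the mean of m^(r-1) g.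
  Since (r-1) r' = r, Hoelder's inequality returns the mean of m^r to the power 1/r', which is
  absorbed. The constant does not involve \<open>d\<close>.\<close>

lemma dyadic_maximal_inequality:
  assumes r: "r > 1" and g0: "\<And>y. g y \<ge> 0" and [measurable]: "g \<in> borel_measurable borel"
    and gi: "integrable (dmeas j (x::real^'n::finite)) (\<lambda>y. g y powr r)"
  shows "dmean j (\<lambda>y. dmaximal j g d y powr r) x \<le> (r/(r-1)) powr r * dmean j (\<lambda>y. g y powr r) x"
proof -
  define r' where "r' = r/(r-1)"
  have r': "r' > 1" "1/r + 1/r' = 1" "1/r' + 1/r = 1" "(r-1)*r' = r" using r by (auto simp: r'_def field_simps)
  have gi': "integrable (dmeas j x) (\<lambda>y. \<bar>g y\<bar> powr r)" using gi g0 by simp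
  have g1: "integrable (dmeas j x) g"
    by (rule powr_dmean_le(1)[OF _ _ gi']) (use r in auto)
  define m where "m = dmaximal j g"
  have m0: "m d y \<ge> 0" for d y unfolding m_def by (rule dmaximal_nonneg[OF g0])
  have lm: "dlevel (j + int d) (\<lambda>y. m d y powr e)" for d e unfolding m_def by (rule dlevel_comp[OF dlevel_dmaximal])
  have [measurable]: "m d \<in> borel_measurable borel" for d
    unfolding m_def by (rule dlevel_borel_measurable[OF dlevel_dmaximal])
  have mi: "integrable (dmeas j x) (\<lambda>y. m d y powr e)" for d e using lm by (rule dlevel_integrable)
  have mgi: "integrable (dmeas j x) (\<lambda>y. m d y powr e * g y)" for d e using lm g1 by (rule dlevel_mult_integrable)
  have pd: "m d y powr r = m d y powr (r-1) * m d y" for d y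
    using m0[of d y] powr_add[of "m d y" "r-1" 1] by simp
  have main: "dmean j (\<lambda>y. m d y powr r) x \<le> r' * dmean j (\<lambda>y. m d y powr (r-1) * g y) x" for d
  proof (induction d)
    case 0
    have "dmean j (\<lambda>y. m 0 y powr r) x = dmean j (\<lambda>y. m 0 y powr (r-1) * dmean j g y) x"
      by (simp only: pd) (simp only: m_def dmaximal.simps)
    also have "\<dots> = dmean j (\<lambda>y. m 0 y powr (r-1) * g y) x"
      using dmean_dlevel_dmean[OF order_refl lm[of 0 "r-1", simplified] g1] .
    also have "\<dots> \<le> r' * dmean j (\<lambda>y. m 0 y powr (r-1) * g y) x"
    proof -
      have "0 \<le> dmean j (\<lambda>y. m 0 y powr (r-1) * g y) x" by (rule dmean_nonneg) (simp add: g0)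
      then show ?thesis using r' mult_right_mono[of 1 r' "dmean j (\<lambda>y. m 0 y powr (r-1) * g y) x"] by simp
    qed
    finally show ?case .
  next
    case (Suc d)
    define D where "D y = m (Suc d) y powr (r-1) - m d y powr (r-1)" for y
    have lD: "dlevel (j + int (Suc d)) D" unfolding D_def
      by (rule dlevel_comp2[OF lm dlevel_mono[OF lm], where h="(-)"]) simp
    have Di: "integrable (dmeas j x) (\<lambda>y. D y * dmean (j + int (Suc d)) g y)"
      by (rule dlevel_mult_integrable[OF lD dmean_integrable])
    have Dg: "integrable (dmeas j x) (\<lambda>y. D y * g y)"
      by (rule dlevel_mult_integrable[OF lD g1])
    have "dmean j (\<lambda>y. m (Suc d) y powr r) x
        \<le> dmean j (\<lambda>y. m d y powr r + r' * (D y * dmean (j + int (Suc d)) g y)) x"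
    proof (rule dmean_mono')
      fix y
      show "m (Suc d) y powr r \<le> m d y powr r + r' * (D y * dmean (j + int (Suc d)) g y)"
        using max_powr_increment[OF r, of "m d y" "dmean (j + int (Suc d)) g y"] m0[of d y]
        by (simp add: D_def m_def r'_def dmean_nonneg g0)
    qed (use mi Di in auto)
    also have "\<dots> = dmean j (\<lambda>y. m d y powr r) x + r' * dmean j (\<lambda>y. D y * dmean (j + int (Suc d)) g y) x"
      using mi Di by (simp add: dmean_add)
    also have "dmean j (\<lambda>y. D y * dmean (j + int (Suc d)) g y) x = dmean j (\<lambda>y. D y * g y) x"
      by (rule dmean_dlevel_dmean[OF _ lD g1]) simp
    also have "dmean j (\<lambda>y. m d y powr r) x + r' * dmean j (\<lambda>y. D y * g y) x
       \<le> r' * dmean j (\<lambda>y. m d y powr (r-1) * g y) x + r' * dmean j (\<lambda>y. D y * g y) x" using Suc by simp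
    also have "\<dots> = r' * dmean j (\<lambda>y. m d y powr (r-1) * g y + D y * g y) x"
      using mgi Dg by (simp add: dmean_add distrib_left)
    also have "\<dots> = r' * dmean j (\<lambda>y. m (Suc d) y powr (r-1) * g y) x"
      by (simp add: D_def algebra_simps)
    finally show ?case .
  qed
  define X where "X = dmean j (\<lambda>y. m d y powr r) x"
  define G where "G = dmean j (\<lambda>y. g y powr r) x"
  have X0: "X \<ge> 0" "G \<ge> 0" by (auto simp: X_def G_def intro!: dmean_nonneg)
  have "dmean j (\<lambda>y. \<bar>m d y powr (r-1) * g y\<bar>) x \<le> (dmean j (\<lambda>y. \<bar>m d y powr (r-1)\<bar> powr r') x) powr (1/r') * (dmean j (\<lambda>y. \<bar>g y\<bar> powr r) x) powr (1/r)"
    by (rule dmean_Hoelder) (use r r' gi' mi in \<open>auto simp: powr_powr\<close>)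
  then have "dmean j (\<lambda>y. m d y powr (r-1) * g y) x \<le> X powr (1/r') * G powr (1/r)"
    using r'(4) g0 m0 by (simp add: powr_powr X_def G_def)
  then have "r' * dmean j (\<lambda>y. m d y powr (r-1) * g y) x \<le> r' * (X powr (1/r') * G powr (1/r))"
    using r' by (intro mult_left_mono) auto
  with main[of d] have "X \<le> r' * G powr (1/r) * X powr (1/r')" unfolding X_def by (simp add: mult_ac)
  then have "X \<le> r' powr r * G" using X0 r r' by (intro powr_absorb) auto
  then show ?thesis unfolding X_def G_def m_def r'_def .
qed

section \<open>The John--Nirenberg inequality\<close>

text \<open>The oscillation bound is required on every cube instead of in the sense of an essential
  supremum, and \<open>b\<close> is strictly positive so that it can be divided by. Functions of
  norm 0 are reached by letting \<open>b\<close> tend to 0.\<close>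

definition bmo_le :: "(real^'n::finite \<Rightarrow> real) \<Rightarrow> real \<Rightarrow> bool" where
  "bmo_le a b \<longleftrightarrow> 0 < b \<and> a \<in> borel_measurable borel \<and> (\<forall>j x. integrable (dmeas j x) a)
     \<and> (\<forall>j x. dmean j (\<lambda>y. \<bar>a y - dmean j a x\<bar>) x \<le> b)"

lemma bmo_leD:
  assumes "bmo_le a b"
  shows "0 < b" "a \<in> borel_measurable borel" "integrable (dmeas j x) a" "dmean j (\<lambda>y. \<bar>a y - dmean j a x\<bar>) x \<le> b"
  using assms by (auto simp: bmo_le_def)

lemma bmo_step:
  fixes a :: "real^'n::finite \<Rightarrow> real"
  assumes "bmo_le a b" "y \<in> dcube j x"
  shows "\<bar>dmean (j+1) a y - dmean j a x\<bar> \<le> 2 powr real CARD('n) * b"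
proof -
  note a = bmo_leD[OF assms(1)]
  have "dmean (j+1) (\<lambda>y. a y - dmean j a x) y = dmean (j+1) a y - dmean j a x"
    using a by (subst dmean_diff) auto
  then have "\<bar>dmean (j+1) a y - dmean j a x\<bar> \<le> dmean (j+1) (\<lambda>y. \<bar>a y - dmean j a x\<bar>) y"
    using dmean_abs_le[of "j+1" "\<lambda>y. a y - dmean j a x" y] by simp
  also have "\<dots> \<le> 2 powr (real_of_int (j + 1 - j) * real CARD('n)) * dmean j (\<lambda>y. \<bar>a y - dmean j a x\<bar>) x"
    by (rule dmean_subcube_le) (use a assms(2) in auto)
  also have "\<dots> \<le> 2 powr real CARD('n) * b" using a(4)[of j x] by simp
  finally show ?thesis .
qed

lemma bmo_steps:
  fixes a :: "real^'n::finite \<Rightarrow> real"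
  assumes "bmo_le a b"
  shows "\<bar>dmean (j + int d) a y - dmean j a y\<bar> \<le> real d * (2 powr real CARD('n) * b)"
proof (induction d)
  case (Suc d)
  have "\<bar>dmean (j + int d + 1) a y - dmean (j + int d) a y\<bar> \<le> 2 powr real CARD('n) * b"
    by (rule bmo_step[OF assms]) simp
  moreover have e: "j + (1 + int d) = j + int d + 1" by simp
  ultimately show ?case using Suc unfolding of_nat_Suc e distrib_right mult_1 by linarith
qed simp

text \<open>The exponential integrability of John and Nirenberg. Stopping when the mean has moved by more
  than \<open>2 b\<close> selects at most half of the cube, and by the induction hypothesis each selected subcube
  contributes at most \<open>(3/2) * 6\<close> times its measure.\<close>
lemma john_nirenberg_exp:
  fixes a :: "real^'n::finite \<Rightarrow> real"
  assumes ab: "bmo_le a b" and th: "\<theta> = ln (3/2) / ((2 + 2 powr real CARD('n)) * b)"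
  shows "j \<le> N \<Longrightarrow> dmean j (\<lambda>y. exp (\<theta> * \<bar>dmean N a y - dmean j a x\<bar>)) x \<le> 6"
proof (induction "nat (N - j)" arbitrary: j x rule: less_induct)
  case less
  note a = bmo_leD[OF ab]
  define B where "B = 2 powr real CARD('n) * b"
  define c where "c = dmean j a x"
  define I where "I = {j<..N}"
  define S where "S k y \<longleftrightarrow> \<bar>dmean k a y - c\<bar> > 2 * b" for k y
  \<comment> \<open>\<open>T k\<close> is the indicator of the cubes selected at level k: those
    where k is the first level after j at which the mean of \<open>a\<close> has left the interval
    of radius 2 b around c.\<close>
  define T :: "int \<Rightarrow> real^'n \<Rightarrow> real" where "T k y = of_bool (S k y \<and> (\<forall>i\<in>{j<..<k}. \<not> S i y))" for k y
  define Ex where "Ex k y = exp (\<theta> * \<bar>dmean N a y - dmean k a y\<bar>)" for k y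
  have fI: "finite I" by (simp add: I_def)
  have B0: "B > 0" using a by (simp add: B_def)
  have th0: "\<theta> > 0" unfolding th using a by (intro divide_pos_pos mult_pos_pos add_pos_nonneg) auto
  \<comment> \<open>This equation determines \<theta>. Up to the level before the selection the mean
    has moved by at most 2 b, and the last step adds at most B.\<close>
  have thB: "exp (\<theta> * (2 * b + B)) = 3/2"
  proof -
    have "2 * b + B = (2 + 2 powr real CARD('n)) * b" by (simp add: B_def algebra_simps)
    then have "\<theta> = ln (3/2) / (2 * b + B)" unfolding th by simp
    then have "\<theta> * (2 * b + B) = ln (3/2)" using a B0 by simp
    then show ?thesis by simp
  qed
  have th2: "exp (\<theta> * u) \<le> 3/2" if "u \<le> 2 * b + B" for u
    using th0 that unfolding thB[symmetric] by simp
  have lT: "dlevel k (T k)" if "k \<in> I" for k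
  proof -
    have "S i y = S i z" if "i \<le> k" "y \<in> dcube k z" for i y z
      using dlevelD[OF dlevel_dmean_le[OF that(1)] that(2)] by (simp add: S_def)
    then show ?thesis unfolding dlevel_def T_def by auto
  qed
  have T01: "0 \<le> T k y" "T k y \<le> 1" for k y by (auto simp: T_def)
  have lEx: "dlevel N (Ex k)" if "k \<in> I" for k
    unfolding Ex_def by (rule dlevel_comp2[OF dlevel_dmean dlevel_dmean_le, where h="\<lambda>u v. exp (\<theta> * \<bar>u - v\<bar>)"])
      (use that in \<open>auto simp: I_def\<close>)
  \<comment> \<open>The selected cubes are disjoint: a point either survives all levels up to N or
    has exactly one stopping level.\<close>
  have cases_T: "(\<forall>k\<in>I. T k y = 0 \<and> \<not> S k y) \<or> (\<exists>k0\<in>I. S k0 y \<and> (\<forall>i\<in>{j<..<k0}. \<not> S i y) \<and> (\<forall>k\<in>I. T k y = (if k = k0 then 1 else 0)))" for y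
  proof (cases "\<exists>k\<in>I. S k y")
    case False
    then show ?thesis by (auto simp: T_def)
  next
    case True
    define k0 where "k0 = Min {k\<in>I. S k y}"
    have ne: "finite {k\<in>I. S k y}" "{k\<in>I. S k y} \<noteq> {}" using True fI by auto
    have k0: "k0 \<in> I" "S k0 y" using Min_in[OF ne] by (auto simp: k0_def)
    have le: "k0 \<le> k" if "k \<in> I" "S k y" for k using Min_le[OF ne(1), of k] that by (auto simp: k0_def)
    have b4: "\<not> S i y" if "i \<in> {j<..<k0}" for i using le[of i] that k0(1) by (auto simp: I_def)
    have "T k y = (if k = k0 then 1 else 0)" if "k \<in> I" for k
    proof (cases "k = k0")
      case True then show ?thesis using k0 b4 by (auto simp: T_def)
    next
      case False
      have "\<not> (S k y \<and> (\<forall>i\<in>{j<..<k}. \<not> S i y))"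
        using le[of k] that False k0 by (auto simp: I_def)
      then show ?thesis using False by (simp add: T_def)
    qed
    then show ?thesis using k0 b4 by blast
  qed
  have sumT: "(\<Sum>k\<in>I. T k y) \<le> 1" for y
    using cases_T[of y] fI by auto
  have point: "exp (\<theta> * \<bar>dmean N a y - c\<bar>) \<le> 3/2 + (\<Sum>k\<in>I. T k y * (3/2 * Ex k y))" if y: "y \<in> dcube j x" for y
  proof -
    have cy: "dmean j a y = c" unfolding c_def by (rule dmean_dcube_cong[OF y])
    consider (no) "\<forall>k\<in>I. T k y = 0 \<and> \<not> S k y"
      | (yes) k0 where "k0 \<in> I" "\<forall>i\<in>{j<..<k0}. \<not> S i y" "\<forall>k\<in>I. T k y = (if k = k0 then 1 else 0)"
      using cases_T[of y] by blast
    then show ?thesis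
    proof cases
      case no
      have "\<bar>dmean N a y - c\<bar> \<le> 2 * b"
      proof (cases "N = j")
        case True then show ?thesis using cy a by simp
      next
        case False
        then have "N \<in> I" using less.prems by (simp add: I_def)
        then show ?thesis using no by (auto simp: S_def)
      qed
      then show ?thesis using th2[of "\<bar>dmean N a y - c\<bar>"] B0 no by simp
    next
      case yes
      have "\<bar>dmean (k0 - 1) a y - c\<bar> \<le> 2 * b"
      proof (cases "k0 - 1 = j")
        case True then show ?thesis using cy a by simp
      next
        case False
        then have "k0 - 1 \<in> {j<..<k0}" using yes(1) by (simp add: I_def)
        from bspec[OF yes(2) this] show ?thesis by (simp add: S_def)
      qed
      moreover have "\<bar>dmean k0 a y - dmean (k0 - 1) a y\<bar> \<le> B"
        using bmo_step[OF ab dcube_self[of y "k0 - 1"]] by (simp add: B_def)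
      ultimately have "\<bar>dmean k0 a y - c\<bar> \<le> 2 * b + B" by linarith
      then have e: "exp (\<theta> * \<bar>dmean k0 a y - c\<bar>) \<le> 3/2" by (rule th2)
      have "exp (\<theta> * \<bar>dmean N a y - c\<bar>) \<le> exp (\<theta> * \<bar>dmean k0 a y - c\<bar> + \<theta> * \<bar>dmean N a y - dmean k0 a y\<bar>)"
        using th0 unfolding distrib_left[symmetric] by simp
      also have "\<dots> \<le> 3/2 * Ex k0 y" unfolding exp_add Ex_def by (intro mult_right_mono e) simp
      also have "\<dots> = (\<Sum>k\<in>I. T k y * (3/2 * Ex k y))"
      proof -
        have "(\<Sum>k\<in>I. T k y * (3/2 * Ex k y)) = (\<Sum>k\<in>I. if k = k0 then 3/2 * Ex k y else 0)"
          using yes(3) by (intro sum.cong refl) auto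
        then show ?thesis using yes(1) fI by simp
      qed
      finally show ?thesis by simp
    qed
  qed
  have Ti: "integrable (dmeas j x) (T k)" if "k \<in> I" for k using lT[OF that] by (rule dlevel_integrable)
  have Exi: "integrable (dmeas j x) (Ex k)" if "k \<in> I" for k using lEx[OF that] by (rule dlevel_integrable)
  have TEi: "integrable (dmeas j x) (\<lambda>y. T k y * (3/2 * Ex k y))" if "k \<in> I" for k
    using lT[OF that] Exi[OF that] by (intro dlevel_mult_integrable) auto
  have TE: "dmean j (\<lambda>y. T k y * (3/2 * Ex k y)) x \<le> 9 * dmean j (T k) x" if k: "k \<in> I" for k
  proof -
    have jk: "j \<le> k" using k by (simp add: I_def)
    have IH: "dmean k (Ex k) y \<le> 6" for y
    proof -
      have "dmean k (Ex k) y = dmean k (\<lambda>z. exp (\<theta> * \<bar>dmean N a z - dmean k a y\<bar>)) y"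
        unfolding Ex_def by (rule dmean_cong) (auto simp: dmean_dcube_cong)
      then show ?thesis using less.hyps[of k y] k by (simp add: I_def)
    qed
    have "dmean j (\<lambda>y. T k y * (3/2 * Ex k y)) x = 3/2 * dmean j (\<lambda>y. T k y * Ex k y) x"
      by (simp flip: dmean_cmult add: mult_ac)
    also have "dmean j (\<lambda>y. T k y * Ex k y) x = dmean j (\<lambda>y. T k y * dmean k (Ex k) y) x"
      by (rule dmean_dlevel_dmean[symmetric, OF jk lT[OF k] Exi[OF k]])
    also have "\<dots> \<le> dmean j (\<lambda>y. 6 * T k y) x"
    proof (rule dmean_mono')
      show "integrable (dmeas j x) (\<lambda>y. T k y * dmean k (Ex k) y)"
        by (rule dlevel_mult_integrable[OF lT[OF k]]) simp
      show "T k y * dmean k (Ex k) y \<le> 6 * T k y" for y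
        using mult_left_mono[OF IH[of y] T01(1)[of k y]] by simp
    qed (use Ti[OF k] in simp)
    finally show ?thesis by simp
  qed
  \<comment> \<open>Chebyshev's inequality: on a selected cube the mean of |a - c| exceeds 2 b,
    while over the whole cube it is at most b.\<close>
  have meas: "(\<Sum>k\<in>I. dmean j (T k) x) \<le> 1/2"
  proof -
    have aci: "integrable (dmeas j x) (\<lambda>y. \<bar>a y - c\<bar>)" using a by auto
    have "2 * b * dmean j (T k) x \<le> dmean j (\<lambda>y. T k y * \<bar>a y - c\<bar>) x" if k: "k \<in> I" for k
    proof -
      have jk: "j \<le> k" using k by (simp add: I_def)
      have "2 * b * dmean j (T k) x = dmean j (\<lambda>y. 2 * b * T k y) x" by simp
      also have "\<dots> \<le> dmean j (\<lambda>y. T k y * dmean k (\<lambda>y. \<bar>a y - c\<bar>) y) x"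
      proof (rule dmean_mono')
        show "integrable (dmeas j x) (\<lambda>y. T k y * dmean k (\<lambda>y. \<bar>a y - c\<bar>) y)"
          by (rule dlevel_mult_integrable[OF lT[OF k]]) simp
        fix y
        have "\<bar>dmean k a y - c\<bar> \<le> dmean k (\<lambda>y. \<bar>a y - c\<bar>) y"
          using dmean_abs_le[of k "\<lambda>y. a y - c" y] a by (simp add: dmean_diff)
        then show "2 * b * T k y \<le> T k y * dmean k (\<lambda>y. \<bar>a y - c\<bar>) y"
          by (auto simp: T_def S_def)
      qed (use Ti[OF k] in simp)
      also have "\<dots> = dmean j (\<lambda>y. T k y * \<bar>a y - c\<bar>) x"
        by (rule dmean_dlevel_dmean[OF jk lT[OF k] aci])
      finally show ?thesis .
    qed
    then have "2 * b * (\<Sum>k\<in>I. dmean j (T k) x) \<le> (\<Sum>k\<in>I. dmean j (\<lambda>y. T k y * \<bar>a y - c\<bar>) x)"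
      unfolding sum_distrib_left by (rule sum_mono)
    also have "\<dots> = dmean j (\<lambda>y. \<Sum>k\<in>I. T k y * \<bar>a y - c\<bar>) x"
      by (rule dmean_sum[symmetric], rule dlevel_mult_integrable[OF lT aci])
    also have "\<dots> \<le> dmean j (\<lambda>y. \<bar>a y - c\<bar>) x"
    proof (rule dmean_mono'[OF aci])
      show "integrable (dmeas j x) (\<lambda>y. \<Sum>k\<in>I. T k y * \<bar>a y - c\<bar>)"
        by (intro Bochner_Integration.integrable_sum dlevel_mult_integrable[OF lT aci])
      show "(\<Sum>k\<in>I. T k y * \<bar>a y - c\<bar>) \<le> \<bar>a y - c\<bar>" for y
        unfolding sum_distrib_right[symmetric] using mult_right_mono[OF sumT[of y], of "\<bar>a y - c\<bar>"] by simp
    qed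
    also have "\<dots> \<le> b" unfolding c_def by (rule a)
    finally show ?thesis using a(1) by (simp add: field_simps)
  qed
  have "dmean j (\<lambda>y. exp (\<theta> * \<bar>dmean N a y - c\<bar>)) x \<le> dmean j (\<lambda>y. 3/2 + (\<Sum>k\<in>I. T k y * (3/2 * Ex k y))) x"
  proof (rule dmean_mono'[OF _ _ point])
    show "integrable (dmeas j x) (\<lambda>y. exp (\<theta> * \<bar>dmean N a y - c\<bar>))"
      by (rule dlevel_integrable[of N], rule dlevel_comp) simp
  qed (use TEi in auto)
  also have "\<dots> = 3/2 + (\<Sum>k\<in>I. dmean j (\<lambda>y. T k y * (3/2 * Ex k y)) x)"
    using TEi by (simp add: dmean_add dmean_sum)
  also have "\<dots> \<le> 3/2 + (\<Sum>k\<in>I. 9 * dmean j (T k) x)" by (intro add_left_mono sum_mono TE)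
  \<comment> \<open>The constant 6 is the fixed point of u = 3/2 + (3/2) u / 2, which closes the
    induction.\<close>
  also have "\<dots> \<le> 6" using meas by (simp flip: sum_distrib_left)
  finally show ?case unfolding c_def .
qed

lemma powr_le_exp: "u powr r \<le> (r/\<theta>) powr r * exp (\<theta> * u)" if "u \<ge> 0" "r > 0" "\<theta> > 0" for u r \<theta> :: real
proof -
  have "(\<theta> * u / r) powr r \<le> exp (\<theta> * u / r) powr r"
  proof (intro powr_mono2)
    show "\<theta> * u / r \<le> exp (\<theta> * u / r)" using exp_ge_add_one_self[of "\<theta> * u / r"] by linarith
  qed (use that in auto)
  also have "\<dots> = exp (\<theta> * u)" using that by (simp add: powr_def)
  finally have "(r/\<theta>) powr r * (\<theta> * u / r) powr r \<le> (r/\<theta>) powr r * exp (\<theta> * u)"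
    by (intro mult_left_mono) auto
  then show ?thesis using that by (simp flip: powr_mult)
qed

lemma dmean_AE_subseq:
  assumes "integrable (dmeas j (x::real^'n::finite)) f"
  shows "\<exists>r. (\<forall>k. int (r k) \<ge> j) \<and> strict_mono r \<and> (AE y in dmeas j x. (\<lambda>k. dmean (int (r k)) f y) \<longlonglongrightarrow> f y)"
proof -
  have "\<exists>r::nat\<Rightarrow>nat. strict_mono r \<and> (AE y in dmeas j x. (\<lambda>n. dmean (int (r n)) f y - f y) \<longlonglongrightarrow> 0)"
    by (rule tendsto_L1_AE_subseq[where u="\<lambda>N y. dmean (int N) f y - f y"])
       (use assms dmean_tendsto_L1[OF assms] in \<open>auto simp: dmean_def[of j]\<close>)
  then obtain r :: "nat \<Rightarrow> nat" where r: "strict_mono r" "AE y in dmeas j x. (\<lambda>n. dmean (int (r n)) f y - f y) \<longlonglongrightarrow> 0"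
    by blast
  \<comment> \<open>Shifting the subsequence by \<open>nat j\<close> keeps all its levels at least
    \<open>j\<close>, the range of \<open>john_nirenberg_exp\<close>.\<close>
  have ge: "int (r (k + nat j)) \<ge> j" for k
    using seq_suble[OF r(1), of "k + nat j"] by linarith
  have "AE y in dmeas j x. (\<lambda>k. dmean (int (r (k + nat j))) f y) \<longlonglongrightarrow> f y"
    using r(2)
  proof eventually_elim
    fix y assume "(\<lambda>n. dmean (int (r n)) f y - f y) \<longlonglongrightarrow> 0"
    then have "(\<lambda>n. dmean (int (r n)) f y) \<longlonglongrightarrow> f y" by (rule LIM_zero_cancel)
    then show "(\<lambda>k. dmean (int (r (k + nat j))) f y) \<longlonglongrightarrow> f y"
      by (rule LIMSEQ_ignore_initial_segment[of "\<lambda>k. dmean (int (r k)) f y"])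
  qed
  moreover have "strict_mono (\<lambda>k. r (k + nat j))" using r(1) by (auto simp: strict_mono_def)
  ultimately show ?thesis using ge by (intro exI[of _ "\<lambda>k. r (k + nat j)"]) auto
qed

lemma tendsto_abs_powr: "(f \<longlongrightarrow> l) F \<Longrightarrow> r > 0 \<Longrightarrow> ((\<lambda>k. \<bar>f k\<bar> powr r) \<longlongrightarrow> \<bar>l\<bar> powr r) F" for f :: "_ \<Rightarrow> real"
  by (intro tendsto_powr' tendsto_intros) auto

text \<open>The r-th power is dominated by the exponential, whose mean is bounded uniformly in the
  level N; Fatou's lemma replaces the averages of \<open>a\<close> by \<open>a\<close>
  itself.\<close>

lemma john_nirenberg:
  assumes r: "r > 0"
  shows "\<exists>C>0. \<forall>(a::real^'n::finite \<Rightarrow> real) b j x. bmo_le a b \<longrightarrow>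
    integrable (dmeas j x) (\<lambda>y. \<bar>a y - dmean j a x\<bar> powr r) \<and>
    dmean j (\<lambda>y. \<bar>a y - dmean j a x\<bar> powr r) x \<le> (C * b) powr r"
proof -
  define K where "K = (2 + 2 powr real CARD('n)) / ln (3/2)"
  have K: "K > 0" unfolding K_def by (intro divide_pos_pos add_pos_nonneg) auto
  have "integrable (dmeas j x) (\<lambda>y. \<bar>a y - dmean j a x\<bar> powr r) \<and>
    dmean j (\<lambda>y. \<bar>a y - dmean j a x\<bar> powr r) x \<le> (6 powr (1/r) * r * K * b) powr r"
    if ab: "bmo_le a b" for a :: "real^'n \<Rightarrow> real" and b j x
  proof -
    note a = bmo_leD[OF ab]
    note [measurable] = a(2)
    define \<theta> where "\<theta> = ln (3/2) / ((2 + 2 powr real CARD('n)) * b)"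
    have th: "\<theta> > 0" unfolding \<theta>_def using a by (intro divide_pos_pos mult_pos_pos add_pos_nonneg) auto
    \<comment> \<open>1/\<theta> is proportional to b, which makes the final bound homogeneous in
      b.\<close>
    have rt: "r / \<theta> = r * K * b" by (simp add: \<theta>_def K_def)
    obtain \<sigma> where \<sigma>: "\<And>k. int (\<sigma> k) \<ge> j" "AE y in dmeas j x. (\<lambda>k. dmean (int (\<sigma> k)) a y) \<longlonglongrightarrow> a y"
      using dmean_AE_subseq[OF a(3), of j x] by auto
    define F where "F k y = \<bar>dmean (int (\<sigma> k)) a y - dmean j a x\<bar> powr r" for k y
    have Fi: "integrable (dmeas j x) (F k)" for k unfolding F_def
      by (rule dlevel_integrable[of "int (\<sigma> k)"], rule dlevel_comp) simp
    have Fle: "(\<integral>y. F k y \<partial>dmeas j x) \<le> 6 * (r/\<theta>) powr r" for k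
    proof -
      have "dmean j (F k) x \<le> dmean j (\<lambda>y. (r/\<theta>) powr r * exp (\<theta> * \<bar>dmean (int (\<sigma> k)) a y - dmean j a x\<bar>)) x"
      proof (rule dmean_mono'[OF _ Fi])
        show "integrable (dmeas j x) (\<lambda>y. (r/\<theta>) powr r * exp (\<theta> * \<bar>dmean (int (\<sigma> k)) a y - dmean j a x\<bar>))"
          by (rule dlevel_integrable[of "int (\<sigma> k)"], rule dlevel_comp) simp
      qed (use powr_le_exp[OF _ r th] in \<open>auto simp: F_def\<close>)
      also have "\<dots> \<le> (r/\<theta>) powr r * 6"
        unfolding dmean_cmult using john_nirenberg_exp[OF ab \<theta>_def \<sigma>(1)[of k], of x] by (intro mult_left_mono) auto
      finally show ?thesis by (simp add: dmean_def)
    qed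
    have AE: "AE y in dmeas j x. (\<lambda>k. F k y) \<longlonglongrightarrow> \<bar>a y - dmean j a x\<bar> powr r"
      using \<sigma>(2) by eventually_elim (auto simp: F_def intro!: tendsto_abs_powr tendsto_intros r)
    note Fa = Fatou_real[OF Fi _ _ Fle AE]
    have "6 * (r/\<theta>) powr r = (6 powr (1/r) * r * K * b) powr r"
      unfolding rt using r K a by (simp add: powr_mult powr_powr)
    then show ?thesis using Fa by (simp add: F_def dmean_def)
  qed
  moreover have "6 powr (1/r) * r * K > 0" using r K by simp
  ultimately show ?thesis by blast
qed

section \<open>Weighted estimates for BMO and Morrey functions\<close>

lemma integrable_powr_add:
  fixes u v :: "real^'n::finite \<Rightarrow> real"
  assumes q: "q \<ge> 0" and [measurable]: "u \<in> borel_measurable borel" "v \<in> borel_measurable borel"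
    and i: "integrable (dmeas j x) (\<lambda>y. \<bar>u y\<bar> powr q)" "integrable (dmeas j x) (\<lambda>y. \<bar>v y\<bar> powr q)"
  shows "integrable (dmeas j x) (\<lambda>y. \<bar>u y + v y\<bar> powr q)"
proof (rule integrable_dmeas_bound[where g="\<lambda>y. 3 powr q * (\<bar>u y\<bar> powr q + \<bar>v y\<bar> powr q)"])
  show "\<bar>\<bar>u y + v y\<bar> powr q\<bar> \<le> 3 powr q * (\<bar>u y\<bar> powr q + \<bar>v y\<bar> powr q)" for y
    using add3_powr_le[of "\<bar>u y\<bar>" "\<bar>v y\<bar>" 0 q] powr_mono2[of q "\<bar>u y + v y\<bar>" "\<bar>u y\<bar> + \<bar>v y\<bar>"] abs_triangle_ineq[of "u y" "v y"] q by simp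
qed (use i in auto)

lemma integrable_powr_sum:
  fixes u :: "'i \<Rightarrow> real^'n::finite \<Rightarrow> real"
  assumes q: "q \<ge> 0" and "finite J" "\<And>i. i \<in> J \<Longrightarrow> u i \<in> borel_measurable borel"
    "\<And>i. i \<in> J \<Longrightarrow> integrable (dmeas j x) (\<lambda>y. \<bar>u i y\<bar> powr q)"
  shows "integrable (dmeas j x) (\<lambda>y. \<bar>\<Sum>i\<in>J. u i y\<bar> powr q)"
  using assms(2-4)
proof (induction J rule: finite_induct)
  case (insert k J)
  then show ?case
    by (simp, intro integrable_powr_add[OF q]) (auto intro!: borel_measurable_sum)
qed simp

lemma integrable_powr_dlevel_mult:
  fixes u \<phi> :: "real^'n::finite \<Rightarrow> real"
  assumes "dlevel k \<phi>" "integrable (dmeas j x) (\<lambda>y. \<bar>u y\<bar> powr q)"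
  shows "integrable (dmeas j x) (\<lambda>y. \<bar>u y * \<phi> y\<bar> powr q)"
proof -
  have "integrable (dmeas j x) (\<lambda>y. \<bar>\<phi> y\<bar> powr q * \<bar>u y\<bar> powr q)"
    by (rule dlevel_mult_integrable[OF dlevel_comp[OF assms(1)] assms(2)])
  then show ?thesis by (simp add: abs_mult powr_mult mult.commute)
qed

lemma bmo_diff_powr_integrable:
  fixes a :: "real^'n::finite \<Rightarrow> real"
  assumes ab: "bmo_le a b" and r: "r > 0"
  shows "integrable (dmeas j x) (\<lambda>y. \<bar>a y - dmean i a y\<bar> powr r)"
proof -
  note [measurable] = bmo_leD(2)[OF ab]
  have "integrable (dmeas j x) (\<lambda>y. \<bar>a y - dmean j a x\<bar> powr r)"
    using john_nirenberg[OF r, where 'n='n] ab by blast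
  moreover have "integrable (dmeas j x) (\<lambda>y. \<bar>dmean j a x - dmean i a y\<bar> powr r)"
    by (rule dlevel_integrable[of i], rule dlevel_comp) simp
  ultimately have "integrable (dmeas j x) (\<lambda>y. \<bar>(a y - dmean j a x) + (dmean j a x - dmean i a y)\<bar> powr r)"
    using r by (intro integrable_powr_add) auto
  then show ?thesis by simp
qed

lemma bmo_Hoelder:
  assumes r: "r > 1"
  shows "\<exists>C>0. \<forall>(a::real^'n::finite \<Rightarrow> real) b g j x. bmo_le a b \<longrightarrow> g \<in> borel_measurable borel \<longrightarrow>
    integrable (dmeas j x) (\<lambda>y. \<bar>g y\<bar> powr r) \<longrightarrow>
    integrable (dmeas j x) (\<lambda>y. (a y - dmean j a x) * g y) \<and>
    dmean j (\<lambda>y. \<bar>(a y - dmean j a x) * g y\<bar>) x \<le> C * b * (dmean j (\<lambda>y. \<bar>g y\<bar> powr r) x) powr (1/r)"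
proof -
  define r' where "r' = r / (r - 1)"
  have r': "r' > 1" "1/r' + 1/r = 1" using r by (auto simp: r'_def field_simps)
  obtain C where C: "C > 0" "\<forall>(a::real^'n \<Rightarrow> real) b j x. bmo_le a b \<longrightarrow>
    integrable (dmeas j x) (\<lambda>y. \<bar>a y - dmean j a x\<bar> powr r') \<and>
    dmean j (\<lambda>y. \<bar>a y - dmean j a x\<bar> powr r') x \<le> (C * b) powr r'"
    using john_nirenberg[of r', where 'n='n] r' by auto
  have "integrable (dmeas j x) (\<lambda>y. (a y - dmean j a x) * g y) \<and>
    dmean j (\<lambda>y. \<bar>(a y - dmean j a x) * g y\<bar>) x \<le> C * b * (dmean j (\<lambda>y. \<bar>g y\<bar> powr r) x) powr (1/r)"
    if ab: "bmo_le a b" and [measurable]: "g \<in> borel_measurable borel"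
      and gi: "integrable (dmeas j x) (\<lambda>y. \<bar>g y\<bar> powr r)" for a g :: "real^'n \<Rightarrow> real" and b j x
  proof
    note [measurable] = bmo_leD(2)[OF ab]
    note J = C(2)[rule_format, OF ab, of j x]
    show "integrable (dmeas j x) (\<lambda>y. (a y - dmean j a x) * g y)"
      by (rule Hoelder(1)[OF r'(1) r r'(2)]) (use J gi in auto)
    have "((dmean j (\<lambda>y. \<bar>a y - dmean j a x\<bar> powr r') x) powr (1/r')) \<le> ((C * b) powr r') powr (1/r')"
      using r' J by (intro powr_mono2 dmean_nonneg) auto
    also have "\<dots> = C * b" using r' C(1) bmo_leD(1)[OF ab] by (simp add: powr_powr)
    finally have o: "(dmean j (\<lambda>y. \<bar>a y - dmean j a x\<bar> powr r') x) powr (1/r') \<le> C * b" .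
    have "dmean j (\<lambda>y. \<bar>(a y - dmean j a x) * g y\<bar>) x
      \<le> (dmean j (\<lambda>y. \<bar>a y - dmean j a x\<bar> powr r') x) powr (1/r') * (dmean j (\<lambda>y. \<bar>g y\<bar> powr r) x) powr (1/r)"
      by (rule dmean_Hoelder[OF r'(1) r r'(2)]) (use J gi in auto)
    also have "\<dots> \<le> C * b * (dmean j (\<lambda>y. \<bar>g y\<bar> powr r) x) powr (1/r)"
      by (intro mult_right_mono o) simp
    finally show "dmean j (\<lambda>y. \<bar>(a y - dmean j a x) * g y\<bar>) x \<le> C * b * (dmean j (\<lambda>y. \<bar>g y\<bar> powr r) x) powr (1/r)" .
  qed
  with C(1) show ?thesis by (intro exI[of _ C] conjI allI impI; simp)
qed

text \<open>Duality: tested against \<open>g = S\<^sup>t\<^sup>-\<^sup>1\<close>, the factor \<open>|a - dmean i a|\<close> is averaged over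
  cubes of level \<open>i\<close>, where Hoelder's inequality replaces it by \<open>b\<close> at the cost of the
  maximal function of \<open>g\<close>.\<close>
lemma bmo_weighted_sum:
  assumes t: "t > 1"
  shows "\<exists>C>0. \<forall>(a::real^'n::finite \<Rightarrow> real) b j x J \<phi>. bmo_le a b \<longrightarrow> finite J \<longrightarrow> (\<forall>i\<in>J. j \<le> i) \<longrightarrow>
     (\<forall>i\<in>J. dlevel i (\<phi> i) \<and> (\<forall>y. 0 \<le> \<phi> i y)) \<longrightarrow>
     integrable (dmeas j x) (\<lambda>y. (\<Sum>i\<in>J. \<bar>a y - dmean i a y\<bar> * \<phi> i y) powr t) \<and>
     dmean j (\<lambda>y. (\<Sum>i\<in>J. \<bar>a y - dmean i a y\<bar> * \<phi> i y) powr t) x \<le> (C * b) powr t * dmean j (\<lambda>y. (\<Sum>i\<in>J. \<phi> i y) powr t) x"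
proof -
  define t' where "t' = t / (t - 1)"
  \<comment> \<open>Only 1 < r < t' matters: r > 1 admits \<open>bmo_Hoelder\<close>, and r < t'
    makes \<rho> = t'/r an admissible exponent for the maximal function of g^r.\<close>
  define r where "r = (1 + t') / 2"
  define \<rho> where "\<rho> = t' / r"
  define A where "A = (\<rho> / (\<rho> - 1)) powr \<rho>"
  have t': "t' > 1" "1/t + 1/t' = 1" "1/t' + 1/t = 1" "(t-1)*t' = t" using t by (auto simp: t'_def field_simps)
  have r: "r > 1" "r < t'" using t' by (auto simp: r_def)
  have \<rho>: "\<rho> > 1" "r * \<rho> = t'" using r by (auto simp: \<rho>_def)
  have A: "A > 0" using \<rho> by (auto simp: A_def)
  obtain CJ where CJ: "CJ > 0" "\<forall>(a::real^'n \<Rightarrow> real) b g j x. bmo_le a b \<longrightarrow> g \<in> borel_measurable borel \<longrightarrow>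
    integrable (dmeas j x) (\<lambda>y. \<bar>g y\<bar> powr r) \<longrightarrow>
    integrable (dmeas j x) (\<lambda>y. (a y - dmean j a x) * g y) \<and>
    dmean j (\<lambda>y. \<bar>(a y - dmean j a x) * g y\<bar>) x \<le> CJ * b * (dmean j (\<lambda>y. \<bar>g y\<bar> powr r) x) powr (1/r)"
    using bmo_Hoelder[OF r(1), where 'n='n] by blast
  define C where "C = CJ * A powr (1/t')"
  have main: "integrable (dmeas j x) (\<lambda>y. (\<Sum>i\<in>J. \<bar>a y - dmean i a y\<bar> * \<phi> i y) powr t) \<and>
     dmean j (\<lambda>y. (\<Sum>i\<in>J. \<bar>a y - dmean i a y\<bar> * \<phi> i y) powr t) x \<le> (C * b) powr t * dmean j (\<lambda>y. (\<Sum>i\<in>J. \<phi> i y) powr t) x"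
    if ab: "bmo_le a b" and J: "finite J" "\<And>i. i \<in> J \<Longrightarrow> j \<le> i" and \<phi>: "\<And>i. i \<in> J \<Longrightarrow> dlevel i (\<phi> i)" "\<And>i y. i \<in> J \<Longrightarrow> 0 \<le> \<phi> i y"
    for a :: "real^'n \<Rightarrow> real" and b j x J and \<phi> :: "int \<Rightarrow> real^'n \<Rightarrow> real"
  proof -
    note a = bmo_leD[OF ab]
    note [measurable] = a(2)
    define S where "S y = (\<Sum>i\<in>J. \<bar>a y - dmean i a y\<bar> * \<phi> i y)" for y
    define W where "W y = (\<Sum>i\<in>J. \<phi> i y)" for y
    define g where "g y = S y powr (t - 1)" for y
    \<comment> \<open>The sum of the depths is a convenient upper bound for each of them, so the
      truncated maximal function sees every level of \<open>J\<close>.\<close>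
    define d where "d = (\<Sum>i\<in>J. nat (i - j))"
    define M where "M = dmaximal j (\<lambda>y. g y powr r) d"
    have [measurable]: "\<phi> i \<in> borel_measurable borel" if "i \<in> J" for i using \<phi>(1)[OF that] by (rule dlevel_borel_measurable)
    have [measurable]: "S \<in> borel_measurable borel" unfolding S_def by measurable
    have [measurable]: "g \<in> borel_measurable borel" unfolding g_def by measurable
    have S0: "S y \<ge> 0" for y unfolding S_def by (intro sum_nonneg mult_nonneg_nonneg \<phi>) auto
    have g0: "g y \<ge> 0" for y by (simp add: g_def)
    \<comment> \<open>Because (t-1) t' = t, the test function \<open>g\<close> has a finite L^t'
      mean exactly when \<open>S\<close> has a finite L^t mean.\<close>
    have gt: "g y powr t' = S y powr t" for y by (simp add: g_def powr_powr t'(4))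
    have Sg: "S y powr t = S y * g y" for y
      using S0[of y] powr_add[of "S y" 1 "t-1"] by (simp add: g_def)
    have "integrable (dmeas j x) (\<lambda>y. \<bar>S y\<bar> powr t)" unfolding S_def
    proof (rule integrable_powr_sum)
      fix i assume i: "i \<in> J"
      have "integrable (dmeas j x) (\<lambda>y. \<bar>\<bar>a y - dmean i a y\<bar>\<bar> powr t)"
        using bmo_diff_powr_integrable[OF ab, of t j x i] t by simp
      then show "integrable (dmeas j x) (\<lambda>y. \<bar>\<bar>a y - dmean i a y\<bar> * \<phi> i y\<bar> powr t)"
        by (rule integrable_powr_dlevel_mult[OF \<phi>(1)[OF i]])
    qed (use t J in auto)
    then have Si: "integrable (dmeas j x) (\<lambda>y. S y powr t)" using S0 by simp
    have gi: "integrable (dmeas j x) (\<lambda>y. \<bar>g y\<bar> powr t')" using Si gt g0 by simp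
    have gri: "integrable (dmeas j x) (\<lambda>y. \<bar>g y\<bar> powr r)"
      by (rule integrable_powr_mono[OF gi]) (use r in auto)
    have agi: "integrable (dmeas j x) (\<lambda>y. \<bar>a y - dmean i a y\<bar> * g y)" for i
      by (rule Hoelder(1)[OF t t'(1,2)]) (use gi bmo_diff_powr_integrable[OF ab, of t j x i] t in auto)
    have lM: "dlevel (j + int d) M" unfolding M_def by (rule dlevel_dmaximal)
    have [measurable]: "M \<in> borel_measurable borel" using lM by (rule dlevel_borel_measurable)
    have step: "dmean i (\<lambda>z. \<bar>a z - dmean i a z\<bar> * g z) y \<le> CJ * b * M y powr (1/r)" if i: "i \<in> J" and y: "y \<in> dcube j x" for i y
    proof -
      have ji: "j \<le> i" using J i by auto
      have "dmean i (\<lambda>z. \<bar>a z - dmean i a z\<bar> * g z) y = dmean i (\<lambda>z. \<bar>(a z - dmean i a y) * g z\<bar>) y"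
        using g0 by (intro dmean_cong) (auto simp: dmean_dcube_cong abs_mult)
      also have "\<dots> \<le> CJ * b * (dmean i (\<lambda>z. \<bar>g z\<bar> powr r) y) powr (1/r)"
        using CJ(2) ab integrable_dmeas_sub[OF gri ji y] by simp
      also have "\<dots> \<le> (CJ * b) * M y powr (1/r)"
      proof (intro mult_left_mono)
        have "nat (i - j) \<le> d" unfolding d_def by (rule member_le_sum[OF i _ J(1)]) auto
        then have "dmean (j + int (nat (i - j))) (\<lambda>y. g y powr r) y \<le> M y"
          unfolding M_def by (rule dmean_le_dmaximal)
        then show "(dmean i (\<lambda>z. \<bar>g z\<bar> powr r) y) powr (1/r) \<le> M y powr (1/r)"
          using ji g0 r by (intro powr_mono2) (auto intro!: dmean_nonneg)
      qed (use CJ(1) a(1) in auto)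
      finally show ?thesis .
    qed
    have "dmean j (\<lambda>y. S y powr t) x = dmean j (\<lambda>y. \<Sum>i\<in>J. \<phi> i y * (\<bar>a y - dmean i a y\<bar> * g y)) x"
      unfolding Sg by (simp add: S_def sum_distrib_right sum_distrib_left mult_ac)
    also have "\<dots> = (\<Sum>i\<in>J. dmean j (\<lambda>y. \<phi> i y * (\<bar>a y - dmean i a y\<bar> * g y)) x)"
      by (intro dmean_sum dlevel_mult_integrable[OF \<phi>(1) agi])
    also have "\<dots> = (\<Sum>i\<in>J. dmean j (\<lambda>y. \<phi> i y * dmean i (\<lambda>z. \<bar>a z - dmean i a z\<bar> * g z) y) x)"
      by (intro sum.cong refl dmean_dlevel_dmean[symmetric] J \<phi>(1) agi)
    also have "\<dots> = dmean j (\<lambda>y. \<Sum>i\<in>J. \<phi> i y * dmean i (\<lambda>z. \<bar>a z - dmean i a z\<bar> * g z) y) x"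
      by (intro dmean_sum[symmetric] dlevel_mult_integrable[OF \<phi>(1)] dmean_integrable)
    also have "\<dots> \<le> dmean j (\<lambda>y. CJ * b * (W y * M y powr (1/r))) x"
    proof (rule dmean_mono')
      have lW: "dlevel (j + int d) W" unfolding W_def
      proof (rule dlevel_sum, rule dlevel_mono[OF \<phi>(1)])
        fix i assume i: "i \<in> J"
        have "nat (i - j) \<le> d" unfolding d_def by (rule member_le_sum[OF i _ J(1)]) auto
        then show "i \<le> j + int d" by linarith
      qed
      have "dlevel (j + int d) (\<lambda>y. CJ * b * (W y * M y powr (1/r)))"
        by (rule dlevel_comp2[OF lW lM, where h="\<lambda>u v. CJ * b * (u * v powr (1/r))"])
      then show "integrable (dmeas j x) (\<lambda>y. CJ * b * (W y * M y powr (1/r)))" by (rule dlevel_integrable)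
      show "integrable (dmeas j x) (\<lambda>y. \<Sum>i\<in>J. \<phi> i y * dmean i (\<lambda>z. \<bar>a z - dmean i a z\<bar> * g z) y)"
        by (intro Bochner_Integration.integrable_sum dlevel_mult_integrable[OF \<phi>(1)] dmean_integrable)
      fix y assume y: "y \<in> dcube j x"
      have "(\<Sum>i\<in>J. \<phi> i y * dmean i (\<lambda>z. \<bar>a z - dmean i a z\<bar> * g z) y) \<le> (\<Sum>i\<in>J. \<phi> i y * (CJ * b * M y powr (1/r)))"
        by (intro sum_mono mult_left_mono step \<phi>(2) y)
      then show "(\<Sum>i\<in>J. \<phi> i y * dmean i (\<lambda>z. \<bar>a z - dmean i a z\<bar> * g z) y) \<le> CJ * b * (W y * M y powr (1/r))"
        by (simp add: W_def sum_distrib_left sum_distrib_right mult_ac)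
    qed
    also have "\<dots> = CJ * b * dmean j (\<lambda>y. W y * M y powr (1/r)) x" by simp
    also have "dmean j (\<lambda>y. W y * M y powr (1/r)) x \<le> (dmean j (\<lambda>y. W y powr t) x) powr (1/t) * (A * dmean j (\<lambda>y. S y powr t) x) powr (1/t')"
    proof -
      have W0: "W y \<ge> 0" for y unfolding W_def by (intro sum_nonneg \<phi>)
      have Wi: "integrable (dmeas j x) (\<lambda>y. \<bar>W y\<bar> powr t)" unfolding W_def
        by (rule integrable_powr_sum) (use t J in \<open>auto intro!: dlevel_integrable[OF dlevel_comp[OF \<phi>(1)]]\<close>)
      have [measurable]: "W \<in> borel_measurable borel" unfolding W_def by measurable
      have Me: "\<bar>M y powr (1/r)\<bar> powr t' = M y powr \<rho>" for y using r by (simp add: powr_powr \<rho>_def)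
      have H: "dmean j (\<lambda>y. \<bar>W y * M y powr (1/r)\<bar>) x \<le> (dmean j (\<lambda>y. \<bar>W y\<bar> powr t) x) powr (1/t) * (dmean j (\<lambda>y. \<bar>M y powr (1/r)\<bar> powr t') x) powr (1/t')"
      proof (rule dmean_Hoelder[OF t t'(1,2) _ _ Wi])
        show "integrable (dmeas j x) (\<lambda>y. \<bar>M y powr (1/r)\<bar> powr t')"
          by (rule dlevel_integrable, rule dlevel_comp[OF lM])
      qed auto
      have "dmean j (\<lambda>y. \<bar>M y powr (1/r)\<bar> powr t') x \<le> A * dmean j (\<lambda>y. S y powr t) x"
      proof -
        have e: "(g y powr r) powr \<rho> = S y powr t" for y by (simp add: powr_powr \<rho>(2) gt)
        show ?thesis unfolding Me unfolding A_def M_def e[symmetric]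
          by (rule dyadic_maximal_inequality[OF \<rho>(1)]) (use Si in \<open>auto simp: e\<close>)
      qed
      then have "(dmean j (\<lambda>y. \<bar>M y powr (1/r)\<bar> powr t') x) powr (1/t') \<le> (A * dmean j (\<lambda>y. S y powr t) x) powr (1/t')"
        using t' by (intro powr_mono2 dmean_nonneg) auto
      from order_trans[OF H mult_left_mono[OF this]] show ?thesis using W0 by (simp add: abs_mult)
    qed
    finally have "dmean j (\<lambda>y. S y powr t) x \<le> CJ * b * ((dmean j (\<lambda>y. W y powr t) x) powr (1/t) * (A * dmean j (\<lambda>y. S y powr t) x) powr (1/t'))"
      using CJ(1) a(1) by (simp add: mult_left_mono)
    also have "\<dots> = (C * b) * (dmean j (\<lambda>y. W y powr t) x) powr (1/t) * (dmean j (\<lambda>y. S y powr t) x) powr (1/t')"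
      using A by (simp add: powr_mult C_def dmean_nonneg)
    \<comment> \<open>The mean of S^t occurs on both sides, on the right only to the power 1/t'; it
      is finite by \<open>Si\<close> and can be absorbed.\<close>
    finally have "dmean j (\<lambda>y. S y powr t) x \<le> (C * b) powr t * dmean j (\<lambda>y. W y powr t) x"
      by (intro powr_absorb[OF _ _ _ t t'(2)]) (use CJ(1) a(1) A in \<open>auto simp: C_def intro!: dmean_nonneg\<close>)
    then show ?thesis using Si unfolding S_def W_def by simp
  qed
  have "C > 0" using CJ A by (simp add: C_def)
  then show ?thesis
  proof (intro exI[of _ C] conjI allI impI)
    fix a :: "real^'n \<Rightarrow> real" and b j x J and \<phi> :: "int \<Rightarrow> real^'n \<Rightarrow> real"
    assume "bmo_le a b" "finite J" "\<forall>i\<in>J. j \<le> i" "\<forall>i\<in>J. dlevel i (\<phi> i) \<and> (\<forall>y. 0 \<le> \<phi> i y)"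
    then have "integrable (dmeas j x) (\<lambda>y. (\<Sum>i\<in>J. \<bar>a y - dmean i a y\<bar> * \<phi> i y) powr t) \<and>
     dmean j (\<lambda>y. (\<Sum>i\<in>J. \<bar>a y - dmean i a y\<bar> * \<phi> i y) powr t) x \<le> (C * b) powr t * dmean j (\<lambda>y. (\<Sum>i\<in>J. \<phi> i y) powr t) x"
      by (intro main) auto
    then show "integrable (dmeas j x) (\<lambda>y. (\<Sum>i\<in>J. \<bar>a y - dmean i a y\<bar> * \<phi> i y) powr t)"
      "dmean j (\<lambda>y. (\<Sum>i\<in>J. \<bar>a y - dmean i a y\<bar> * \<phi> i y) powr t) x \<le> (C * b) powr t * dmean j (\<lambda>y. (\<Sum>i\<in>J. \<phi> i y) powr t) x"
      by auto
  qed
qed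

section \<open>Sums over levels\<close>

lemma sum_geometric_up:
  fixes k :: int
  assumes "\<gamma> > 0" "finite J" "\<And>i. i \<in> J \<Longrightarrow> k \<le> i"
  shows "(\<Sum>i\<in>J. 2 powr (- real_of_int i * \<gamma>)) \<le> 2 powr (- real_of_int k * \<gamma>) / (1 - 2 powr (-\<gamma>))"
proof -
  define z where "z = (2::real) powr (-\<gamma>)"
  have z: "0 < z" "z < 1" using assms(1) by (auto simp: z_def powr_less_one)
  have inj: "inj_on (\<lambda>i. nat (i - k)) J"
  proof (rule inj_onI)
    fix u v assume "u \<in> J" "v \<in> J" "nat (u - k) = nat (v - k)"
    then show "u = v" using assms(3)[of u] assms(3)[of v] by simp
  qed
  have "(\<Sum>i\<in>J. 2 powr (- real_of_int i * \<gamma>)) = (\<Sum>i\<in>J. 2 powr (- real_of_int k * \<gamma>) * z ^ nat (i - k))"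
  proof (intro sum.cong refl)
    fix i assume "i \<in> J"
    then have "real (nat (i - k)) = real_of_int i - real_of_int k" using assms(3) by simp
    then have "z ^ nat (i - k) = 2 powr (- \<gamma> * (real_of_int i - real_of_int k))"
      unfolding z_def by (simp add: powr_realpow[symmetric] powr_powr)
    then show "2 powr (- real_of_int i * \<gamma>) = 2 powr (- real_of_int k * \<gamma>) * z ^ nat (i - k)"
      by (simp flip: powr_add add: algebra_simps)
  qed
  also have "\<dots> = 2 powr (- real_of_int k * \<gamma>) * (\<Sum>m\<in>(\<lambda>i. nat (i - k)) ` J. z ^ m)"
    by (simp add: sum.reindex[OF inj] sum_distrib_left)
  also have "\<dots> \<le> 2 powr (- real_of_int k * \<gamma>) * (\<Sum>m. z ^ m)"
    using z assms(2) by (intro mult_left_mono sum_le_suminf summable_geometric) auto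
  also have "\<dots> = 2 powr (- real_of_int k * \<gamma>) / (1 - z)" using z by (simp add: suminf_geometric)
  finally show ?thesis unfolding z_def .
qed

lemma sum_geometric_down:
  fixes k :: int
  assumes "\<gamma> > 0" "finite J" "\<And>i. i \<in> J \<Longrightarrow> i \<le> k"
  shows "(\<Sum>i\<in>J. 2 powr (real_of_int i * \<gamma>)) \<le> 2 powr (real_of_int k * \<gamma>) / (1 - 2 powr (-\<gamma>))"
proof -
  have "(\<Sum>i\<in>J. 2 powr (real_of_int i * \<gamma>)) = (\<Sum>i\<in>uminus ` J. 2 powr (- real_of_int i * \<gamma>))"
    by (simp add: sum.reindex)
  also have "\<dots> \<le> 2 powr (- real_of_int (-k) * \<gamma>) / (1 - 2 powr (-\<gamma>))"
    by (rule sum_geometric_up) (use assms in auto)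
  finally show ?thesis by simp
qed

text \<open>Half of the exponent \<gamma> is spent on the linear factor, the other half keeps the
  series geometric. The linear factor will come from the drift of the means of \<open>a\<close> over
  k - i levels.\<close>

lemma sum_linear_geometric_down:
  assumes "\<gamma> > 0"
  shows "\<exists>C>0. \<forall>(k::int) J. finite J \<longrightarrow> (\<forall>i\<in>J. i \<le> k) \<longrightarrow>
    (\<Sum>i\<in>J. real_of_int (k - i) * 2 powr (real_of_int i * \<gamma>)) \<le> C * 2 powr (real_of_int k * \<gamma>)"
proof -
  define \<delta> where "\<delta> = \<gamma> / 2"
  have d: "\<delta> > 0" using assms by (simp add: \<delta>_def)
  define C where "C = 1 / (\<delta> * ln 2) / (1 - 2 powr (-\<delta>))"
  have m: "u \<le> 1 / (\<delta> * ln 2) * 2 powr (u * \<delta>)" for u :: real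
  proof -
    have "u * (\<delta> * ln 2) \<le> exp (u * (\<delta> * ln 2))" using exp_ge_add_one_self[of "u * (\<delta> * ln 2)"] by linarith
    also have "\<dots> = 2 powr (u * \<delta>)" by (simp add: powr_def mult_ac)
    finally show ?thesis using d by (simp add: field_simps)
  qed
  have "(\<Sum>i\<in>J. real_of_int (k - i) * 2 powr (real_of_int i * \<gamma>)) \<le> C * 2 powr (real_of_int k * \<gamma>)"
    if J: "finite J" "\<forall>i\<in>J. i \<le> k" for k :: int and J
  proof -
    have "(\<Sum>i\<in>J. real_of_int (k - i) * 2 powr (real_of_int i * \<gamma>)) \<le> (\<Sum>i\<in>J. 1 / (\<delta> * ln 2) * 2 powr (real_of_int k * \<delta>) * 2 powr (real_of_int i * \<delta>))"
    proof (intro sum_mono)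
      fix i assume "i \<in> J"
      have "real_of_int (k - i) * 2 powr (real_of_int i * \<gamma>) \<le> 1 / (\<delta> * ln 2) * 2 powr (real_of_int (k - i) * \<delta>) * 2 powr (real_of_int i * \<gamma>)"
        by (intro mult_right_mono m) simp
      also have "\<dots> = 1 / (\<delta> * ln 2) * 2 powr (real_of_int (k - i) * \<delta> + real_of_int i * \<gamma>)"
        unfolding powr_add by simp
      also have "real_of_int (k - i) * \<delta> + real_of_int i * \<gamma> = real_of_int k * \<delta> + real_of_int i * \<delta>"
        by (simp add: \<delta>_def field_simps)
      finally show "real_of_int (k - i) * 2 powr (real_of_int i * \<gamma>) \<le> 1 / (\<delta> * ln 2) * 2 powr (real_of_int k * \<delta>) * 2 powr (real_of_int i * \<delta>)"
        unfolding powr_add by simp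
    qed
    also have "\<dots> = 1 / (\<delta> * ln 2) * 2 powr (real_of_int k * \<delta>) * (\<Sum>i\<in>J. 2 powr (real_of_int i * \<delta>))"
      by (rule sum_distrib_left[symmetric])
    also have "\<dots> \<le> 1 / (\<delta> * ln 2) * 2 powr (real_of_int k * \<delta>) * (2 powr (real_of_int k * \<delta>) / (1 - 2 powr (-\<delta>)))"
      using d J by (intro mult_left_mono sum_geometric_down) auto
    also have "\<dots> = C * (2 powr (real_of_int k * \<delta>) * 2 powr (real_of_int k * \<delta>))" by (simp add: C_def)
    also have "\<dots> = C * 2 powr (real_of_int k * \<gamma>)" unfolding powr_add[symmetric] by (simp add: \<delta>_def mult.commute)
    finally show ?thesis .
  qed
  moreover have "C > 0" unfolding C_def using d by (intro divide_pos_pos) (auto simp: powr_less_one)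
  ultimately show ?thesis by blast
qed

text \<open>The two bounds under the minimum cross where 2^i = (A/F)^(1/\<beta>). Beyond this level
  the bound A is used and 2^(-i \<alpha>) decays; before it F 2^(i (\<beta> - \<alpha>)) grows, so
  each half is dominated by its term at the crossing.\<close>

lemma hedberg_sum:
  assumes "0 < \<alpha>" "\<alpha> < \<beta>"
  shows "\<exists>C>0. \<forall>A F J. 0 \<le> A \<longrightarrow> 0 < F \<longrightarrow> finite J \<longrightarrow>
    (\<Sum>i\<in>J. 2 powr (- real_of_int i * \<alpha>) * min A (F * 2 powr (real_of_int i * \<beta>))) \<le> C * (A powr (1 - \<alpha>/\<beta>) * F powr (\<alpha>/\<beta>))"
proof -
  define C1 where "C1 = 1 / (1 - 2 powr (-\<alpha>))"
  define C2 where "C2 = 1 / (1 - 2 powr (-(\<beta>-\<alpha>)))"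
  have C: "C1 > 0" "C2 > 0" using assms by (auto simp: C1_def C2_def powr_less_one)
  have "(\<Sum>i\<in>J. 2 powr (- real_of_int i * \<alpha>) * min A (F * 2 powr (real_of_int i * \<beta>))) \<le> (C1 + C2) * (A powr (1 - \<alpha>/\<beta>) * F powr (\<alpha>/\<beta>))"
    if "0 \<le> A" "0 < F" "finite J" for A F J
  proof (cases "A = 0")
    case True
    then have "(\<Sum>i\<in>J. 2 powr (- real_of_int i * \<alpha>) * min A (F * 2 powr (real_of_int i * \<beta>))) = 0"
      using that by (intro sum.neutral ballI) (simp add: min_def)
    then show ?thesis using True by simp
  next
    case False
    with that have A: "A > 0" by simp
    define u where "u = (A/F) powr (1/\<beta>)"
    have u: "u > 0" using A that by (simp add: u_def)
    \<comment> \<open>Since 2^k <= u <= 2^(k+1), with the upper half starting at k+1 and the lower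
      half ending at k, rounding u to a power of two is favourable in both halves.\<close>
    define k where "k = \<lfloor>log 2 u\<rfloor>"
    have k: "2 powr real_of_int k \<le> u" "u \<le> 2 powr real_of_int (k + 1)"
      using u by (auto simp: k_def powr_le_iff le_log_iff[symmetric] log_le_iff[symmetric])
    have e1: "A * u powr (-\<alpha>) = A powr (1 - \<alpha>/\<beta>) * F powr (\<alpha>/\<beta>)"
    proof -
      have "A * u powr (-\<alpha>) = A * (A/F) powr (-(\<alpha>/\<beta>))" using assms by (simp add: u_def powr_powr)
      also have "\<dots> = (A / A powr (\<alpha>/\<beta>)) * F powr (\<alpha>/\<beta>)" using A that by (simp add: powr_divide powr_minus field_simps)
      also have "A / A powr (\<alpha>/\<beta>) = A powr (1 - \<alpha>/\<beta>)" using A by (simp add: powr_diff)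
      finally show ?thesis .
    qed
    have e2: "F * u powr (\<beta>-\<alpha>) = A powr (1 - \<alpha>/\<beta>) * F powr (\<alpha>/\<beta>)"
    proof -
      have "F * u powr (\<beta>-\<alpha>) = F * (A/F) powr (1 - \<alpha>/\<beta>)" using assms by (simp add: u_def powr_powr field_simps)
      also have "\<dots> = A powr (1 - \<alpha>/\<beta>) * (F / F powr (1 - \<alpha>/\<beta>))" using A that by (simp add: powr_divide)
      also have "F / F powr (1 - \<alpha>/\<beta>) = F powr (\<alpha>/\<beta>)" using that by (simp add: powr_diff)
      finally show ?thesis .
    qed
    define J1 J2 where "J1 = {i\<in>J. k + 1 \<le> i}" and "J2 = {i\<in>J. i \<le> k}"
    have J12: "J = J1 \<union> J2" "J1 \<inter> J2 = {}" "finite J1" "finite J2" using that by (auto simp: J1_def J2_def)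
    have "(\<Sum>i\<in>J1. 2 powr (- real_of_int i * \<alpha>) * min A (F * 2 powr (real_of_int i * \<beta>))) \<le> (\<Sum>i\<in>J1. 2 powr (- real_of_int i * \<alpha>)) * A"
      unfolding sum_distrib_right by (intro sum_mono mult_left_mono) auto
    also have "\<dots> \<le> (2 powr (- real_of_int (k+1) * \<alpha>) / (1 - 2 powr (-\<alpha>))) * A"
      using A J12 assms by (intro mult_right_mono sum_geometric_up) (auto simp: J1_def)
    also have "2 powr (- real_of_int (k+1) * \<alpha>) \<le> u powr (-\<alpha>)"
    proof -
      have "2 powr (- real_of_int (k+1) * \<alpha>) = (2 powr real_of_int (k+1)) powr (-\<alpha>)" unfolding powr_powr by (simp add: algebra_simps)
      also have "\<dots> \<le> u powr (-\<alpha>)" using k u assms by (intro powr_mono2') auto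
      finally show ?thesis .
    qed
    finally have 1: "(\<Sum>i\<in>J1. 2 powr (- real_of_int i * \<alpha>) * min A (F * 2 powr (real_of_int i * \<beta>))) \<le> C1 * (A * u powr (-\<alpha>))"
      using A C by (simp add: C1_def divide_right_mono mult_right_mono mult_ac)
    have "(\<Sum>i\<in>J2. 2 powr (- real_of_int i * \<alpha>) * min A (F * 2 powr (real_of_int i * \<beta>))) \<le> (\<Sum>i\<in>J2. F * 2 powr (real_of_int i * (\<beta> - \<alpha>)))"
    proof (intro sum_mono)
      fix i
      have "2 powr (- real_of_int i * \<alpha>) * min A (F * 2 powr (real_of_int i * \<beta>)) \<le> 2 powr (- real_of_int i * \<alpha>) * (F * 2 powr (real_of_int i * \<beta>))"
        by (intro mult_left_mono) auto
      also have "\<dots> = F * 2 powr (- real_of_int i * \<alpha> + real_of_int i * \<beta>)" unfolding powr_add by simp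
      finally show "2 powr (- real_of_int i * \<alpha>) * min A (F * 2 powr (real_of_int i * \<beta>)) \<le> F * 2 powr (real_of_int i * (\<beta> - \<alpha>))"
        by (simp add: algebra_simps)
    qed
    also have "\<dots> \<le> F * (2 powr (real_of_int k * (\<beta> - \<alpha>)) / (1 - 2 powr (-(\<beta>-\<alpha>))))"
      unfolding sum_distrib_left[symmetric]
      using that(2) J12 assms by (intro mult_left_mono sum_geometric_down) (auto simp: J2_def)
    also have "2 powr (real_of_int k * (\<beta> - \<alpha>)) \<le> u powr (\<beta>-\<alpha>)"
    proof -
      have "2 powr (real_of_int k * (\<beta> - \<alpha>)) = (2 powr real_of_int k) powr (\<beta>-\<alpha>)" unfolding powr_powr by simp
      also have "\<dots> \<le> u powr (\<beta>-\<alpha>)" using k u assms by (intro powr_mono2) auto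
      finally show ?thesis .
    qed
    finally have 2: "(\<Sum>i\<in>J2. 2 powr (- real_of_int i * \<alpha>) * min A (F * 2 powr (real_of_int i * \<beta>))) \<le> C2 * (F * u powr (\<beta>-\<alpha>))"
      using that(2) C by (simp add: C2_def divide_right_mono mult_right_mono mult_ac)
    have "(\<Sum>i\<in>J. 2 powr (- real_of_int i * \<alpha>) * min A (F * 2 powr (real_of_int i * \<beta>))) = (\<Sum>i\<in>J1. 2 powr (- real_of_int i * \<alpha>) * min A (F * 2 powr (real_of_int i * \<beta>))) + (\<Sum>i\<in>J2. 2 powr (- real_of_int i * \<alpha>) * min A (F * 2 powr (real_of_int i * \<beta>)))"
      unfolding J12(1) by (rule sum.union_disjoint) (use J12 in auto)
    also have "\<dots> \<le> (C1 + C2) * (A powr (1 - \<alpha>/\<beta>) * F powr (\<alpha>/\<beta>))"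
      using 1 2 unfolding e1 e2 distrib_right by linarith
    finally show ?thesis .
  qed
  moreover have "C1 + C2 > 0" using C by simp
  ultimately show ?thesis by blast
qed

text \<open>The Morrey norm on a cube is |Q|^(1/p) times the q-mean, since |Q|^(-1/q) turns the
  integral into a mean; at level \<open>j\<close> the factor |Q|^(1/p) is 2^(-j n/p). As in
  \<open>bmo_le\<close>, the bound is strictly positive.\<close>

definition morrey_le :: "real \<Rightarrow> real \<Rightarrow> (real^'n::finite \<Rightarrow> real) \<Rightarrow> real \<Rightarrow> bool" where
  "morrey_le p q f F \<longleftrightarrow> 0 < F \<and> f \<in> borel_measurable borel \<and> (\<forall>j x. integrable (dmeas j x) (\<lambda>y. \<bar>f y\<bar> powr q))
     \<and> (\<forall>j x. (dmean j (\<lambda>y. \<bar>f y\<bar> powr q) x) powr (1/q) \<le> F * 2 powr (real_of_int j * (real CARD('n) / p)))"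

lemma morrey_leD:
  assumes "morrey_le p q (f::real^'n::finite \<Rightarrow> real) F"
  shows "0 < F" "f \<in> borel_measurable borel" "integrable (dmeas j x) (\<lambda>y. \<bar>f y\<bar> powr q)"
    "(dmean j (\<lambda>y. \<bar>f y\<bar> powr q) x) powr (1/q) \<le> F * 2 powr (real_of_int j * (real CARD('n) / p))"
  using assms by (auto simp: morrey_le_def)

lemma morrey_le_powr_mean:
  assumes f: "morrey_le p q (f::real^'n::finite \<Rightarrow> real) F" and r: "0 < r" "r \<le> q"
  shows "(dmean j (\<lambda>y. \<bar>f y\<bar> powr r) x) powr (1/r) \<le> F * 2 powr (real_of_int j * (real CARD('n) / p))"
  using dmean_powr_mono[OF morrey_leD(3)[OF f] r morrey_leD(2)[OF f]] morrey_leD(4)[OF f] by (rule order_trans)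

text \<open>Each r-mean is bounded by the maximal function of |f|^r to the power 1/r and by the
  Morrey bound of its level. \<open>hedberg_sum\<close> yields the power p/s of the former, and t
  p/s = q, so the t-th power is the maximal function to the power q/r > 1, where the maximal
  inequality applies.\<close>

lemma morrey_riesz_near:
  assumes \<alpha>: "0 < \<alpha>" and q: "1 < q" "q \<le> p" and st: "0 < t" "0 < s" and r: "1 \<le> r" "r < q"
    and ts: "t / s = q / p" and s: "1 / s = 1 / p - \<alpha> / real CARD('n::finite)"
  shows "\<exists>C>0. \<forall>(f::real^'n \<Rightarrow> real) F j x J. morrey_le p q f F \<longrightarrow> finite J \<longrightarrow> (\<forall>i\<in>J. j \<le> i) \<longrightarrow>
     dmean j (\<lambda>y. (\<Sum>i\<in>J. 2 powr (- real_of_int i * \<alpha>) * (dmean i (\<lambda>z. \<bar>f z\<bar> powr r) y) powr (1/r)) powr t) x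
       \<le> (C * F * 2 powr (real_of_int j * (real CARD('n) / s))) powr t"
proof -
  define n where "n = real CARD('n)"
  define \<beta> where "\<beta> = n / p"
  define \<rho> where "\<rho> = q / r"
  define A0 where "A0 = (\<rho> / (\<rho> - 1)) powr \<rho>"
  have n: "n > 0" by (simp add: n_def)
  have p: "p > 0" using q by simp
  have bs: "\<beta> - \<alpha> = n / s" using s n unfolding \<beta>_def n_def[symmetric] by (simp add: field_simps)
  then have ab: "\<alpha> < \<beta>" using n st by (smt (verit) divide_pos_pos)
  have ps: "1 - \<alpha> / \<beta> = p / s" using bs ab \<alpha> n p st by (simp add: \<beta>_def field_simps)
  have pst: "p / s * t = q" using ts p st by (simp add: field_simps)
  have \<rho>: "\<rho> > 1" using r by (simp add: \<rho>_def)
  have A0: "A0 > 0" using \<rho> by (simp add: A0_def)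
  obtain C1 where C1: "C1 > 0" "\<forall>A F J. 0 \<le> A \<longrightarrow> 0 < F \<longrightarrow> finite J \<longrightarrow>
    (\<Sum>i\<in>J. 2 powr (- real_of_int i * \<alpha>) * min A (F * 2 powr (real_of_int i * \<beta>))) \<le> C1 * (A powr (1 - \<alpha>/\<beta>) * F powr (\<alpha>/\<beta>))"
    using hedberg_sum[OF \<alpha> ab] by blast
  define C where "C = C1 * A0 powr (1/t)"
  have main: "dmean j (\<lambda>y. (\<Sum>i\<in>J. 2 powr (- real_of_int i * \<alpha>) * (dmean i (\<lambda>z. \<bar>f z\<bar> powr r) y) powr (1/r)) powr t) x
       \<le> (C * F * 2 powr (real_of_int j * (n / s))) powr t"
    if f: "morrey_le p q f F" and J: "finite J" "\<And>i. i \<in> J \<Longrightarrow> j \<le> i" for f :: "real^'n \<Rightarrow> real" and F j x J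
  proof -
    note fD = morrey_leD[OF f]
    note [measurable] = fD(2)
    define d where "d = (\<Sum>i\<in>J. nat (i - j))"
    define M where "M = dmaximal j (\<lambda>y. \<bar>f y\<bar> powr r) d"
    define W where "W y = (\<Sum>i\<in>J. 2 powr (- real_of_int i * \<alpha>) * (dmean i (\<lambda>z. \<bar>f z\<bar> powr r) y) powr (1/r))" for y
    have lM: "dlevel (j + int d) M" unfolding M_def by (rule dlevel_dmaximal)
    have [measurable]: "M \<in> borel_measurable borel" using lM by (rule dlevel_borel_measurable)
    have W0: "W y \<ge> 0" for y unfolding W_def by (intro sum_nonneg) auto
    have Wle: "W y \<le> C1 * ((M y powr (1/r)) powr (p/s) * F powr (1 - p/s))" for y
    proof -
      have "W y \<le> (\<Sum>i\<in>J. 2 powr (- real_of_int i * \<alpha>) * min (M y powr (1/r)) (F * 2 powr (real_of_int i * \<beta>)))"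
        unfolding W_def
      proof (intro sum_mono mult_left_mono)
        fix i assume i: "i \<in> J"
        have "nat (i - j) \<le> d" unfolding d_def by (rule member_le_sum[OF i _ J(1)]) auto
        then have "dmean (j + int (nat (i - j))) (\<lambda>y. \<bar>f y\<bar> powr r) y \<le> M y"
          unfolding M_def by (rule dmean_le_dmaximal)
        then have "(dmean i (\<lambda>z. \<bar>f z\<bar> powr r) y) powr (1/r) \<le> M y powr (1/r)"
          using J(2)[OF i] r by (intro powr_mono2) (auto intro!: dmean_nonneg)
        moreover have "(dmean i (\<lambda>z. \<bar>f z\<bar> powr r) y) powr (1/r) \<le> F * 2 powr (real_of_int i * \<beta>)"
          unfolding \<beta>_def n_def by (rule morrey_le_powr_mean[OF f]) (use r in auto)
        ultimately show "(dmean i (\<lambda>z. \<bar>f z\<bar> powr r) y) powr (1/r) \<le> min (M y powr (1/r)) (F * 2 powr (real_of_int i * \<beta>))"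
          by simp
      qed simp
      also have "\<dots> \<le> C1 * ((M y powr (1/r)) powr (1 - \<alpha>/\<beta>) * F powr (\<alpha>/\<beta>))"
        by (rule C1(2)[rule_format]) (use fD(1) J in auto)
      also have "\<alpha>/\<beta> = 1 - p/s" using ps by simp
      finally show ?thesis by simp
    qed
    have Wt: "W y powr t \<le> C1 powr t * F powr (t - q) * M y powr \<rho>" for y
    proof -
      have "W y powr t \<le> (C1 * ((M y powr (1/r)) powr (p/s) * F powr (1 - p/s))) powr t"
        using st by (intro powr_mono2 Wle W0) auto
      also have "\<dots> = C1 powr t * (F powr ((1 - p/s) * t) * M y powr (1/r * (p/s * t)))"
        using C1 by (simp add: powr_mult powr_powr)
      also have "(1 - p/s) * t = t - q" using pst by (simp add: algebra_simps)
      finally show ?thesis unfolding pst by (simp add: \<rho>_def)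
    qed
    have "dmean j (\<lambda>y. W y powr t) x \<le> dmean j (\<lambda>y. C1 powr t * F powr (t - q) * M y powr \<rho>) x"
    proof (rule dmean_mono)
      show "integrable (dmeas j x) (\<lambda>y. C1 powr t * F powr (t - q) * M y powr \<rho>)"
        by (rule dlevel_integrable, rule dlevel_comp[OF lM])
    qed (use Wt in \<open>auto simp: W_def\<close>)
    also have "\<dots> = C1 powr t * F powr (t - q) * dmean j (\<lambda>y. M y powr \<rho>) x" by simp
    also have "\<dots> \<le> C1 powr t * F powr (t - q) * (A0 * dmean j (\<lambda>y. (\<bar>f y\<bar> powr r) powr \<rho>) x)"
      unfolding M_def A0_def using fD(3)[of j x] r
      by (intro mult_left_mono dyadic_maximal_inequality[OF \<rho>]) (auto simp: powr_powr \<rho>_def)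
    also have "(\<lambda>y. (\<bar>f y\<bar> powr r) powr \<rho>) = (\<lambda>y. \<bar>f y\<bar> powr q)" using r by (simp add: powr_powr \<rho>_def)
    also have "C1 powr t * F powr (t - q) * (A0 * dmean j (\<lambda>y. \<bar>f y\<bar> powr q) x) \<le> C1 powr t * F powr (t - q) * (A0 * (F * 2 powr (real_of_int j * \<beta>)) powr q)"
    proof (intro mult_left_mono)
      have "((dmean j (\<lambda>y. \<bar>f y\<bar> powr q) x) powr (1/q)) powr q \<le> (F * 2 powr (real_of_int j * \<beta>)) powr q"
        using fD(4)[of j x] q by (intro powr_mono2) (auto simp: \<beta>_def n_def)
      then show "dmean j (\<lambda>y. \<bar>f y\<bar> powr q) x \<le> (F * 2 powr (real_of_int j * \<beta>)) powr q"
        using q by (simp add: powr_powr dmean_nonneg)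
    qed (use A0 in auto)
    also have "\<dots> = C1 powr t * A0 * (F powr (t - q) * F powr q) * 2 powr (real_of_int j * (\<beta> * q))"
      using fD(1) by (simp add: powr_mult powr_powr mult_ac)
    also have "F powr (t - q) * F powr q = F powr t" by (simp flip: powr_add)
    \<comment> \<open>The exponent relation again: the scaling n/p at the power q is the scaling n/s
      at the power t.\<close>
    also have "\<beta> * q = n / s * t" using ts p st by (simp add: \<beta>_def field_simps)
    also have "C1 powr t * A0 * F powr t * 2 powr (real_of_int j * (n / s * t)) = (C * F * 2 powr (real_of_int j * (n / s))) powr t"
      using C1 A0 fD(1) st by (simp add: C_def powr_mult powr_powr mult_ac)
    finally show ?thesis unfolding W_def .
  qed
  have "C > 0" using C1 A0 by (simp add: C_def)
  with main show ?thesis unfolding n_def by (intro exI[of _ C]) auto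
qed

lemma add4_powr_le: "(a + b + c * (d + e)) powr q \<le> 9 powr q * (a powr q + b powr q + c powr q * (d powr q + e powr q))"
  if "a \<ge> 0" "b \<ge> 0" "c \<ge> 0" "d \<ge> 0" "e \<ge> 0" "q \<ge> 0" for a b c d e q :: real
proof -
  have "(a + b + c * (d + e)) powr q \<le> 3 powr q * (a powr q + b powr q + (c * (d + e)) powr q)"
    using that by (intro add3_powr_le) auto
  also have "(c * (d + e)) powr q \<le> c powr q * (3 powr q * (d powr q + e powr q))"
    using add3_powr_le[of d e 0 q] that by (simp add: powr_mult mult_left_mono)
  finally have "(a + b + c * (d + e)) powr q \<le> 3 powr q * (a powr q + b powr q + c powr q * (3 powr q * (d powr q + e powr q)))"
    by simp
  also have "\<dots> \<le> 3 powr q * (3 powr q * (a powr q + b powr q + c powr q * (d powr q + e powr q)))"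
  proof (intro mult_left_mono)
    have "(1::real) \<le> 3 powr q" using that ge_one_powr_ge_zero by simp
    from mult_right_mono[OF this, of "a powr q + b powr q"]
    show "a powr q + b powr q + c powr q * (3 powr q * (d powr q + e powr q)) \<le> 3 powr q * (a powr q + b powr q + c powr q * (d powr q + e powr q))"
      by (simp add: algebra_simps)
  qed simp
  also have "\<dots> = 9 powr q * (a powr q + b powr q + c powr q * (d powr q + e powr q))"
    by (simp flip: powr_mult mult.assoc)
  finally show ?thesis .
qed

text \<open>The function \<open>H\<close> is arbitrary and the constant does not depend on the
  finite set \<open>J\<close>, so the estimate applies to every partial sum of the commutator and
  survives the passage to the limit.\<close>

lemma commutator_mean_bound:
  assumes \<alpha>: "0 < \<alpha>" and q: "1 < q" "q \<le> p" and st: "1 < t" "0 < s"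
    and ts: "t / s = q / p" and s: "1 / s = 1 / p - \<alpha> / real CARD('n::finite)"
  shows "\<exists>C>0. \<forall>(a::real^'n \<Rightarrow> real) b f F j x J H. bmo_le a b \<longrightarrow> morrey_le p q f F \<longrightarrow> finite J \<longrightarrow> H \<in> borel_measurable borel \<longrightarrow>
     (\<forall>y\<in>dcube j x. \<bar>H y\<bar> \<le> (\<Sum>i\<in>J. 2 powr (- real_of_int i * \<alpha>) * dmean i (\<lambda>z. \<bar>a y - a z\<bar> * \<bar>f z\<bar>) y)) \<longrightarrow>
     integrable (dmeas j x) (\<lambda>y. \<bar>H y\<bar> powr t) \<and>
     dmean j (\<lambda>y. \<bar>H y\<bar> powr t) x \<le> (C * b * F * 2 powr (real_of_int j * (real CARD('n) / s))) powr t"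
proof -
  define n where "n = real CARD('n)"
  define \<beta> where "\<beta> = n / p"
  define \<gamma> where "\<gamma> = n / s"
  define r where "r = (1 + q) / 2"
  have n: "n > 0" by (simp add: n_def)
  have bs: "\<beta> - \<alpha> = \<gamma>" using s n unfolding \<beta>_def \<gamma>_def n_def[symmetric] by (simp add: field_simps)
  have g: "\<gamma> > 0" using n st by (simp add: \<gamma>_def)
  have r: "r > 1" "r < q" using q by (auto simp: r_def)
  have t0: "t > 0" using st by simp
  obtain CJ where CJ: "CJ > 0" "\<forall>(a::real^'n \<Rightarrow> real) b g j x. bmo_le a b \<longrightarrow> g \<in> borel_measurable borel \<longrightarrow>
    integrable (dmeas j x) (\<lambda>y. \<bar>g y\<bar> powr r) \<longrightarrow>
    integrable (dmeas j x) (\<lambda>y. (a y - dmean j a x) * g y) \<and>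
    dmean j (\<lambda>y. \<bar>(a y - dmean j a x) * g y\<bar>) x \<le> CJ * b * (dmean j (\<lambda>y. \<bar>g y\<bar> powr r) x) powr (1/r)"
    using bmo_Hoelder[OF r(1), where 'n='n] by blast
  obtain Ct where Ct: "Ct > 0" "\<And>(a::real^'n \<Rightarrow> real) b j x. bmo_le a b \<Longrightarrow> dmean j (\<lambda>y. \<bar>a y - dmean j a x\<bar> powr t) x \<le> (Ct * b) powr t"
    using john_nirenberg[of t, where 'n='n] st by auto
  obtain CS where CS: "CS > 0" "\<forall>(a::real^'n \<Rightarrow> real) b j x J \<phi>. bmo_le a b \<longrightarrow> finite J \<longrightarrow> (\<forall>i\<in>J. j \<le> i) \<longrightarrow>
     (\<forall>i\<in>J. dlevel i (\<phi> i) \<and> (\<forall>y. 0 \<le> \<phi> i y)) \<longrightarrow>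
     integrable (dmeas j x) (\<lambda>y. (\<Sum>i\<in>J. \<bar>a y - dmean i a y\<bar> * \<phi> i y) powr t) \<and>
     dmean j (\<lambda>y. (\<Sum>i\<in>J. \<bar>a y - dmean i a y\<bar> * \<phi> i y) powr t) x \<le> (CS * b) powr t * dmean j (\<lambda>y. (\<Sum>i\<in>J. \<phi> i y) powr t) x"
    using bmo_weighted_sum[OF st(1), where 'n='n] by blast
  obtain CW where CW: "CW > 0" "\<forall>(f::real^'n \<Rightarrow> real) F j x J. morrey_le p q f F \<longrightarrow> finite J \<longrightarrow> (\<forall>i\<in>J. j \<le> i) \<longrightarrow>
     dmean j (\<lambda>y. (\<Sum>i\<in>J. 2 powr (- real_of_int i * \<alpha>) * (dmean i (\<lambda>z. \<bar>f z\<bar> powr r) y) powr (1/r)) powr t) x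
       \<le> (CW * F * 2 powr (real_of_int j * \<gamma>)) powr t"
    using morrey_riesz_near[OF \<alpha> q t0 st(2) _ r(2) ts s] r(1) unfolding \<gamma>_def n_def by auto
  obtain CL where CL: "CL > 0" "\<And>(k::int) J. finite J \<Longrightarrow> (\<forall>i\<in>J. i \<le> k) \<Longrightarrow>
    (\<Sum>i\<in>J. real_of_int (k - i) * 2 powr (real_of_int i * \<gamma>)) \<le> CL * 2 powr (real_of_int k * \<gamma>)"
    using sum_linear_geometric_down[OF g] by blast
  define CG where "CG = 1 / (1 - 2 powr (-\<gamma>))"
  have CG: "CG > 0" using g by (simp add: CG_def powr_less_one)
  define B where "B = 2 powr n"
  \<comment> \<open>In the sum over large cubes CG belongs to |a y - c|; the other terms belong to
    b, with CL * B from the drift of the means and CG * CJ from \<open>bmo_Hoelder\<close>.\<close>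
  define CF where "CF = CG + CL * B + CG * CJ"
  have CF: "CF > 0" using CG CL CJ by (simp add: CF_def B_def add_pos_nonneg)
  define K where "K = 9 powr t * ((CS * CW) powr t + (CJ * CW) powr t + CF powr t * (Ct powr t + 1))"
  have K: "K > 0" using CS CW CJ CF Ct by (simp add: K_def add_pos_pos add_pos_nonneg)
  define C where "C = K powr (1/t)"
  have main: "integrable (dmeas j x) (\<lambda>y. \<bar>H y\<bar> powr t) \<and>
     dmean j (\<lambda>y. \<bar>H y\<bar> powr t) x \<le> (C * b * F * 2 powr (real_of_int j * \<gamma>)) powr t"
    if ab: "bmo_le a b" and f: "morrey_le p q f F" and J: "finite J" and [measurable]: "H \<in> borel_measurable borel"
      and H: "\<And>y. y \<in> dcube j x \<Longrightarrow> \<bar>H y\<bar> \<le> (\<Sum>i\<in>J. 2 powr (- real_of_int i * \<alpha>) * dmean i (\<lambda>z. \<bar>a y - a z\<bar> * \<bar>f z\<bar>) y)"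
    for a f H :: "real^'n \<Rightarrow> real" and b F j x J
  proof -
    note a = bmo_leD[OF ab] and fD = morrey_leD[OF f]
    note [measurable] = a(2) fD(2)
    \<comment> \<open>The levels in \<open>J1\<close> give cubes inside the fixed cube, those in
      \<open>J2\<close> cubes strictly larger than it.\<close>
    define J1 J2 where "J1 = {i\<in>J. j \<le> i}" and "J2 = {i\<in>J. i < j}"
    have J12: "J = J1 \<union> J2" "J1 \<inter> J2 = {}" "finite J1" "finite J2" using J by (auto simp: J1_def J2_def)
    define w where "w i y = (dmean i (\<lambda>z. \<bar>f z\<bar> powr r) y) powr (1/r)" for i y
    define \<phi> where "\<phi> i y = 2 powr (- real_of_int i * \<alpha>) * w i y" for i y
    define S where "S y = (\<Sum>i\<in>J1. \<bar>a y - dmean i a y\<bar> * \<phi> i y)" for y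
    define W where "W y = (\<Sum>i\<in>J1. \<phi> i y)" for y
    define E where "E = CF * F * 2 powr (real_of_int j * \<gamma>)"
    define c where "c = dmean j a x"
    have w0: "w i y \<ge> 0" for i y by (simp add: w_def)
    have \<phi>0: "\<phi> i y \<ge> 0" for i y using w0 by (simp add: \<phi>_def)
    have l\<phi>: "dlevel i (\<phi> i)" for i unfolding \<phi>_def w_def by (rule dlevel_comp[OF dlevel_dmean])
    have S0: "S y \<ge> 0" for y unfolding S_def by (intro sum_nonneg mult_nonneg_nonneg \<phi>0) auto
    have W0: "W y \<ge> 0" for y unfolding W_def by (intro sum_nonneg \<phi>0)
    have E0: "E \<ge> 0" using CF fD(1) by (simp add: E_def)
    have fri: "integrable (dmeas i y) (\<lambda>z. \<bar>f z\<bar> powr r)" for i y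
      by (rule integrable_powr_mono[OF fD(3)]) (use r in auto)
    have f1: "integrable (dmeas i y) f" for i y
      by (rule powr_dmean_le(1)[OF _ _ fD(3)]) (use q in auto)
    have afi: "integrable (dmeas i y) (\<lambda>z. (a z - dmean i a y) * f z)" for i y
      using CJ(2) ab fD(2) fri by blast
    have w1: "dmean i (\<lambda>z. \<bar>f z\<bar>) y \<le> w i y" for i y
      using dmean_powr_mono[OF fri[of i y], of 1] r by (simp add: w_def dmean_nonneg)
    have w2: "w i y \<le> F * 2 powr (real_of_int i * \<beta>)" for i y
      unfolding w_def \<beta>_def n_def by (rule morrey_le_powr_mean[OF f]) (use r in auto)
    have w3: "dmean i (\<lambda>z. \<bar>(a z - dmean i a y) * f z\<bar>) y \<le> CJ * b * w i y" for i y
      unfolding w_def using CJ(2) ab fD(2) fri by blast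
    have tm: "dmean i (\<lambda>z. \<bar>a y - a z\<bar> * \<bar>f z\<bar>) y \<le> (\<bar>a y - dmean i a y\<bar> + CJ * b) * w i y" for i y
    proof -
      have "dmean i (\<lambda>z. \<bar>a y - a z\<bar> * \<bar>f z\<bar>) y \<le> dmean i (\<lambda>z. \<bar>a y - dmean i a y\<bar> * \<bar>f z\<bar> + \<bar>(a z - dmean i a y) * f z\<bar>) y"
      proof (rule dmean_mono)
        show "integrable (dmeas i y) (\<lambda>z. \<bar>a y - dmean i a y\<bar> * \<bar>f z\<bar> + \<bar>(a z - dmean i a y) * f z\<bar>)"
          using f1 afi by auto
        fix z
        have "\<bar>a y - a z\<bar> \<le> \<bar>a y - dmean i a y\<bar> + \<bar>a z - dmean i a y\<bar>" by linarith
        from mult_right_mono[OF this, of "\<bar>f z\<bar>"]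
        show "\<bar>a y - a z\<bar> * \<bar>f z\<bar> \<le> \<bar>a y - dmean i a y\<bar> * \<bar>f z\<bar> + \<bar>(a z - dmean i a y) * f z\<bar>"
          by (simp add: distrib_right abs_mult)
      qed auto
      also have "\<dots> = \<bar>a y - dmean i a y\<bar> * dmean i (\<lambda>z. \<bar>f z\<bar>) y + dmean i (\<lambda>z. \<bar>(a z - dmean i a y) * f z\<bar>) y"
        using f1 afi by (subst dmean_add) auto
      also have "\<dots> \<le> \<bar>a y - dmean i a y\<bar> * w i y + CJ * b * w i y"
        by (intro add_mono mult_left_mono w1 w3) auto
      finally show ?thesis by (simp add: distrib_right)
    qed
    have Hle: "\<bar>H y\<bar> \<le> S y + CJ * b * W y + E * (\<bar>a y - c\<bar> + b)" if y: "y \<in> dcube j x" for y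
    proof -
      have cy: "dmean j a y = c" unfolding c_def by (rule dmean_dcube_cong[OF y])
      have "\<bar>H y\<bar> \<le> (\<Sum>i\<in>J. (\<bar>a y - dmean i a y\<bar> + CJ * b) * \<phi> i y)"
        unfolding \<phi>_def using tm by (intro order_trans[OF H[OF y]] sum_mono) (simp add: mult.left_commute mult_left_mono)
      also have "\<dots> = (\<Sum>i\<in>J1. (\<bar>a y - dmean i a y\<bar> + CJ * b) * \<phi> i y) + (\<Sum>i\<in>J2. (\<bar>a y - dmean i a y\<bar> + CJ * b) * \<phi> i y)"
        unfolding J12(1) by (rule sum.union_disjoint) (use J12 in auto)
      also have "(\<Sum>i\<in>J1. (\<bar>a y - dmean i a y\<bar> + CJ * b) * \<phi> i y) = S y + CJ * b * W y"
        by (simp add: S_def W_def sum.distrib sum_distrib_left algebra_simps)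
      also have "(\<Sum>i\<in>J2. (\<bar>a y - dmean i a y\<bar> + CJ * b) * \<phi> i y) \<le> E * (\<bar>a y - c\<bar> + b)"
      proof -
        have "(\<Sum>i\<in>J2. (\<bar>a y - dmean i a y\<bar> + CJ * b) * \<phi> i y) \<le> (\<Sum>i\<in>J2. (\<bar>a y - c\<bar> + CJ * b) * F * 2 powr (real_of_int i * \<gamma>) + B * b * F * (real_of_int (j - i) * 2 powr (real_of_int i * \<gamma>)))"
        proof (intro sum_mono)
          fix i assume "i \<in> J2"
          then have ij: "i < j" by (simp add: J2_def)
          have "\<bar>dmean (i + int (nat (j - i))) a y - dmean i a y\<bar> \<le> real (nat (j - i)) * (2 powr real CARD('n) * b)"
            by (rule bmo_steps[OF ab])
          then have "\<bar>c - dmean i a y\<bar> \<le> real_of_int (j - i) * (B * b)"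
            using ij cy by (simp add: B_def n_def)
          then have 1: "\<bar>a y - dmean i a y\<bar> + CJ * b \<le> \<bar>a y - c\<bar> + real_of_int (j - i) * (B * b) + CJ * b"
            by linarith
          \<comment> \<open>The growth 2^(i \<beta>) of the Morrey bound outweighs the weight 2^(-i
            \<alpha>) and leaves the positive exponent \<gamma> = \<beta> - \<alpha>, so the sum
            over i < j converges.\<close>
          have 2: "\<phi> i y \<le> F * 2 powr (real_of_int i * \<gamma>)"
          proof -
            have "\<phi> i y \<le> 2 powr (- real_of_int i * \<alpha>) * (F * 2 powr (real_of_int i * \<beta>))"
              unfolding \<phi>_def by (intro mult_left_mono w2) auto
            also have "\<dots> = F * 2 powr (- real_of_int i * \<alpha> + real_of_int i * \<beta>)" unfolding powr_add by simp
            also have "- real_of_int i * \<alpha> + real_of_int i * \<beta> = real_of_int i * \<gamma>" unfolding bs[symmetric] by (simp add: algebra_simps)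
            finally show ?thesis .
          qed
          have "(\<bar>a y - dmean i a y\<bar> + CJ * b) * \<phi> i y \<le> (\<bar>a y - c\<bar> + real_of_int (j - i) * (B * b) + CJ * b) * (F * 2 powr (real_of_int i * \<gamma>))"
            using a(1) CJ(1) ij \<phi>0 by (intro mult_mono 1 2) (auto simp: B_def)
          then show "(\<bar>a y - dmean i a y\<bar> + CJ * b) * \<phi> i y \<le> (\<bar>a y - c\<bar> + CJ * b) * F * 2 powr (real_of_int i * \<gamma>) + B * b * F * (real_of_int (j - i) * 2 powr (real_of_int i * \<gamma>))"
            by (simp add: algebra_simps)
        qed
        also have "\<dots> = (\<bar>a y - c\<bar> + CJ * b) * F * (\<Sum>i\<in>J2. 2 powr (real_of_int i * \<gamma>)) + B * b * F * (\<Sum>i\<in>J2. real_of_int (j - i) * 2 powr (real_of_int i * \<gamma>))"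
          by (simp only: sum.distrib sum_distrib_left)
        also have "\<dots> \<le> (\<bar>a y - c\<bar> + CJ * b) * F * (2 powr (real_of_int j * \<gamma>) / (1 - 2 powr (-\<gamma>))) + B * b * F * (CL * 2 powr (real_of_int j * \<gamma>))"
          using a(1) CJ(1) fD(1) g J12 by (intro add_mono mult_left_mono sum_geometric_down CL(2)) (auto simp: J2_def B_def)
        also have "\<dots> = F * 2 powr (real_of_int j * \<gamma>) * (CG * \<bar>a y - c\<bar> + (CL * B + CG * CJ) * b)"
          by (simp add: CG_def algebra_simps add_divide_distrib)
        also have "\<dots> \<le> F * 2 powr (real_of_int j * \<gamma>) * (CF * \<bar>a y - c\<bar> + CF * b)"
          using a(1) CJ(1) fD(1) CL(1) CG by (intro mult_left_mono add_mono mult_right_mono) (auto simp: CF_def B_def)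
        finally show ?thesis by (simp add: E_def algebra_simps)
      qed
      finally show ?thesis by simp
    qed
    define G where "G y = 9 powr t * (S y powr t + (CJ * b) powr t * W y powr t + E powr t * (\<bar>a y - c\<bar> powr t + b powr t))" for y
    have SS: "integrable (dmeas j x) (\<lambda>y. S y powr t) \<and>
     dmean j (\<lambda>y. S y powr t) x \<le> (CS * b) powr t * dmean j (\<lambda>y. W y powr t) x"
      unfolding S_def W_def using J12 l\<phi> \<phi>0 by (intro CS(2)[rule_format] ab) (auto simp: J1_def)
    have WW: "dmean j (\<lambda>y. W y powr t) x \<le> (CW * F * 2 powr (real_of_int j * \<gamma>)) powr t"
      unfolding W_def \<phi>_def w_def using J12 by (intro CW(2)[rule_format] f) (auto simp: J1_def)
    have Wi: "integrable (dmeas j x) (\<lambda>y. W y powr t)"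
    proof -
      have "integrable (dmeas j x) (\<lambda>y. \<bar>W y\<bar> powr t)" unfolding W_def
        by (rule integrable_powr_sum)
          (use t0 J12 in \<open>auto intro!: dlevel_integrable[OF dlevel_comp[OF l\<phi>]] dlevel_borel_measurable[OF l\<phi>]\<close>)
      then show ?thesis using W0 by simp
    qed
    have ai: "integrable (dmeas j x) (\<lambda>y. \<bar>a y - c\<bar> powr t)"
      unfolding c_def using john_nirenberg[OF t0, where 'n='n] ab by blast
    have Gi: "integrable (dmeas j x) G" unfolding G_def using SS Wi ai by auto
    have HG: "\<bar>\<bar>H y\<bar> powr t\<bar> \<le> G y" if y: "y \<in> dcube j x" for y
    proof -
      have "\<bar>H y\<bar> powr t \<le> (S y + CJ * b * W y + E * (\<bar>a y - c\<bar> + b)) powr t"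
        using t0 by (intro powr_mono2 Hle y) auto
      also have "\<dots> \<le> 9 powr t * (S y powr t + (CJ * b * W y) powr t + E powr t * (\<bar>a y - c\<bar> powr t + b powr t))"
        by (rule add4_powr_le) (use t0 S0 W0 E0 a(1) CJ(1) in auto)
      finally show ?thesis using a(1) CJ(1) W0[of y] by (simp add: G_def powr_mult)
    qed
    have Hi: "integrable (dmeas j x) (\<lambda>y. \<bar>H y\<bar> powr t)"
      by (rule integrable_dmeas_bound[OF Gi _ HG]) auto
    define X where "X = b * F * 2 powr (real_of_int j * \<gamma>)"
    have X: "X > 0" using a(1) fD(1) by (simp add: X_def)
    have "dmean j (\<lambda>y. \<bar>H y\<bar> powr t) x \<le> dmean j G x"
      by (rule dmean_mono'[OF Gi Hi]) (use HG in force)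
    also have "\<dots> = 9 powr t * (dmean j (\<lambda>y. S y powr t) x + (CJ * b) powr t * dmean j (\<lambda>y. W y powr t) x + E powr t * (dmean j (\<lambda>y. \<bar>a y - c\<bar> powr t) x + b powr t))"
      unfolding G_def using SS Wi ai by (simp add: dmean_add)
    also have "\<dots> \<le> 9 powr t * ((CS * b) powr t * (CW * F * 2 powr (real_of_int j * \<gamma>)) powr t + (CJ * b) powr t * (CW * F * 2 powr (real_of_int j * \<gamma>)) powr t + E powr t * ((Ct * b) powr t + b powr t))"
    proof (intro mult_left_mono add_mono)
      show "dmean j (\<lambda>y. S y powr t) x \<le> (CS * b) powr t * (CW * F * 2 powr (real_of_int j * \<gamma>)) powr t"
        using SS mult_left_mono[OF WW, of "(CS * b) powr t"] by simp
      show "dmean j (\<lambda>y. \<bar>a y - c\<bar> powr t) x \<le> (Ct * b) powr t" unfolding c_def by (rule Ct(2)[OF ab])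
    qed (use WW in auto)
    also have "\<dots> = K * X powr t"
    proof -
      have p1: "(CS * b) powr t * (CW * F * 2 powr (real_of_int j * \<gamma>)) powr t = (CS * CW) powr t * X powr t"
        using CS CW a(1) fD(1) by (simp add: X_def powr_mult mult_ac)
      have p2: "(CJ * b) powr t * (CW * F * 2 powr (real_of_int j * \<gamma>)) powr t = (CJ * CW) powr t * X powr t"
        using CJ CW a(1) fD(1) by (simp add: X_def powr_mult mult_ac)
      have p3: "E powr t * ((Ct * b) powr t + b powr t) = CF powr t * (Ct powr t + 1) * X powr t"
        using CF Ct a(1) fD(1) by (simp add: X_def E_def powr_mult algebra_simps)
      show ?thesis unfolding p1 p2 p3 K_def by (simp add: algebra_simps)
    qed
    also have "\<dots> = (C * X) powr t" using K X t0 by (simp add: C_def powr_mult powr_powr)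
    finally show ?thesis using Hi by (simp add: X_def mult_ac)
  qed
  have C: "C > 0" using K by (simp add: C_def)
  show ?thesis
  proof (intro exI[of _ C] conjI allI impI)
    fix a f H :: "real^'n \<Rightarrow> real" and b F j and x :: "real^'n" and J
    assume "bmo_le a b" "morrey_le p q f F" "finite J" "H \<in> borel_measurable borel"
     "\<forall>y\<in>dcube j x. \<bar>H y\<bar> \<le> (\<Sum>i\<in>J. 2 powr (- real_of_int i * \<alpha>) * dmean i (\<lambda>z. \<bar>a y - a z\<bar> * \<bar>f z\<bar>) y)"
    then have "integrable (dmeas j x) (\<lambda>y. \<bar>H y\<bar> powr t) \<and>
     dmean j (\<lambda>y. \<bar>H y\<bar> powr t) x \<le> (C * b * F * 2 powr (real_of_int j * \<gamma>)) powr t"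
      by (intro main) auto
    then show "integrable (dmeas j x) (\<lambda>y. \<bar>H y\<bar> powr t)"
     "dmean j (\<lambda>y. \<bar>H y\<bar> powr t) x \<le> (C * b * F * 2 powr (real_of_int j * (real CARD('n) / s))) powr t"
      by (auto simp: \<gamma>_def n_def)
  qed (rule C)
qed

section \<open>Haar expansions as differences of averages\<close>

lemma haar1_eq: "haar1 b u = (if \<lfloor>2 * u\<rfloor> = 0 then 1 else if \<lfloor>2 * u\<rfloor> = 1 then (if b then -1 else 1) else 0)"
  by (auto simp: haar1_def indicator_def floor_eq_iff)

lemma haar1_zero: "\<lfloor>u\<rfloor> \<noteq> 0 \<Longrightarrow> haar1 b u = 0"
  by (auto simp: haar1_eq floor_eq_iff)

lemma haar1_False: "haar1 False u = of_bool (\<lfloor>u\<rfloor> = 0)"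
  by (auto simp: haar1_eq floor_eq_iff)

text \<open>On the unit interval the two functions take the values 1 and -1, so the sum is 1 + 1 if
  u and v lie in the same half and 1 - 1 if they lie in different halves.\<close>

lemma haar1_sum: "\<lfloor>v\<rfloor> = 0 \<Longrightarrow> (\<Sum>b\<in>UNIV. haar1 b v * haar1 b u) = 2 * of_bool (\<lfloor>2 * u\<rfloor> = \<lfloor>2 * v\<rfloor>)"
proof -
  assume "\<lfloor>v\<rfloor> = 0"
  then have "\<lfloor>2 * v\<rfloor> = 0 \<or> \<lfloor>2 * v\<rfloor> = 1" by (auto simp: floor_eq_iff)
  then show ?thesis by (auto simp: UNIV_bool haar1_eq)
qed

lemma haar1_measurable [measurable]: "haar1 b \<in> borel_measurable borel"
  unfolding haar1_def[abs_def] by measurable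

lemma haar_cube_measurable [measurable]: "haar_cube e j (m :: int^'a::finite) \<in> borel_measurable borel"
proof -
  have h: "(\<lambda>x. haar1 (e i) (2 powr real_of_int j * x$i - of_int (m$i))) \<in> borel_measurable borel" for i
    by (rule measurable_compose[OF _ haar1_measurable]) measurable
  have e: "haar_cube e j m = (\<lambda>x. 2 powr (real_of_int j * real CARD('a) / 2) * (\<Prod>i\<in>UNIV. haar1 (e i) (2 powr real_of_int j * x$i - of_int (m$i))))"
    by (auto simp: haar_cube_def haar_def)
  show ?thesis unfolding e by (intro borel_measurable_times borel_measurable_const borel_measurable_prod h)
qed

lemma abs_haar1_le: "\<bar>haar1 b u\<bar> \<le> 1"
  by (auto simp: haar1_eq)

lemma haar_cube_zero: "y \<notin> dyadic_cube j m \<Longrightarrow> haar_cube e j m y = 0"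
proof -
  assume "y \<notin> dyadic_cube j m"
  then obtain i where "\<lfloor>2 powr real_of_int j * y$i\<rfloor> \<noteq> m$i" by (auto simp: dyadic_cube_eq_floor)
  then have "haar1 (e i) ((2 powr real_of_int j *\<^sub>R y - (\<chi> i. of_int (m$i))) $ i) = 0"
    by (intro haar1_zero) simp
  then show ?thesis unfolding haar_cube_def haar_def by (subst prod_zero) auto
qed

lemma abs_haar_cube_le: "\<bar>haar_cube e j m y\<bar> \<le> 2 powr (real_of_int j * real CARD('n) / 2)"
  for m :: "int^'n::finite"
proof -
  have "\<bar>haar e z\<bar> \<le> 1" for z :: "real^'n"
    unfolding haar_def abs_prod by (intro prod_le_1) (auto simp: abs_haar1_le)
  then show ?thesis unfolding haar_cube_def abs_mult
    using mult_left_mono[of _ 1 "2 powr (real_of_int j * real CARD('n) / 2)"] by simp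
qed

lemma floor_shift: "\<lfloor>2 * (2 powr real_of_int j * u - of_int k)\<rfloor> = \<lfloor>2 powr real_of_int (j+1) * u\<rfloor> - 2 * k"
proof -
  have "2 * (2 powr real_of_int j * u - of_int k) = 2 powr real_of_int (j+1) * u - of_int (2 * k)"
    by (simp add: powr_add)
  then show ?thesis by (simp only: floor_diff_of_int)
qed

text \<open>Summed over all sign patterns, including the zero pattern, the kernel factorises over
  the coordinates and is the kernel of averaging at level j+1. The excluded zero pattern contributes
  the kernel of averaging at level j.\<close>

lemma haar_kernel_sum:
  fixes x y :: "real^'n::finite"
  assumes m: "x \<in> dyadic_cube j m"
  shows "(\<Sum>e\<in>haar_E. haar_cube e j m x * haar_cube e j m y)
     = 2 powr (real_of_int (j+1) * real CARD('n)) * indicator (dcube (j+1) x) y - 2 powr (real_of_int j * real CARD('n)) * indicator (dcube j x) y"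
proof -
  define u where "u i = 2 powr real_of_int j * y$i - of_int (m$i)" for i
  define v where "v i = 2 powr real_of_int j * x$i - of_int (m$i)" for i
  define P where "P e = (\<Prod>i\<in>UNIV. haar1 (e i) (v i) * haar1 (e i) (u i))" for e :: "'n \<Rightarrow> bool"
  have v0: "\<lfloor>v i\<rfloor> = 0" for i using m by (simp add: v_def dyadic_cube_eq_floor)
  have hh: "haar_cube e j m x * haar_cube e j m y = 2 powr (real_of_int j * real CARD('n)) * P e" for e
    unfolding haar_cube_def haar_def P_def prod.distrib
    by (simp add: u_def v_def mult_ac flip: powr_add)
  have all: "(\<Sum>e\<in>UNIV. P e) = 2 powr real CARD('n) * indicator (dcube (j+1) x) y"
  proof -
    have "(\<Sum>e\<in>UNIV. P e) = (\<Sum>e\<in>PiE UNIV (\<lambda>_. UNIV). P e)" by (simp add: PiE_UNIV_domain)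
    also have "\<dots> = (\<Prod>i\<in>UNIV. \<Sum>b\<in>UNIV. haar1 b (v i) * haar1 b (u i))"
      unfolding P_def by (rule prod_sum_PiE[symmetric]) auto
    also have "\<dots> = (\<Prod>i\<in>UNIV. 2 * of_bool (\<lfloor>2 * u i\<rfloor> = \<lfloor>2 * v i\<rfloor>))"
      by (intro prod.cong refl haar1_sum v0)
    also have "\<dots> = 2 powr real CARD('n) * (\<Prod>i\<in>UNIV. of_bool (\<lfloor>2 * u i\<rfloor> = \<lfloor>2 * v i\<rfloor>))"
      by (simp add: prod.distrib powr_realpow)
    also have "(\<Prod>i\<in>UNIV. of_bool (\<lfloor>2 * u i\<rfloor> = \<lfloor>2 * v i\<rfloor>)) = (indicator (dcube (j+1) x) y :: real)"
      unfolding u_def v_def floor_shift by (auto simp: dcube_def indicator_def prod_zero_iff)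
    finally show ?thesis .
  qed
  have zero: "P (\<lambda>_. False) = indicator (dcube j x) y"
  proof -
    have "P (\<lambda>_. False) = (\<Prod>i\<in>UNIV. of_bool (\<lfloor>u i\<rfloor> = 0))"
      unfolding P_def haar1_False v0 by simp
    also have "\<dots> = indicator (dcube j x) y"
      using m by (auto simp: dcube_def u_def indicator_def prod_zero_iff dyadic_cube_eq_floor)
    finally show ?thesis .
  qed
  have E: "haar_E = UNIV - {\<lambda>_. False :: bool}" unfolding haar_E_def by auto
  have "(\<Sum>e\<in>haar_E. P e) = (\<Sum>e\<in>UNIV. P e) - P (\<lambda>_. False)"
    unfolding E by (simp add: sum_diff1)
  then have S: "(\<Sum>e\<in>haar_E. P e) = 2 powr real CARD('n) * indicator (dcube (j+1) x) y - indicator (dcube j x) y"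
    unfolding all zero .
  have e: "2 powr (real_of_int (j+1) * real CARD('n)) = 2 powr (real_of_int j * real CARD('n)) * 2 powr real CARD('n)"
    by (simp add: powr_add distrib_right)
  show ?thesis
  proof -
    have "(\<Sum>e\<in>haar_E. haar_cube e j m x * haar_cube e j m y) = 2 powr (real_of_int j * real CARD('n)) * (\<Sum>e\<in>haar_E. P e)"
      by (simp only: hh sum_distrib_left)
    also have "\<dots> = 2 powr (real_of_int j * real CARD('n)) * (2 powr real CARD('n) * indicator (dcube (j+1) x) y) - 2 powr (real_of_int j * real CARD('n)) * indicator (dcube j x) y"
      by (simp only: S right_diff_distrib)
    finally show ?thesis by (simp only: e mult.assoc)
  qed
qed

lemma haar_projection:
  fixes x :: "real^'n::finite"
  assumes m: "x \<in> dyadic_cube j m" and fi: "integrable (dmeas j x) f"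
  shows "(\<Sum>e\<in>haar_E. pairing f (haar_cube e j m) * haar_cube e j m x) = dmean (j+1) f x - dmean j f x"
proof -
  note [measurable] = dmeas_integrableD[OF fi]
  have Q: "dyadic_cube j m = dcube j x" using m by (rule dyadic_cube_eq_dcube)
  have s1: "set_integrable lborel (dcube j x) f" using fi by (subst (asm) integrable_dmeas_iff) auto
  have s2: "set_integrable lborel (dcube (j+1) x) f"
    using s1 by (rule set_integrable_subset) (use dcube_Suc_subset in auto)
  have i1: "integrable lborel (\<lambda>y. indicator (dcube j x) y * f y)" "integrable lborel (\<lambda>y. indicator (dcube (j+1) x) y * f y)"
    using s1 s2 by (auto simp: set_integrable_def)
  have hi: "integrable lborel (\<lambda>y. f y * haar_cube e j m y)" for e
  proof (rule Bochner_Integration.integrable_bound)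
    show "integrable lborel (\<lambda>y. 2 powr (real_of_int j * real CARD('n) / 2) * (indicator (dcube j x) y * f y))"
      using i1 by simp
    show "AE y in lborel. norm (f y * haar_cube e j m y) \<le> norm (2 powr (real_of_int j * real CARD('n) / 2) * (indicator (dcube j x) y * f y))"
    proof (intro AE_I2)
      fix y
      show "norm (f y * haar_cube e j m y) \<le> norm (2 powr (real_of_int j * real CARD('n) / 2) * (indicator (dcube j x) y * f y))"
        using mult_right_mono[OF abs_haar_cube_le[of e j m y], of "\<bar>f y\<bar>"] haar_cube_zero[of y j m e] unfolding Q
        by (cases "y \<in> dcube j x") (auto simp: abs_mult mult_ac)
    qed
  qed auto
  have "(\<Sum>e\<in>haar_E. pairing f (haar_cube e j m) * haar_cube e j m x)
     = (LINT y|lborel. (\<Sum>e\<in>haar_E. f y * haar_cube e j m y * haar_cube e j m x))"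
    unfolding pairing_def using hi by (subst Bochner_Integration.integral_sum) auto
  also have "\<dots> = (LINT y|lborel. f y * (\<Sum>e\<in>haar_E. haar_cube e j m x * haar_cube e j m y))"
    by (simp add: sum_distrib_left mult_ac)
  also have "\<dots> = (LINT y|lborel. 2 powr (real_of_int (j+1) * real CARD('n)) * (indicator (dcube (j+1) x) y * f y) - 2 powr (real_of_int j * real CARD('n)) * (indicator (dcube j x) y * f y))"
    unfolding haar_kernel_sum[OF m] by (simp add: right_diff_distrib mult_ac)
  also have "\<dots> = 2 powr (real_of_int (j+1) * real CARD('n)) * (LINT y:dcube (j+1) x|lborel. f y) - 2 powr (real_of_int j * real CARD('n)) * (LINT y:dcube j x|lborel. f y)"
    using i1 by (simp add: set_lebesgue_integral_def)
  also have "\<dots> = dmean (j+1) f x - dmean j f x"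
    unfolding dmean_eq_set_integral[OF dmeas_integrableD[OF fi]]
    by (simp flip: mult.assoc powr_add) (simp add: algebra_simps)
  finally show ?thesis .
qed

lemma infsum_dyadic_cubes:
  assumes "\<And>m'. m' \<noteq> m \<Longrightarrow> g m' = (0::real)"
  shows "(\<Sum>\<^sub>\<infinity>m'. g m') = g m"
proof -
  have "infsum g UNIV = infsum g {m}" by (rule infsum_cong_neutral) (use assms in auto)
  then show ?thesis by simp
qed

text \<open>Only the cube containing x contributes to the sum over m. The free weights c serve both
  \<open>frac_partial\<close>, with a power of the volume, and \<open>comm_partial\<close>, with
  1.\<close>

lemma weighted_haar_sum:
  fixes x :: "real^'n::finite"
  assumes fi: "\<And>j x. integrable (dmeas j x) f"
  shows "(\<Sum>e\<in>haar_E. \<Sum>j\<in>{- int M..int M}. \<Sum>\<^sub>\<infinity> m. c j m * pairing f (haar_cube e j m) * haar_cube e j m x)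
    = (\<Sum>j\<in>{- int M..int M}. c j (\<chi> i. \<lfloor>2 powr real_of_int j * x$i\<rfloor>) * (dmean (j+1) f x - dmean j f x))"
proof -
  define m where "m j = (\<chi> i. \<lfloor>2 powr real_of_int j * x$i\<rfloor>)" for j
  have xm: "x \<in> dyadic_cube j (m j)" for j unfolding m_def by (simp flip: dcube_eq_dyadic_cube)
  have "(\<Sum>\<^sub>\<infinity> m'. c j m' * pairing f (haar_cube e j m') * haar_cube e j m' x) = c j (m j) * (pairing f (haar_cube e j (m j)) * haar_cube e j (m j) x)" for e j
  proof -
    have "haar_cube e j m' x = 0" if "m' \<noteq> m j" for m'
      by (rule haar_cube_zero) (use that in \<open>auto simp: m_def dyadic_cube_eq_floor vec_eq_iff, metis\<close>)
    then have "(\<Sum>\<^sub>\<infinity> m'. c j m' * pairing f (haar_cube e j m') * haar_cube e j m' x) = c j (m j) * pairing f (haar_cube e j (m j)) * haar_cube e j (m j) x"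
      by (intro infsum_dyadic_cubes) simp
    then show ?thesis by simp
  qed
  then have "(\<Sum>e\<in>haar_E. \<Sum>j\<in>{- int M..int M}. \<Sum>\<^sub>\<infinity> m. c j m * pairing f (haar_cube e j m) * haar_cube e j m x)
    = (\<Sum>e\<in>haar_E. \<Sum>j\<in>{- int M..int M}. c j (m j) * (pairing f (haar_cube e j (m j)) * haar_cube e j (m j) x))" by simp
  also have "\<dots> = (\<Sum>j\<in>{- int M..int M}. \<Sum>e\<in>haar_E. c j (m j) * (pairing f (haar_cube e j (m j)) * haar_cube e j (m j) x))"
    by (rule sum.swap)
  also have "\<dots> = (\<Sum>j\<in>{- int M..int M}. c j (m j) * (dmean (j+1) f x - dmean j f x))"
    unfolding sum_distrib_left[symmetric] haar_projection[OF xm fi] ..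
  finally show ?thesis unfolding m_def .
qed

lemma frac_partial_eq:
  fixes f :: "real^'n::finite \<Rightarrow> real"
  assumes fi: "\<And>j x. integrable (dmeas j x) f"
  shows "frac_partial \<alpha> f M x = (\<Sum>j\<in>{- int M..int M}. 2 powr (- real_of_int j * \<alpha>) * (dmean (j+1) f x - dmean j f x))"
proof -
  have "measure lborel (dyadic_cube j m) powr (\<alpha> / real CARD('n)) = 2 powr (- real_of_int j * \<alpha>)" for j and m :: "int^'n"
    by (simp add: dyadic_cube_corner measure_dcube powr_powr)
  then show ?thesis unfolding frac_partial_def weighted_haar_sum[OF fi] by simp
qed

abbreviation frac_commutator :: "(real^'n::finite \<Rightarrow> real) \<Rightarrow> real \<Rightarrow> (real^'n \<Rightarrow> real) \<Rightarrow> real^'n \<Rightarrow> real" where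
  "frac_commutator a \<alpha> f \<equiv> (\<lambda>y. a y * frac_int \<alpha> f y - frac_int \<alpha> (\<lambda>y. a y * f y) y)"

text \<open>With weight 1 the martingale differences telescope, so only the finest and the coarsest
  average remain.\<close>

lemma comm_partial_eq:
  fixes f :: "real^'n::finite \<Rightarrow> real"
  assumes "\<And>j x. integrable (dmeas j x) (frac_commutator a \<alpha> f)"
  shows "comm_partial a \<alpha> f M x = dmean (int M + 1) (frac_commutator a \<alpha> f) x
     - dmean (- int M) (frac_commutator a \<alpha> f) x"
proof -
  define G where "G = (frac_commutator a \<alpha> f)"
  have tele: "(\<Sum>j\<in>{- int M..int M}. h (j+1) - h j) = h (int M + 1) - h (- int M)" for h :: "int \<Rightarrow> real"
  proof (induction M)
    case (Suc M)
    have eq: "{- int (Suc M)..int (Suc M)} = insert (- int M - 1) (insert (int M + 1) {- int M..int M})" by auto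
    have S: "(\<Sum>j\<in>{- int (Suc M)..int (Suc M)}. h (j+1) - h j)
      = (h (- int M - 1 + 1) - h (- int M - 1)) + ((h (int M + 1 + 1) - h (int M + 1)) + (\<Sum>j\<in>{- int M..int M}. h (j+1) - h j))"
      unfolding eq by (subst sum.insert; simp)+
    have e: "- int M - 1 + 1 = - int M" "- (int M + 1) = - int M - 1" "int (Suc M) = int M + 1" by auto
    show ?case unfolding S Suc by (simp only: e)
  qed simp
  have "comm_partial a \<alpha> f M x = (\<Sum>j\<in>{- int M..int M}. dmean (j+1) G x - dmean j G x)"
    unfolding comm_partial_def G_def[symmetric]
    using weighted_haar_sum[OF assms[folded G_def], where c="\<lambda>_ _. 1" and M=M and x=x] by (simp only: mult_1)
  also have "\<dots> = dmean (int M + 1) G x - dmean (- int M) G x" by (rule tele)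
  finally show ?thesis unfolding G_def .
qed

section \<open>Local convergence and the fractional integral\<close>

lemma dcube_subset_compact: "\<exists>K. compact K \<and> dcube j x \<subseteq> (K :: (real^'n::finite) set)"
proof -
  define m where "m = (\<chi> i. \<lfloor>2 powr real_of_int j * x$i\<rfloor>)"
  have "dcube j x \<subseteq> cbox (\<chi> i. of_int (m$i) * 2 powr (- real_of_int j)) (\<chi> i. (of_int (m$i) + 1) * 2 powr (- real_of_int j))"
    unfolding dcube_eq_dyadic_cube m_def[symmetric] dyadic_cube_def by (auto simp: mem_box_cart less_imp_le)
  then show ?thesis by (meson compact_cbox)
qed

text \<open>This reduces local integrability and local convergence to unit cubes.\<close>

lemma compact_subset_unit_cubes:
  assumes "compact (K :: (real^'n::finite) set)"
  shows "\<exists>P. finite P \<and> K \<subseteq> (\<Union>m\<in>P. dcube 0 (corner 0 m))"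
proof -
  obtain B where B: "\<And>x. x \<in> K \<Longrightarrow> norm x \<le> B" using compact_imp_bounded[OF assms] by (auto simp: bounded_iff)
  define P :: "(int^'n) set" where "P = vec_lambda ` (PiE UNIV (\<lambda>_. {\<lfloor>-B\<rfloor>..\<lfloor>B\<rfloor>}))"
  have "finite P" unfolding P_def by (intro finite_imageI finite_PiE) auto
  moreover have "K \<subseteq> (\<Union>m\<in>P. dcube 0 (corner 0 m))"
  proof
    fix x assume x: "x \<in> K"
    define m where "m = (\<chi> i. \<lfloor>2 powr real_of_int 0 * x$i\<rfloor>)"
    have "vec_nth m \<in> PiE UNIV (\<lambda>_. {\<lfloor>-B\<rfloor>..\<lfloor>B\<rfloor>})"
    proof -
      have "-B \<le> x$i" "x$i \<le> B" for i using component_le_norm_cart[of x i] B[OF x] by linarith+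
      then show ?thesis by (auto simp: m_def intro!: floor_mono)
    qed
    then have "m \<in> P" unfolding P_def by (metis image_eqI vec_nth_inverse)
    moreover have "x \<in> dcube 0 (corner 0 m)" unfolding m_def by (rule in_dcube_corner)
    ultimately show "x \<in> (\<Union>m\<in>P. dcube 0 (corner 0 m))" by blast
  qed
  ultimately show ?thesis by blast
qed

lemma set_integrable_compact:
  fixes h :: "real^'n::finite \<Rightarrow> real"
  assumes "compact K" "\<And>x. integrable (dmeas 0 x) h" and [measurable]: "h \<in> borel_measurable borel"
  shows "set_integrable lborel K h"
proof -
  obtain P where P: "finite P" "K \<subseteq> (\<Union>m\<in>P. dcube 0 (corner 0 m))" using compact_subset_unit_cubes[OF assms(1)] by blast
  have "set_integrable lborel (\<Union>m\<in>P. dcube 0 (corner 0 m)) h"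
    using assms(2) by (intro set_integrable_UN P) (auto simp flip: integrable_dmeas_iff[OF assms(3)])
  then show ?thesis by (rule set_integrable_subset) (use P assms(1) in \<open>auto intro: borel_compact\<close>)
qed

lemma Lloc_iff:
  fixes f :: "real^'n::finite \<Rightarrow> real"
  shows "Lloc r f \<longleftrightarrow> f \<in> borel_measurable borel \<and> (\<forall>j x. integrable (dmeas j x) (\<lambda>y. \<bar>f y\<bar> powr r))"
proof (intro iffI conjI allI)
  assume L: "Lloc r f"
  show [measurable]: "f \<in> borel_measurable borel" using L by (simp add: Lloc_def)
  fix j and x :: "real^'n"
  obtain K where K: "compact K" "dcube j x \<subseteq> K" using dcube_subset_compact by blast
  have "set_integrable lborel K (\<lambda>y. \<bar>f y\<bar> powr r)" using L K by (simp add: Lloc_def)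
  then have "set_integrable lborel (dcube j x) (\<lambda>y. \<bar>f y\<bar> powr r)" by (rule set_integrable_subset) (use K in auto)
  then show "integrable (dmeas j x) (\<lambda>y. \<bar>f y\<bar> powr r)" by (subst integrable_dmeas_iff) auto
next
  assume R: "f \<in> borel_measurable borel \<and> (\<forall>j x. integrable (dmeas j x) (\<lambda>y. \<bar>f y\<bar> powr r))"
  then show "Lloc r f" unfolding Lloc_def by (auto intro!: set_integrable_compact)
qed

lemma LlocI:
  fixes f :: "real^'n::finite \<Rightarrow> real"
  assumes "f \<in> borel_measurable borel" "\<And>x. integrable (dmeas 0 x) (\<lambda>y. \<bar>f y\<bar> powr r)"
  shows "Lloc r f"
  unfolding Lloc_def using assms by (auto intro!: set_integrable_compact)

lemma LlocD:
  fixes f :: "real^'n::finite \<Rightarrow> real"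
  assumes "Lloc r f"
  shows "f \<in> borel_measurable borel" "integrable (dmeas j x) (\<lambda>y. \<bar>f y\<bar> powr r)"
  using assms by (auto simp: Lloc_iff)

lemma Lloc1_integrable: "Lloc 1 f \<Longrightarrow> integrable (dmeas j x) f"
  using LlocD[of 1 f] by (simp add: integrable_abs_iff)

lemma Lloc_diff: "r \<ge> 0 \<Longrightarrow> Lloc r f \<Longrightarrow> Lloc r g \<Longrightarrow> Lloc r (\<lambda>y. f y - g y)"
  using integrable_powr_add[of r f "\<lambda>y. - g y"] by (auto simp: Lloc_iff)

lemma Lloc_dlevel: "dlevel k (\<phi> :: real^'n::finite \<Rightarrow> real) \<Longrightarrow> Lloc r \<phi>"
  unfolding Lloc_iff by (intro conjI allI dlevel_borel_measurable dlevel_integrable[OF dlevel_comp])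

lemma Lloc_convI:
  fixes g :: "real^'n::finite \<Rightarrow> real"
  assumes r: "r \<ge> 0" and g: "Lloc r g" and F: "\<And>M. Lloc r (F M)"
    and lim: "\<And>x. (\<lambda>M. dmean 0 (\<lambda>y. \<bar>F M y - g y\<bar> powr r) x) \<longlonglongrightarrow> 0"
  shows "Lloc_conv r F g"
  unfolding Lloc_conv_def
proof (intro conjI allI impI g F)
  fix K :: "(real^'n) set" assume K: "compact K"
  obtain P where P: "finite P" "K \<subseteq> (\<Union>m\<in>P. dcube 0 (corner 0 m))" using compact_subset_unit_cubes[OF K] by blast
  note D = LlocD[OF Lloc_diff[OF r F g]]
  have [measurable]: "F M \<in> borel_measurable borel" "g \<in> borel_measurable borel" for M using LlocD(1) F g by auto
  define h where "h M y = \<bar>F M y - g y\<bar> powr r" for M y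
  have [measurable]: "h M \<in> borel_measurable borel" for M unfolding h_def by measurable
  have hi: "set_integrable lborel (dcube 0 x) (h M)" for x M
    using D(2)[of 0 x M] unfolding h_def[abs_def] by (subst integrable_dmeas_iff[symmetric]) auto
  have le: "(LINT x:K|lborel. h M x) \<le> (\<Sum>m\<in>P. dmean 0 (h M) (corner 0 m))" for M
  proof -
    have "(LINT x:K|lborel. h M x) \<le> (LINT x|lborel. (\<Sum>m\<in>P. indicator (dcube 0 (corner 0 m)) x * h M x))"
      unfolding set_lebesgue_integral_def
    proof (rule integral_mono')
      show "integrable lborel (\<lambda>x. \<Sum>m\<in>P. indicator (dcube 0 (corner 0 m)) x * h M x)"
        using hi by (intro Bochner_Integration.integrable_sum) (auto simp: set_integrable_def)
      fix x
      show "0 \<le> (\<Sum>m\<in>P. indicator (dcube 0 (corner 0 m)) x * h M x)" by (intro sum_nonneg) (auto simp: h_def)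
      show "indicator K x *\<^sub>R h M x \<le> (\<Sum>m\<in>P. indicator (dcube 0 (corner 0 m)) x * h M x)"
      proof (cases "x \<in> K")
        case True
        then obtain m where m: "m \<in> P" "x \<in> dcube 0 (corner 0 m)" using P by blast
        have "indicator (dcube 0 (corner 0 m)) x * h M x \<le> (\<Sum>m\<in>P. indicator (dcube 0 (corner 0 m)) x * h M x)"
          by (rule member_le_sum[OF m(1) _ P(1)]) (auto simp: h_def)
        then show ?thesis using True m by simp
      qed (auto simp: h_def intro!: sum_nonneg)
    qed
    also have "\<dots> = (\<Sum>m\<in>P. LINT x:dcube 0 (corner 0 m)|lborel. h M x)"
      unfolding set_lebesgue_integral_def using hi
      by (subst Bochner_Integration.integral_sum) (auto simp: set_integrable_def)
    also have "\<dots> = (\<Sum>m\<in>P. dmean 0 (h M) (corner 0 m))"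
      by (subst dmean_eq_set_integral) auto
    finally show ?thesis .
  qed
  have "(\<lambda>M. LINT x:K|lborel. h M x) \<longlonglongrightarrow> 0"
  proof (rule tendsto_sandwich[OF _ _ tendsto_const])
    have "(\<lambda>M. \<Sum>m\<in>P. dmean 0 (h M) (corner 0 m)) \<longlonglongrightarrow> (\<Sum>m\<in>P. 0)"
      unfolding h_def by (intro tendsto_sum lim)
    then show "(\<lambda>M. \<Sum>m\<in>P. dmean 0 (h M) (corner 0 m)) \<longlonglongrightarrow> 0" by simp
  qed (use le in \<open>auto intro!: always_eventually simp: set_lebesgue_integral_def h_def\<close>)
  then show "(\<lambda>M. LINT x:K|lborel. \<bar>F M x - g x\<bar> powr r) \<longlonglongrightarrow> 0" by (simp add: h_def)
qed

lemma Lloc_convD: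
  fixes g :: "real^'n::finite \<Rightarrow> real"
  assumes C: "Lloc_conv r F g" and r: "r \<ge> 0"
  shows "Lloc r g" "Lloc r (F M)" "(\<lambda>M. dmean j (\<lambda>y. \<bar>F M y - g y\<bar> powr r) x) \<longlonglongrightarrow> 0"
proof -
  show g: "Lloc r g" and F: "Lloc r (F M)" for M using C by (auto simp: Lloc_conv_def)
  obtain K where K: "compact K" "dcube j x \<subseteq> K" using dcube_subset_compact by blast
  have [measurable]: "F M \<in> borel_measurable borel" "g \<in> borel_measurable borel" for M using LlocD(1) F g by auto
  have lim: "(\<lambda>M. 2 powr (real_of_int j * real CARD('n)) * (LINT x:K|lborel. \<bar>F M x - g x\<bar> powr r)) \<longlonglongrightarrow> 2 powr (real_of_int j * real CARD('n)) * 0"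
    using C K by (intro tendsto_mult tendsto_const) (auto simp: Lloc_conv_def)
  have le: "dmean j (\<lambda>y. \<bar>F M y - g y\<bar> powr r) x \<le> 2 powr (real_of_int j * real CARD('n)) * (LINT x:K|lborel. \<bar>F M x - g x\<bar> powr r)" for M
  proof -
    have "(LINT y:dcube j x|lborel. \<bar>F M y - g y\<bar> powr r) \<le> (LINT y:K|lborel. \<bar>F M y - g y\<bar> powr r)"
      unfolding set_lebesgue_integral_def
    proof (rule integral_mono')
      show "integrable lborel (\<lambda>y. indicator K y *\<^sub>R \<bar>F M y - g y\<bar> powr r)"
        using Lloc_diff[OF r F g] K by (auto simp: Lloc_def set_integrable_def)
    qed (use K in \<open>auto simp: indicator_def\<close>)
    then have "2 powr (- real_of_int j * real CARD('n)) * dmean j (\<lambda>y. \<bar>F M y - g y\<bar> powr r) x \<le> (LINT y:K|lborel. \<bar>F M y - g y\<bar> powr r)"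
      by (subst (asm) dmean_eq_set_integral) auto
    then have "2 powr (real_of_int j * real CARD('n)) * (2 powr (- real_of_int j * real CARD('n)) * dmean j (\<lambda>y. \<bar>F M y - g y\<bar> powr r) x) \<le> 2 powr (real_of_int j * real CARD('n)) * (LINT y:K|lborel. \<bar>F M y - g y\<bar> powr r)"
      by (rule mult_left_mono) simp
    moreover have "2 powr (real_of_int j * real CARD('n)) * 2 powr (- real_of_int j * real CARD('n)) = 1"
      by (simp flip: powr_add)
    ultimately show ?thesis by (simp only: mult.assoc[symmetric] mult_1)
  qed
  show "(\<lambda>M. dmean j (\<lambda>y. \<bar>F M y - g y\<bar> powr r) x) \<longlonglongrightarrow> 0"
    by (rule tendsto_sandwich[OF _ _ tendsto_const lim[unfolded mult_zero_right]])
       (use le in \<open>auto intro!: always_eventually dmean_nonneg simp del: mult_le_cancel_left\<close>)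
qed

text \<open>Through this lemma a limit picked by choice becomes accessible: it agrees almost
  everywhere with any limit exhibited explicitly.\<close>

lemma Lloc_conv_unique:
  fixes g :: "real^'n::finite \<Rightarrow> real"
  assumes "Lloc_conv r F g" "Lloc_conv r F g'" "r > 0"
  shows "AE y in lborel. g y = g' y"
proof (rule AE_lborel_dmeas[where j=0])
  fix x
  note D = Lloc_convD[OF assms(1)] Lloc_convD[OF assms(2)]
  have r: "r \<ge> 0" using assms by simp
  have [measurable]: "F M \<in> borel_measurable borel" "g \<in> borel_measurable borel" "g' \<in> borel_measurable borel" for M
    using D(1,2,4)[OF r] LlocD(1) by auto
  have i: "integrable (dmeas 0 x) (\<lambda>y. \<bar>F M y - g y\<bar> powr r)" "integrable (dmeas 0 x) (\<lambda>y. \<bar>F M y - g' y\<bar> powr r)" for M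
    using LlocD(2)[OF Lloc_diff[OF r D(2)[OF r] D(1)[OF r]]] LlocD(2)[OF Lloc_diff[OF r D(5)[OF r] D(4)[OF r]]] by auto
  have gi: "integrable (dmeas 0 x) (\<lambda>y. \<bar>g y - g' y\<bar> powr r)"
    using LlocD(2)[OF Lloc_diff[OF r D(1)[OF r] D(4)[OF r]]] by auto
  have "dmean 0 (\<lambda>y. \<bar>g y - g' y\<bar> powr r) x \<le> 3 powr r * (dmean 0 (\<lambda>y. \<bar>F M y - g y\<bar> powr r) x + dmean 0 (\<lambda>y. \<bar>F M y - g' y\<bar> powr r) x)" for M
  proof -
    have "dmean 0 (\<lambda>y. \<bar>g y - g' y\<bar> powr r) x \<le> dmean 0 (\<lambda>y. 3 powr r * (\<bar>F M y - g y\<bar> powr r + \<bar>F M y - g' y\<bar> powr r)) x"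
    proof (rule dmean_mono'[OF _ gi])
      fix y
      have "\<bar>g y - g' y\<bar> powr r \<le> (\<bar>F M y - g y\<bar> + \<bar>F M y - g' y\<bar> + 0) powr r" using r by (intro powr_mono2) auto
      also have "\<dots> \<le> 3 powr r * (\<bar>F M y - g y\<bar> powr r + \<bar>F M y - g' y\<bar> powr r + 0 powr r)"
        by (rule add3_powr_le) (use r in auto)
      finally show "\<bar>g y - g' y\<bar> powr r \<le> 3 powr r * (\<bar>F M y - g y\<bar> powr r + \<bar>F M y - g' y\<bar> powr r)" by simp
    qed (use i in auto)
    then show ?thesis using i by (simp add: dmean_add)
  qed
  note le = this
  have "(\<lambda>M. 3 powr r * (dmean 0 (\<lambda>y. \<bar>F M y - g y\<bar> powr r) x + dmean 0 (\<lambda>y. \<bar>F M y - g' y\<bar> powr r) x)) \<longlonglongrightarrow> 3 powr r * (0 + 0)"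
    by (intro tendsto_intros D r)
  then have "dmean 0 (\<lambda>y. \<bar>g y - g' y\<bar> powr r) x \<le> 3 powr r * (0 + 0)"
    by (rule LIMSEQ_le_const) (use le in blast)
  moreover have "0 \<le> dmean 0 (\<lambda>y. \<bar>g y - g' y\<bar> powr r) x" by (rule dmean_nonneg) simp
  ultimately have "dmean 0 (\<lambda>y. \<bar>g y - g' y\<bar> powr r) x = 0" by (intro order_antisym) simp_all
  then have "(\<integral>y. \<bar>g y - g' y\<bar> powr r \<partial>dmeas 0 x) = 0" unfolding dmean_def .
  then have "AE y in dmeas 0 x. \<bar>g y - g' y\<bar> powr r = 0"
    using gi by (subst (asm) integral_nonneg_eq_0_iff_AE) auto
  then show "AE y in dmeas 0 x. g y = g' y" by eventually_elim simp
qed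

lemma Lloc_conv_AE_subseq:
  fixes g :: "real^'n::finite \<Rightarrow> real"
  assumes "Lloc_conv 1 F g"
  shows "\<exists>\<sigma>. strict_mono \<sigma> \<and> (AE y in dmeas j x. (\<lambda>k. F (\<sigma> k) y) \<longlonglongrightarrow> g y)"
proof -
  note D = Lloc_convD[OF assms, simplified]
  have i: "integrable (dmeas j x) (\<lambda>y. F M y - g y)" for M
    using Lloc1_integrable[OF D(1)] Lloc1_integrable[OF D(2)] by (intro Bochner_Integration.integrable_diff)
  have "\<exists>\<sigma>::nat\<Rightarrow>nat. strict_mono \<sigma> \<and> (AE y in dmeas j x. (\<lambda>k. F (\<sigma> k) y - g y) \<longlonglongrightarrow> 0)"
    by (rule tendsto_L1_AE_subseq[where u="\<lambda>M y. F M y - g y"]) (use i D(3) in \<open>auto simp: dmean_def\<close>)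
  then obtain \<sigma> :: "nat \<Rightarrow> nat" where \<sigma>: "strict_mono \<sigma>" "AE y in dmeas j x. (\<lambda>k. F (\<sigma> k) y - g y) \<longlonglongrightarrow> 0" by blast
  from \<sigma>(2) have "AE y in dmeas j x. (\<lambda>k. F (\<sigma> k) y) \<longlonglongrightarrow> g y" by eventually_elim (rule LIM_zero_cancel)
  with \<sigma>(1) show ?thesis by blast
qed

lemma Lloc_conv_subseq:
  fixes g :: "real^'n::finite \<Rightarrow> real"
  assumes "Lloc_conv r F g" "strict_mono \<sigma>"
  shows "Lloc_conv r (\<lambda>k. F (\<sigma> k)) g"
  using assms unfolding Lloc_conv_def by (auto intro: LIMSEQ_subseq_LIMSEQ[unfolded o_def])

text \<open>The commutator combines two separately chosen limits, and both are needed along one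
  subsequence; the second one is extracted from the first.\<close>

lemma Lloc_conv_AE_subseq2:
  fixes g h :: "real^'n::finite \<Rightarrow> real"
  assumes "Lloc_conv 1 F g" "Lloc_conv 1 G h"
  shows "\<exists>\<sigma>. strict_mono \<sigma> \<and> (AE y in dmeas j x. (\<lambda>k::nat. F (\<sigma> k) y) \<longlonglongrightarrow> g y \<and> (\<lambda>k. G (\<sigma> k) y) \<longlonglongrightarrow> h y)"
proof -
  obtain \<sigma> where \<sigma>: "strict_mono \<sigma>" "AE y in dmeas j x. (\<lambda>k. F (\<sigma> k) y) \<longlonglongrightarrow> g y"
    using Lloc_conv_AE_subseq[OF assms(1)] by blast
  obtain \<tau> where \<tau>: "strict_mono \<tau>" "AE y in dmeas j x. (\<lambda>k. G (\<sigma> (\<tau> k)) y) \<longlonglongrightarrow> h y"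
    using Lloc_conv_AE_subseq[OF Lloc_conv_subseq[OF assms(2) \<sigma>(1)]] by blast
  have "AE y in dmeas j x. (\<lambda>k. F (\<sigma> (\<tau> k)) y) \<longlonglongrightarrow> g y \<and> (\<lambda>k. G (\<sigma> (\<tau> k)) y) \<longlonglongrightarrow> h y"
    using \<sigma>(2) \<tau>(2) by eventually_elim (auto intro: LIMSEQ_subseq_LIMSEQ[OF _ \<tau>(1), unfolded o_def])
  moreover have "strict_mono (\<lambda>k. \<sigma> (\<tau> k))" using \<sigma>(1) \<tau>(1) by (auto simp: strict_mono_def)
  ultimately show ?thesis by blast
qed

text \<open>The Riesz--Fischer argument. The formula for \<open>g\<close> does not mention the
  measure, so a single function serves as the limit on all unit cubes at once.\<close>

lemma L1_series_limit:
  fixes F :: "nat \<Rightarrow> 'a \<Rightarrow> real"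
  assumes Fi: "\<And>M. integrable N (F M)" and s: "summable (\<lambda>M. \<integral>y. \<bar>F (Suc M) y - F M y\<bar> \<partial>N)"
  defines "g \<equiv> \<lambda>y. F 0 y + (\<Sum>M. F (Suc M) y - F M y)"
  shows "integrable N g" "(\<lambda>M. \<integral>y. \<bar>F M y - g y\<bar> \<partial>N) \<longlonglongrightarrow> 0"
proof -
  define d where "d M y = F (Suc M) y - F M y" for M y
  have di: "integrable N (d M)" for M unfolding d_def using Fi by simp
  have [measurable]: "F M \<in> borel_measurable N" "d M \<in> borel_measurable N" for M using Fi di by auto
  have "(\<integral>\<^sup>+y. (\<Sum>M. ennreal \<bar>d M y\<bar>) \<partial>N) = (\<Sum>M. \<integral>\<^sup>+y. ennreal \<bar>d M y\<bar> \<partial>N)"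
    by (rule nn_integral_suminf) auto
  also have "\<dots> = (\<Sum>M. ennreal (\<integral>y. \<bar>d M y\<bar> \<partial>N))"
    using di by (subst nn_integral_eq_integral) auto
  also have "\<dots> = ennreal (\<Sum>M. \<integral>y. \<bar>d M y\<bar> \<partial>N)"
    by (rule suminf_ennreal2) (use s in \<open>auto simp: d_def\<close>)
  finally have fin: "(\<integral>\<^sup>+y. (\<Sum>M. ennreal \<bar>d M y\<bar>) \<partial>N) \<noteq> \<infinity>" by simp
  have "AE y in N. (\<Sum>M. ennreal \<bar>d M y\<bar>) \<noteq> \<infinity>"
    by (rule nn_integral_PInf_AE[OF _ fin]) auto
  then have sm: "AE y in N. summable (\<lambda>M. norm (d M y))"
    by eventually_elim (auto intro!: summable_suminf_not_top)
  have sN: "summable (\<lambda>M. \<integral>y. norm (d M y) \<partial>N)" using s by (simp add: d_def)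
  have wi: "integrable N (\<lambda>y. \<Sum>M. norm (d M y))"
    by (rule integrable_suminf) (use di sm sN in auto)
  have gi: "integrable N (\<lambda>y. \<Sum>M. d M y)"
    by (rule integrable_suminf[OF di sm sN])
  then show "integrable N g" unfolding g_def d_def[symmetric] using Fi by simp
  have tele: "F 0 y + (\<Sum>i<M. d i y) = F M y" for M y
    by (induction M) (auto simp: d_def)
  have "(\<lambda>M. \<integral>y. \<bar>F M y - g y\<bar> \<partial>N) \<longlonglongrightarrow> (\<integral>y. 0 \<partial>N)"
  proof (rule integral_dominated_convergence[where w="\<lambda>y. 2 * (\<Sum>M. norm (d M y))"])
    show "AE y in N. (\<lambda>M. \<bar>F M y - g y\<bar>) \<longlonglongrightarrow> 0"
      using sm
    proof eventually_elim
      fix y assume "summable (\<lambda>M. norm (d M y))"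
      then have "(\<lambda>M. \<Sum>i<M. d i y) \<longlonglongrightarrow> (\<Sum>M. d M y)" by (rule summable_LIMSEQ[OF summable_norm_cancel])
      then have "(\<lambda>M. F 0 y + (\<Sum>i<M. d i y)) \<longlonglongrightarrow> g y" unfolding g_def d_def[symmetric] by (intro tendsto_intros)
      then have "(\<lambda>M. F M y) \<longlonglongrightarrow> g y" unfolding tele .
      then have "(\<lambda>M. \<bar>F M y - g y\<bar>) \<longlonglongrightarrow> \<bar>g y - g y\<bar>" by (intro tendsto_intros)
      then show "(\<lambda>M. \<bar>F M y - g y\<bar>) \<longlonglongrightarrow> 0" by simp
    qed
    show "AE y in N. norm \<bar>F M y - g y\<bar> \<le> 2 * (\<Sum>M. norm (d M y))" for M
      using sm
    proof eventually_elim
      fix y assume s: "summable (\<lambda>M. norm (d M y))"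
      have "\<bar>\<Sum>i<M. d i y\<bar> \<le> (\<Sum>i<M. norm (d i y))" using sum_abs by (simp add: sum_abs)
      also have "\<dots> \<le> (\<Sum>M. norm (d M y))" by (rule sum_le_suminf[OF s]) auto
      finally have 1: "\<bar>\<Sum>i<M. d i y\<bar> \<le> (\<Sum>M. norm (d M y))" .
      have 2: "\<bar>\<Sum>M. d M y\<bar> \<le> (\<Sum>M. norm (d M y))" using summable_norm[OF s] by simp
      have "F M y - g y = (\<Sum>i<M. d i y) - (\<Sum>M. d M y)" unfolding g_def d_def[symmetric] tele[of y M, symmetric] by simp
      then show "norm \<bar>F M y - g y\<bar> \<le> 2 * (\<Sum>M. norm (d M y))" using 1 2 by simp
    qed
  qed (use \<open>integrable N g\<close> wi in auto)
  then show "(\<lambda>M. \<integral>y. \<bar>F M y - g y\<bar> \<partial>N) \<longlonglongrightarrow> 0" by simp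
qed

lemma dlevel_frac_partial:
  fixes f :: "real^'n::finite \<Rightarrow> real"
  assumes fi: "\<And>j x. integrable (dmeas j x) f"
  shows "dlevel (int M + 1) (frac_partial \<alpha> f M)"
proof -
  have e: "frac_partial \<alpha> f M = (\<lambda>x. \<Sum>j\<in>{- int M..int M}. 2 powr (- real_of_int j * \<alpha>) * (dmean (j+1) f x - dmean j f x))"
    using frac_partial_eq[OF fi] by blast
  show ?thesis unfolding e
    by (intro dlevel_sum dlevel_comp2[of _ "dmean (_+1) f" "dmean _ f" "\<lambda>u v. 2 powr (- real_of_int _ * \<alpha>) * (u - v)"] dlevel_dmean_le) auto
qed

text \<open>On a unit cube the increments at fine levels have geometrically small L^1 means because
  \<alpha> > 0. Those at coarse levels are controlled by means of |f| over growing cubes, for which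
  the last hypothesis is made.\<close>

lemma frac_int_exists:
  fixes f :: "real^'n::finite \<Rightarrow> real"
  assumes \<alpha>: "0 < \<alpha>" and f: "Lloc 1 f"
    and s: "\<And>x. summable (\<lambda>k. 2 powr (real k * \<alpha>) * dmean (- int k) (\<lambda>y. \<bar>f y\<bar>) x)"
  shows "Lloc_conv 1 (frac_partial \<alpha> f) (frac_int \<alpha> f)"
proof -
  note fi = Lloc1_integrable[OF f]
  define P where "P = frac_partial \<alpha> f"
  define u where "u j x = 2 powr (- real_of_int j * \<alpha>) * (dmean (j+1) f x - dmean j f x)" for j x
  define g where "g = (\<lambda>y. P 0 y + (\<Sum>M. P (Suc M) y - P M y))"
  have PL: "Lloc 1 (P M)" for M unfolding P_def using dlevel_frac_partial[OF fi] by (rule Lloc_dlevel)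
  have [measurable]: "P M \<in> borel_measurable borel" for M using PL LlocD(1) by blast
  have Pi: "integrable (dmeas j x) (P M)" for j x M using PL by (rule Lloc1_integrable)
  have ui: "integrable (dmeas j x) (u i)" for i j x unfolding u_def by simp
  have step: "P (Suc M) y - P M y = u (int M + 1) y + u (- int M - 1) y" for M y
  proof -
    have "{- int (Suc M)..int (Suc M)} = insert (- int M - 1) (insert (int M + 1) {- int M..int M})" by auto
    then show ?thesis unfolding P_def frac_partial_eq[OF fi] u_def[symmetric] by simp
  qed
  have ub: "\<bar>u j y\<bar> \<le> 2 powr (- real_of_int j * \<alpha>) * (dmean (j+1) (\<lambda>y. \<bar>f y\<bar>) y + dmean j (\<lambda>y. \<bar>f y\<bar>) y)" for j y
    unfolding u_def abs_mult using dmean_abs_le[of "j+1" f y] dmean_abs_le[of j f y] by (auto intro!: mult_left_mono)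
  have up: "dmean 0 (\<lambda>y. \<bar>u (int M + 1) y\<bar>) x \<le> 2 * dmean 0 (\<lambda>y. \<bar>f y\<bar>) x * (2 powr (-\<alpha>)) ^ Suc M" for M x
  proof -
    have "dmean 0 (\<lambda>y. \<bar>u (int M + 1) y\<bar>) x \<le> dmean 0 (\<lambda>y. 2 powr (- real_of_int (int M + 1) * \<alpha>) * (dmean (int M+1+1) (\<lambda>y. \<bar>f y\<bar>) y + dmean (int M + 1) (\<lambda>y. \<bar>f y\<bar>) y)) x"
      by (rule dmean_mono'[OF _ _ ub]) (use ui in auto)
    also have "\<dots> = 2 powr (- real_of_int (int M + 1) * \<alpha>) * (dmean 0 (dmean (int M + 1 + 1) (\<lambda>y. \<bar>f y\<bar>)) x + dmean 0 (dmean (int M + 1) (\<lambda>y. \<bar>f y\<bar>)) x)"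
      by (simp add: dmean_add)
    also have "\<dots> = 2 powr (- real_of_int (int M + 1) * \<alpha>) * (2 * dmean 0 (\<lambda>y. \<bar>f y\<bar>) x)"
      using fi by (subst (1 2) dmean_dmean) auto
    also have "2 powr (- real_of_int (int M + 1) * \<alpha>) = (2 powr (-\<alpha>)) ^ Suc M"
    proof -
      have "(2 powr (-\<alpha>)) ^ Suc M = 2 powr (-\<alpha> * real (Suc M))" by (simp only: powr_realpow[symmetric] powr_gt_zero powr_powr)
      also have "-\<alpha> * real (Suc M) = - real_of_int (int M + 1) * \<alpha>" by (simp add: algebra_simps)
      finally show ?thesis by simp
    qed
    finally show ?thesis by (simp add: mult_ac)
  qed
  define v where "v k x = 2 powr (real k * \<alpha>) * dmean (- int k) (\<lambda>y. \<bar>f y\<bar>) x" for k x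
  have down: "dmean 0 (\<lambda>y. \<bar>u (- int M - 1) y\<bar>) x \<le> 2 powr \<alpha> * v M x + v (Suc M) x" for M x
  proof -
    define i where "i = - int M - 1"
    have i: "i + 1 = - int M" "i = - int (Suc M)" "- real_of_int i = real (Suc M)" by (auto simp: i_def)
    \<comment> \<open>Both averages in \<open>u i\<close> have level at most 0, so
      \<open>u i\<close> is constant on the unit cube and its mean is its value.\<close>
    have "dmean 0 (\<lambda>y. \<bar>u i y\<bar>) x = \<bar>u i x\<bar>"
    proof (rule dmean_dlevel)
      show "dlevel 0 (\<lambda>y. \<bar>u i y\<bar>)" unfolding u_def
        by (rule dlevel_comp2[OF dlevel_dmean_le dlevel_dmean_le, where h="\<lambda>a b. \<bar>2 powr (- real_of_int i * \<alpha>) * (a - b)\<bar>"]) (auto simp: i_def)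
    qed
    also have "\<dots> \<le> 2 powr (- real_of_int i * \<alpha>) * (dmean (i+1) (\<lambda>y. \<bar>f y\<bar>) x + dmean i (\<lambda>y. \<bar>f y\<bar>) x)"
      by (rule ub)
    also have "\<dots> = 2 powr (real (Suc M) * \<alpha>) * (dmean (- int M) (\<lambda>y. \<bar>f y\<bar>) x + dmean (- int (Suc M)) (\<lambda>y. \<bar>f y\<bar>) x)"
      unfolding i(1) i(3) unfolding i(2) ..
    also have "\<dots> = 2 powr \<alpha> * v M x + v (Suc M) x"
      unfolding v_def distrib_left by (simp add: distrib_right powr_add)
    finally show ?thesis unfolding i_def .
  qed
  have sum: "summable (\<lambda>M. \<integral>y. \<bar>P (Suc M) y - P M y\<bar> \<partial>dmeas 0 x)" for x
  proof (rule summable_comparison_test')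
    have z: "norm ((2::real) powr (-\<alpha>)) < 1" using \<alpha> by (simp add: powr_less_one)
    have "summable (\<lambda>M. 2 * dmean 0 (\<lambda>y. \<bar>f y\<bar>) x * (2 powr (-\<alpha>)) ^ Suc M)"
      using summable_geometric[OF z] by (intro summable_mult) (simp add: summable_mult)
    moreover have sv: "summable (\<lambda>M. v M x)" unfolding v_def by (rule s)
    moreover have "summable (\<lambda>M. v (Suc M) x)" using sv by (subst summable_Suc_iff)
    ultimately show "summable (\<lambda>M. 2 * dmean 0 (\<lambda>y. \<bar>f y\<bar>) x * (2 powr (-\<alpha>)) ^ Suc M + (2 powr \<alpha> * v M x + v (Suc M) x))"
      by (intro summable_add summable_mult[of "\<lambda>M. v M x"])
    show "norm (\<integral>y. \<bar>P (Suc M) y - P M y\<bar> \<partial>dmeas 0 x) \<le> 2 * dmean 0 (\<lambda>y. \<bar>f y\<bar>) x * (2 powr (-\<alpha>)) ^ Suc M + (2 powr \<alpha> * v M x + v (Suc M) x)" for M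
    proof -
      have "dmean 0 (\<lambda>y. \<bar>P (Suc M) y - P M y\<bar>) x \<le> dmean 0 (\<lambda>y. \<bar>u (int M + 1) y\<bar> + \<bar>u (- int M - 1) y\<bar>) x"
        by (rule dmean_mono') (use ui Pi in \<open>auto simp: step\<close>)
      also have "\<dots> = dmean 0 (\<lambda>y. \<bar>u (int M + 1) y\<bar>) x + dmean 0 (\<lambda>y. \<bar>u (- int M - 1) y\<bar>) x"
        using ui by (intro dmean_add) auto
      also have "\<dots> \<le> 2 * dmean 0 (\<lambda>y. \<bar>f y\<bar>) x * (2 powr (-\<alpha>)) ^ Suc M + (2 powr \<alpha> * v M x + v (Suc M) x)"
        by (intro add_mono up down)
      finally show ?thesis using dmean_nonneg[of 0 x "\<lambda>y. \<bar>P (Suc M) y - P M y\<bar>"] by (simp add: dmean_def)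
    qed
  qed
  have gi: "integrable (dmeas 0 x) g" for x unfolding g_def by (rule L1_series_limit(1)[OF Pi sum])
  have lim: "(\<lambda>M. dmean 0 (\<lambda>y. \<bar>P M y - g y\<bar>) x) \<longlonglongrightarrow> 0" for x
    unfolding g_def dmean_def by (rule L1_series_limit(2)[OF Pi sum])
  have [measurable]: "g \<in> borel_measurable borel" unfolding g_def by measurable
  have "Lloc_conv 1 P g"
    by (rule Lloc_convI) (use PL gi lim in \<open>auto intro!: LlocI\<close>)
  then show ?thesis unfolding P_def frac_int_def by (rule someI[where P="Lloc_conv 1 (frac_partial \<alpha> f)"])
qed

section \<open>The upper bound\<close>

lemma morrey_quotient_eq:
  fixes f :: "real^'n::finite \<Rightarrow> real"
  assumes [measurable]: "f \<in> borel_measurable borel"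
  shows "measure lborel (dcube j x) powr (1/p - 1/q) * (LINT y:dcube j x|lborel. \<bar>f y\<bar> powr q) powr (1/q)
    = 2 powr (- (real_of_int j * (real CARD('n) / p))) * (dmean j (\<lambda>y. \<bar>f y\<bar> powr q) x) powr (1/q)"
proof -
  define N where "N = - real_of_int j * real CARD('n)"
  have "measure lborel (dcube j x) powr (1/p - 1/q) * (LINT y:dcube j x|lborel. \<bar>f y\<bar> powr q) powr (1/q)
    = 2 powr (N * (1/p - 1/q)) * (2 powr (N * (1/q)) * (dmean j (\<lambda>y. \<bar>f y\<bar> powr q) x) powr (1/q))"
    by (subst dmean_eq_set_integral) (auto simp: measure_dcube powr_powr powr_mult dmean_nonneg N_def)
  also have "\<dots> = 2 powr (N * (1/p - 1/q) + N * (1/q)) * (dmean j (\<lambda>y. \<bar>f y\<bar> powr q) x) powr (1/q)"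
    unfolding powr_add by simp
  also have "N * (1/p - 1/q) + N * (1/q) = - (real_of_int j * (real CARD('n) / p))"
    by (simp add: N_def algebra_simps)
  finally show ?thesis .
qed

lemma morrey_norm_le_iff:
  fixes f :: "real^'n::finite \<Rightarrow> real"
  assumes [measurable]: "f \<in> borel_measurable borel"
  shows "morrey_norm p q f \<le> ereal F \<longleftrightarrow>
    (\<forall>j x. (dmean j (\<lambda>y. \<bar>f y\<bar> powr q) x) powr (1/q) \<le> F * 2 powr (real_of_int j * (real CARD('n) / p)))"
proof -
  have eq: "(2 powr (- u) * v \<le> F) \<longleftrightarrow> v \<le> F * 2 powr u" for u v :: real
    by (simp add: powr_minus field_simps)
  have "morrey_norm p q f \<le> ereal F \<longleftrightarrow> (\<forall>j x. measure lborel (dcube j x) powr (1/p - 1/q) * (LINT y:dcube j (x::real^'n)|lborel. \<bar>f y\<bar> powr q) powr (1/q) \<le> F)"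
    unfolding morrey_norm_def dyadic_cubes_eq SUP_le_iff by auto
  then show ?thesis unfolding morrey_quotient_eq[OF assms] eq .
qed

lemma morrey_leI:
  fixes f :: "real^'n::finite \<Rightarrow> real"
  assumes "f \<in> morrey p q" "morrey_norm p q f \<le> ereal F" "0 < F"
  shows "morrey_le p q f F"
proof -
  have L: "Lloc q f" using assms by (simp add: morrey_def)
  then show ?thesis
    using assms(2,3) unfolding morrey_le_def morrey_norm_le_iff[OF LlocD(1)[OF L]] by (auto simp: Lloc_iff)
qed

lemma morrey_le_imp:
  fixes f :: "real^'n::finite \<Rightarrow> real"
  assumes "morrey_le p q f F"
  shows "f \<in> morrey p q" "morrey_norm p q f \<le> ereal F"
proof -
  note D = morrey_leD[OF assms]
  have L: "Lloc q f" unfolding Lloc_iff using D by auto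
  show le: "morrey_norm p q f \<le> ereal F" unfolding morrey_norm_le_iff[OF D(2)] using D(4) by auto
  have "morrey_norm p q f < \<infinity>" using le by (rule order.strict_trans1) simp
  then show "f \<in> morrey p q" using L by (simp add: morrey_def)
qed

lemma morrey_le_AE_cong:
  fixes f g :: "real^'n::finite \<Rightarrow> real"
  assumes f: "morrey_le p q f F" and ae: "AE y in lborel. g y = f y" and [measurable]: "g \<in> borel_measurable borel"
  shows "morrey_le p q g F"
proof -
  note D = morrey_leD[OF f]
  note [measurable] = D(2)
  have ae': "AE y in dmeas j x. \<bar>g y\<bar> powr q = \<bar>f y\<bar> powr q" for j x
    using AE_dmeas_lborel[OF ae] by eventually_elim simp
  have "integrable (dmeas j x) (\<lambda>y. \<bar>g y\<bar> powr q)" for j x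
    by (subst integrable_cong_AE[OF _ _ ae']) (use D in auto)
  moreover have "dmean j (\<lambda>y. \<bar>g y\<bar> powr q) x = dmean j (\<lambda>y. \<bar>f y\<bar> powr q) x" for j x
    unfolding dmean_def by (rule integral_cong_AE[OF _ _ ae']) auto
  ultimately show ?thesis using D by (auto simp: morrey_le_def)
qed

lemma mean_oscillation_eq:
  fixes a :: "real^'n::finite \<Rightarrow> real"
  assumes [measurable]: "a \<in> borel_measurable borel"
  shows "cube_mean (dcube j x) (\<lambda>y. \<bar>a y - cube_mean (dcube j x) a\<bar>) = dmean j (\<lambda>y. \<bar>a y - dmean j a x\<bar>) x"
  unfolding cube_mean_dcube[OF assms] by (rule cube_mean_dcube) measurable

lemma sharp_dyadic_eq:
  fixes a :: "real^'n::finite \<Rightarrow> real"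
  assumes "a \<in> borel_measurable borel"
  shows "sharp_dyadic a x = (SUP j. ereal (dmean j (\<lambda>y. \<bar>a y - dmean j a x\<bar>) x))"
proof -
  have "{Q \<in> dyadic_cubes. x \<in> Q} = range (\<lambda>j. dcube j x)"
    unfolding dyadic_cubes_eq using dcube_eq by fastforce
  then show ?thesis unfolding sharp_dyadic_def image_image mean_oscillation_eq[OF assms, symmetric] by (simp add: image_image)
qed

text \<open>A cube has positive measure, so it contains a point at which the essential bound holds;
  the oscillation over the cube does not depend on the point chosen in it.\<close>

lemma bmo_leI:
  fixes a :: "real^'n::finite \<Rightarrow> real"
  assumes a: "a \<in> bmo_dyadic" "bmo_norm a \<le> ereal b" "0 < b"
  shows "bmo_le a b"
proof -
  have L: "Lloc 1 a" using a by (simp add: bmo_dyadic_def)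
  note [measurable] = LlocD(1)[OF L]
  have "dmean j (\<lambda>y. \<bar>a y - dmean j a x\<bar>) x \<le> b" for j and x :: "real^'n"
  proof -
    have "AE y in lborel. sharp_dyadic a y \<le> ereal b"
      using esssup_AE[of "sharp_dyadic a" lborel] by eventually_elim (use a(2) in \<open>auto simp: bmo_norm_def\<close>)
    then have ae: "AE y in dmeas j x. sharp_dyadic a y \<le> ereal b" by (rule AE_dmeas_lborel)
    have "\<exists>y. y \<in> dcube j x \<and> sharp_dyadic a y \<le> ereal b"
    proof (rule ccontr)
      assume no: "\<not> ?thesis"
      from ae AE_dmeas[of j x] have "AE y in dmeas j x. False" by eventually_elim (use no in blast)
      then show False by simp
    qed
    then obtain y where y: "y \<in> dcube j x" "sharp_dyadic a y \<le> ereal b" by blast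
    have "ereal (dmean j (\<lambda>z. \<bar>a z - dmean j a y\<bar>) y) \<le> ereal b"
      using y(2) unfolding sharp_dyadic_eq[OF \<open>a \<in> borel_measurable borel\<close>] SUP_le_iff by blast
    then show ?thesis using dmean_dcube_cong[OF y(1)] by simp
  qed
  then show ?thesis using a L by (auto simp: bmo_le_def Lloc1_integrable)
qed

text \<open>\<open>esssup\<close> is infinite for a non-measurable function, hence the measurability
  argument: the sharp function is a countable supremum of functions constant on cubes of one
  level.\<close>

lemma bmo_norm_leI:
  fixes a :: "real^'n::finite \<Rightarrow> real"
  assumes [measurable]: "a \<in> borel_measurable borel"
    and le: "\<And>j x. dmean j (\<lambda>y. \<bar>a y - dmean j a x\<bar>) x \<le> v"
  shows "bmo_norm a \<le> ereal v"
  unfolding bmo_norm_def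
proof (rule esssup_I)
  have "dlevel j (\<lambda>x. dmean j (\<lambda>y. \<bar>a y - dmean j a x\<bar>) x)" for j
    unfolding dlevel_def by (auto simp: dmean_dcube_cong)
  then have [measurable]: "(\<lambda>x. dmean j (\<lambda>y. \<bar>a y - dmean j a x\<bar>) x) \<in> borel_measurable borel" for j
    by (rule dlevel_borel_measurable)
  have "(\<lambda>x. SUP j. ereal (dmean j (\<lambda>y. \<bar>a y - dmean j a x\<bar>) x)) \<in> borel_measurable lborel"
    by (intro borel_measurable_SUP) auto
  then show "sharp_dyadic a \<in> borel_measurable lborel" using sharp_dyadic_eq[OF assms(1)] by presburger
  show "AE x in lborel. sharp_dyadic a x \<le> ereal v"
    unfolding sharp_dyadic_eq[OF assms(1)] by (intro AE_I2 SUP_least) (simp add: le)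
qed

lemma morrey_abs_mean_le:
  assumes f: "morrey_le p q (f::real^'n::finite \<Rightarrow> real) F" and q: "1 \<le> q"
  shows "dmean j (\<lambda>y. \<bar>f y\<bar>) x \<le> F * 2 powr (real_of_int j * (real CARD('n) / p))"
  using morrey_le_powr_mean[OF f, of 1 j x] q by (simp add: dmean_nonneg)

lemma morrey_Lloc1:
  assumes f: "morrey_le p q (f::real^'n::finite \<Rightarrow> real) F" and q: "1 \<le> q"
  shows "Lloc 1 f"
  unfolding Lloc_iff using morrey_leD[OF f] powr_dmean_le(1)[OF q morrey_leD(2,3)[OF f]] by auto

text \<open>The oscillation of \<open>a\<close> is replaced by a multiple of \<open>b\<close>, but
  the mean of \<open>a\<close> is kept explicit, because its growth over large cubes must be
  followed later.\<close>

lemma bmo_morrey_mean: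
  assumes q: "1 < q"
  shows "\<exists>C>0. \<forall>(a::real^'n::finite \<Rightarrow> real) b f F j x. bmo_le a b \<longrightarrow> morrey_le p q f F \<longrightarrow>
     Lloc 1 (\<lambda>y. a y * f y) \<and>
     dmean j (\<lambda>y. \<bar>a y * f y\<bar>) x \<le> (\<bar>dmean j a x\<bar> + C * b) * (F * 2 powr (real_of_int j * (real CARD('n) / p)))"
proof -
  obtain C where C: "C > 0" "\<forall>(a::real^'n \<Rightarrow> real) b g j x. bmo_le a b \<longrightarrow> g \<in> borel_measurable borel \<longrightarrow>
    integrable (dmeas j x) (\<lambda>y. \<bar>g y\<bar> powr q) \<longrightarrow>
    integrable (dmeas j x) (\<lambda>y. (a y - dmean j a x) * g y) \<and>
    dmean j (\<lambda>y. \<bar>(a y - dmean j a x) * g y\<bar>) x \<le> C * b * (dmean j (\<lambda>y. \<bar>g y\<bar> powr q) x) powr (1/q)"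
    using bmo_Hoelder[OF q, where 'n='n] by blast
  have "Lloc 1 (\<lambda>y. a y * f y) \<and>
     dmean j (\<lambda>y. \<bar>a y * f y\<bar>) x \<le> (\<bar>dmean j a x\<bar> + C * b) * (F * 2 powr (real_of_int j * (real CARD('n) / p)))"
    if ab: "bmo_le a b" and f: "morrey_le p q f F" for a f :: "real^'n \<Rightarrow> real" and b F j x
  proof -
    note a = bmo_leD[OF ab] and fD = morrey_leD[OF f]
    note [measurable] = a(2) fD(2)
    have f1: "integrable (dmeas j x) f" for j x by (rule powr_dmean_le(1)[OF _ _ fD(3)]) (use q in auto)
    have oi: "integrable (dmeas j x) (\<lambda>y. (a y - dmean j a x) * f y)" for j x
      using C(2) ab fD by blast
    have afi: "integrable (dmeas j x) (\<lambda>y. a y * f y)" for j x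
    proof -
      have "integrable (dmeas j x) (\<lambda>y. (a y - dmean j a x) * f y + dmean j a x * f y)"
        using oi[of j x] f1[of j x] by simp
      then show ?thesis by (simp add: left_diff_distrib)
    qed
    have "dmean j (\<lambda>y. \<bar>a y * f y\<bar>) x \<le> dmean j (\<lambda>y. \<bar>dmean j a x\<bar> * \<bar>f y\<bar> + \<bar>(a y - dmean j a x) * f y\<bar>) x"
    proof (rule dmean_mono')
      fix y
      have "\<bar>a y\<bar> \<le> \<bar>dmean j a x\<bar> + \<bar>a y - dmean j a x\<bar>" by linarith
      from mult_right_mono[OF this, of "\<bar>f y\<bar>"]
      show "\<bar>a y * f y\<bar> \<le> \<bar>dmean j a x\<bar> * \<bar>f y\<bar> + \<bar>(a y - dmean j a x) * f y\<bar>"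
        by (simp add: abs_mult distrib_right)
    qed (use afi f1 oi in auto)
    also have "\<dots> = \<bar>dmean j a x\<bar> * dmean j (\<lambda>y. \<bar>f y\<bar>) x + dmean j (\<lambda>y. \<bar>(a y - dmean j a x) * f y\<bar>) x"
      using f1 oi by (subst dmean_add) auto
    also have "dmean j (\<lambda>y. \<bar>(a y - dmean j a x) * f y\<bar>) x \<le> (C * b) * (F * 2 powr (real_of_int j * (real CARD('n) / p)))"
    proof -
      have "dmean j (\<lambda>y. \<bar>(a y - dmean j a x) * f y\<bar>) x \<le> C * b * (dmean j (\<lambda>y. \<bar>f y\<bar> powr q) x) powr (1/q)"
        using C(2) ab fD by blast
      also have "\<dots> \<le> (C * b) * (F * 2 powr (real_of_int j * (real CARD('n) / p)))"
        using C(1) a(1) by (intro mult_left_mono fD(4)) auto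
      finally show ?thesis .
    qed
    also have "\<bar>dmean j a x\<bar> * dmean j (\<lambda>y. \<bar>f y\<bar>) x \<le> \<bar>dmean j a x\<bar> * (F * 2 powr (real_of_int j * (real CARD('n) / p)))"
      using morrey_abs_mean_le[OF f, of j x] q by (intro mult_left_mono) auto
    finally have "dmean j (\<lambda>y. \<bar>a y * f y\<bar>) x \<le> (\<bar>dmean j a x\<bar> + C * b) * (F * 2 powr (real_of_int j * (real CARD('n) / p)))"
      by (simp add: distrib_right)
    moreover have "Lloc 1 (\<lambda>y. a y * f y)" unfolding Lloc_iff using afi by auto
    ultimately show ?thesis by simp
  qed
  with C(1) show ?thesis by blast
qed

lemma summable_linear_powr:
  assumes "\<gamma> > 0" shows "summable (\<lambda>k. (A + B * real k) * (2 powr (- real k * \<gamma>)))"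
proof -
  define z where "z = (2::real) powr (-\<gamma>)"
  have z: "0 < z" "z < 1" using assms by (auto simp: z_def powr_less_one)
  have e: "2 powr (- real k * \<gamma>) = z ^ k" for k
    unfolding z_def by (simp add: powr_realpow[symmetric] powr_powr mult.commute)
  have "summable (\<lambda>k. real k * z ^ k)"
  proof -
    have "summable (\<lambda>n. diffs (\<lambda>_. 1::real) n * z ^ n)"
      by (rule termdiff_converges[of z 1]) (use z in \<open>auto intro!: summable_geometric\<close>)
    then have "summable (\<lambda>n. real (Suc n) * z ^ n)" by (simp add: diffs_def)
    then show ?thesis
      by (rule summable_comparison_test'[where N=0]) (use z in \<open>auto simp: abs_mult intro!: mult_right_mono\<close>)
  qed
  then have "summable (\<lambda>k. A * z ^ k + B * (real k * z ^ k))"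
    using z by (intro summable_add summable_mult summable_geometric) auto
  then show ?thesis unfolding e by (simp add: algebra_simps)
qed

text \<open>Over cubes of level -k the mean of \<open>a\<close> grows at most linearly in k, whereas
  the weight 2^(k \<alpha>) times the Morrey bound decays like 2^(-k \<gamma>) with \<gamma> = n/p -
  \<alpha> > 0.\<close>

lemma frac_int_bmo_mult:
  fixes a f :: "real^'n::finite \<Rightarrow> real"
  assumes \<alpha>: "0 < \<alpha>" "\<alpha> < real CARD('n) / p" and q: "1 < q" and ab: "bmo_le a b" and f: "morrey_le p q f F"
  shows "Lloc_conv 1 (frac_partial \<alpha> (\<lambda>y. a y * f y)) (frac_int \<alpha> (\<lambda>y. a y * f y))"
proof (rule frac_int_exists[OF \<alpha>(1)])
  obtain C where C: "C > 0" "\<forall>(a::real^'n \<Rightarrow> real) b f F j x. bmo_le a b \<longrightarrow> morrey_le p q f F \<longrightarrow>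
     Lloc 1 (\<lambda>y. a y * f y) \<and>
     dmean j (\<lambda>y. \<bar>a y * f y\<bar>) x \<le> (\<bar>dmean j a x\<bar> + C * b) * (F * 2 powr (real_of_int j * (real CARD('n) / p)))"
    using bmo_morrey_mean[OF q, where 'n='n and p=p] by blast
  show "Lloc 1 (\<lambda>y. a y * f y)" using C(2) ab f by blast
  note a = bmo_leD[OF ab] and fD = morrey_leD[OF f]
  define \<gamma> where "\<gamma> = real CARD('n) / p - \<alpha>"
  have g: "\<gamma> > 0" using \<alpha> by (simp add: \<gamma>_def)
  fix x
  define A where "A = (\<bar>dmean 0 a x\<bar> + C * b) * F"
  define B where "B = 2 powr real CARD('n) * b * F"
  show "summable (\<lambda>k. 2 powr (real k * \<alpha>) * dmean (- int k) (\<lambda>y. \<bar>a y * f y\<bar>) x)"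
  proof (rule summable_comparison_test'[OF summable_linear_powr[OF g, of A B], where N=0])
    fix k :: nat
    have "\<bar>dmean (- int k + int k) a x - dmean (- int k) a x\<bar> \<le> real k * (2 powr real CARD('n) * b)"
      by (rule bmo_steps[OF ab])
    then have "\<bar>dmean (- int k) a x\<bar> \<le> \<bar>dmean 0 a x\<bar> + real k * (2 powr real CARD('n) * b)" by simp
    then have "\<bar>dmean (- int k) a x\<bar> + C * b \<le> \<bar>dmean 0 a x\<bar> + real k * (2 powr real CARD('n) * b) + C * b" by simp
    then have "(\<bar>dmean (- int k) a x\<bar> + C * b) * (F * 2 powr (real_of_int (- int k) * (real CARD('n) / p))) \<le> (\<bar>dmean 0 a x\<bar> + real k * (2 powr real CARD('n) * b) + C * b) * (F * 2 powr (real_of_int (- int k) * (real CARD('n) / p)))"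
      using fD(1) by (intro mult_right_mono) auto
    also have "\<dots> = (A + B * real k) * 2 powr (real_of_int (- int k) * (real CARD('n) / p))"
      by (simp add: A_def B_def algebra_simps)
    finally have "dmean (- int k) (\<lambda>y. \<bar>a y * f y\<bar>) x \<le> (A + B * real k) * 2 powr (real_of_int (- int k) * (real CARD('n) / p))"
      using C(2) ab f order_trans by blast
    then have "2 powr (real k * \<alpha>) * dmean (- int k) (\<lambda>y. \<bar>a y * f y\<bar>) x \<le> 2 powr (real k * \<alpha>) * ((A + B * real k) * 2 powr (real_of_int (- int k) * (real CARD('n) / p)))"
      by (intro mult_left_mono) auto
    also have "\<dots> = (A + B * real k) * 2 powr (real k * \<alpha> + real_of_int (- int k) * (real CARD('n) / p))"
      unfolding powr_add by simp
    also have "real k * \<alpha> + real_of_int (- int k) * (real CARD('n) / p) = - real k * \<gamma>" by (simp add: \<gamma>_def algebra_simps)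
    finally show "norm (2 powr (real k * \<alpha>) * dmean (- int k) (\<lambda>y. \<bar>a y * f y\<bar>) x) \<le> (A + B * real k) * 2 powr (- real k * \<gamma>)"
      by (simp add: dmean_nonneg)
  qed
qed

text \<open>With this instance the fractional integral of \<open>f\<close> itself becomes the case a
  = 1 of \<open>frac_int_bmo_mult\<close>.\<close>

lemma bmo_le_one: "bmo_le (\<lambda>_::real^'n::finite. 1) 1"
  by (simp add: bmo_le_def)

lemma frac_int_morrey:
  fixes f :: "real^'n::finite \<Rightarrow> real"
  assumes "0 < \<alpha>" "\<alpha> < real CARD('n) / p" "1 < q" "morrey_le p q f F"
  shows "Lloc_conv 1 (frac_partial \<alpha> f) (frac_int \<alpha> f)"
  using frac_int_bmo_mult[OF assms(1-3) bmo_le_one assms(4)] by simp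

lemma frac_partial_commutator:
  fixes a f :: "real^'n::finite \<Rightarrow> real"
  assumes f: "\<And>j x. integrable (dmeas j x) f" and af: "\<And>j x. integrable (dmeas j x) (\<lambda>y. a y * f y)"
  shows "a y * frac_partial \<alpha> f M y - frac_partial \<alpha> (\<lambda>y. a y * f y) M y
    = (\<Sum>j\<in>{- int M..int M}. 2 powr (- real_of_int j * \<alpha>) * (dmean (j+1) (\<lambda>z. (a y - a z) * f z) y - dmean j (\<lambda>z. (a y - a z) * f z) y))"
proof -
  \<comment> \<open>At a fixed point y the number \<open>a y\<close> is a constant and moves inside
    the averages.\<close>
  have e: "dmean i (\<lambda>z. (a y - a z) * f z) y = a y * dmean i f y - dmean i (\<lambda>z. a z * f z) y" for i
    unfolding left_diff_distrib using f af by (subst dmean_diff) auto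
  then show ?thesis
    unfolding frac_partial_eq[OF f] frac_partial_eq[OF af] sum_distrib_left sum_subtractf[symmetric]
    by (intro sum.cong refl, unfold e) (simp add: algebra_simps)
qed

text \<open>The average at level j+1 carries the weight of level j, which is 2^\<alpha> times its
  own; reindexing collects the factor 2^\<alpha> + 1 and the extra level M + 1.\<close>

lemma frac_partial_commutator_bound:
  fixes a f :: "real^'n::finite \<Rightarrow> real"
  assumes f: "\<And>j x. integrable (dmeas j x) f" and af: "\<And>j x. integrable (dmeas j x) (\<lambda>y. a y * f y)"
    and [measurable]: "a \<in> borel_measurable borel"
  shows "\<bar>a y * frac_partial \<alpha> f M y - frac_partial \<alpha> (\<lambda>y. a y * f y) M y\<bar>
    \<le> (2 powr \<alpha> + 1) * (\<Sum>i\<in>{- int M..int M + 1}. 2 powr (- real_of_int i * \<alpha>) * dmean i (\<lambda>z. \<bar>a y - a z\<bar> * \<bar>f z\<bar>) y)"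
proof -
  define T where "T i = dmean i (\<lambda>z. \<bar>a y - a z\<bar> * \<bar>f z\<bar>) y" for i
  have T0: "T i \<ge> 0" for i unfolding T_def by (rule dmean_nonneg) simp
  have le: "\<bar>dmean i (\<lambda>z. (a y - a z) * f z) y\<bar> \<le> T i" for i
    using dmean_abs_le[of i "\<lambda>z. (a y - a z) * f z" y] by (simp add: T_def abs_mult)
  have "\<bar>a y * frac_partial \<alpha> f M y - frac_partial \<alpha> (\<lambda>y. a y * f y) M y\<bar>
    \<le> (\<Sum>j\<in>{- int M..int M}. 2 powr (- real_of_int j * \<alpha>) * (T (j+1) + T j))"
    unfolding frac_partial_commutator[OF f af]
  proof (rule order_trans[OF sum_abs sum_mono])
    fix j
    show "\<bar>2 powr (- real_of_int j * \<alpha>) * (dmean (j+1) (\<lambda>z. (a y - a z) * f z) y - dmean j (\<lambda>z. (a y - a z) * f z) y)\<bar> \<le> 2 powr (- real_of_int j * \<alpha>) * (T (j+1) + T j)"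
      unfolding abs_mult using le[of "j+1"] le[of j] by (auto intro!: mult_left_mono)
  qed
  also have "\<dots> = 2 powr \<alpha> * (\<Sum>j\<in>{- int M..int M}. 2 powr (- real_of_int (j+1) * \<alpha>) * T (j+1)) + (\<Sum>j\<in>{- int M..int M}. 2 powr (- real_of_int j * \<alpha>) * T j)"
  proof -
    have "2 powr (- real_of_int j * \<alpha>) = 2 powr \<alpha> * 2 powr (- real_of_int (j+1) * \<alpha>)" for j
      unfolding powr_add[symmetric] by (simp add: algebra_simps)
    then have "2 powr (- real_of_int j * \<alpha>) * (T (j+1) + T j) = 2 powr \<alpha> * (2 powr (- real_of_int (j+1) * \<alpha>) * T (j+1)) + 2 powr (- real_of_int j * \<alpha>) * T j" for j
      by (metis distrib_left mult.assoc)
    then show ?thesis by (simp only: sum.distrib sum_distrib_left)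
  qed
  also have "(\<Sum>j\<in>{- int M..int M}. 2 powr (- real_of_int (j+1) * \<alpha>) * T (j+1)) = (\<Sum>i\<in>{- int M + 1..int M + 1}. 2 powr (- real_of_int i * \<alpha>) * T i)"
    by (rule sum.reindex_bij_witness[of _ "\<lambda>i. i - 1" "\<lambda>j. j + 1"]) auto
  also have "2 powr \<alpha> * (\<Sum>i\<in>{- int M + 1..int M + 1}. 2 powr (- real_of_int i * \<alpha>) * T i) + (\<Sum>j\<in>{- int M..int M}. 2 powr (- real_of_int j * \<alpha>) * T j)
    \<le> 2 powr \<alpha> * (\<Sum>i\<in>{- int M..int M + 1}. 2 powr (- real_of_int i * \<alpha>) * T i) + (\<Sum>i\<in>{- int M..int M + 1}. 2 powr (- real_of_int i * \<alpha>) * T i)"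
    using T0 by (intro add_mono mult_left_mono sum_mono2) auto
  finally show ?thesis unfolding T_def by (simp add: distrib_right)
qed

text \<open>The pointwise expression \<open>frac_commutator\<close> is shown to lie in the target
  space first. That provides the integrability and the decay needed for its Haar expansion, which
  defines \<open>commutator\<close>, to converge back to it.\<close>

lemma commutator_upper:
  assumes \<alpha>: "0 < \<alpha>" and q: "1 < q" "q \<le> p" and st: "1 < t" "t \<le> s"
    and ts: "t / s = q / p" and s: "1 / s = 1 / p - \<alpha> / real CARD('n::finite)"
  shows "\<exists>C>0. \<forall>(a::real^'n \<Rightarrow> real) b f F. bmo_le a b \<longrightarrow> morrey_le p q f F \<longrightarrow>
     morrey_le s t (frac_commutator a \<alpha> f) (C * b * F) \<and>
     Lloc_conv q (comm_partial a \<alpha> f) (frac_commutator a \<alpha> f)"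
proof -
  define n where "n = real CARD('n)"
  have n: "n > 0" by (simp add: n_def)
  have s0: "s > 0" and p0: "p > 0" and t1: "t \<ge> 1" using st q by auto
  have bs: "n / p - \<alpha> = n / s" using s n unfolding n_def[symmetric] by (simp add: field_simps)
  have ap: "\<alpha> < real CARD('n) / p" using bs n s0 unfolding n_def[symmetric] by (smt (verit) divide_pos_pos)
  \<comment> \<open>The estimates give local L^t integrability, while the Haar sums have to converge
    locally in L^q.\<close>
  have qt: "q \<le> t"
  proof -
    have "1 / s \<le> 1 / p" using s \<alpha> by simp
    then have "p \<le> s" using s0 p0 by (simp add: field_simps)
    then have "q * p \<le> q * s" using q by simp
    also have "q * s = t * p" using ts s0 p0 by (simp add: field_simps)
    finally show ?thesis using p0 by simp
  qed
  obtain C0 where C0: "C0 > 0" "\<forall>(a::real^'n \<Rightarrow> real) b f F j x J H. bmo_le a b \<longrightarrow> morrey_le p q f F \<longrightarrow> finite J \<longrightarrow> H \<in> borel_measurable borel \<longrightarrow>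
     (\<forall>y\<in>dcube j x. \<bar>H y\<bar> \<le> (\<Sum>i\<in>J. 2 powr (- real_of_int i * \<alpha>) * dmean i (\<lambda>z. \<bar>a y - a z\<bar> * \<bar>f z\<bar>) y)) \<longrightarrow>
     integrable (dmeas j x) (\<lambda>y. \<bar>H y\<bar> powr t) \<and>
     dmean j (\<lambda>y. \<bar>H y\<bar> powr t) x \<le> (C0 * b * F * 2 powr (real_of_int j * (real CARD('n) / s))) powr t"
    using commutator_mean_bound[OF \<alpha> q st(1) s0 ts s] by blast
  define D where "D = 2 powr \<alpha> + 1"
  have D: "D > 0" by (simp add: D_def add_pos_pos)
  define C where "C = D * C0"
  have C: "C > 0" using C0 D by (simp add: C_def)
  have main: "morrey_le s t (frac_commutator a \<alpha> f) (C * b * F) \<and>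
     Lloc_conv q (comm_partial a \<alpha> f) (frac_commutator a \<alpha> f)"
    if ab: "bmo_le a b" and f: "morrey_le p q f F" for a f :: "real^'n \<Rightarrow> real" and b F
  proof -
    note a = bmo_leD[OF ab] and fD = morrey_leD[OF f]
    note [measurable] = a(2) fD(2)
    define g where "g y = a y * frac_int \<alpha> f y - frac_int \<alpha> (\<lambda>y. a y * f y) y" for y
    define P where "P = frac_partial \<alpha> f"
    define P' where "P' = frac_partial \<alpha> (\<lambda>y. a y * f y)"
    have cI: "Lloc_conv 1 P (frac_int \<alpha> f)" unfolding P_def by (rule frac_int_morrey[OF \<alpha> ap q(1) f])
    have cI': "Lloc_conv 1 P' (frac_int \<alpha> (\<lambda>y. a y * f y))" unfolding P'_def by (rule frac_int_bmo_mult[OF \<alpha> ap q(1) ab f])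
    have fi: "integrable (dmeas j x) f" for j x
      by (rule powr_dmean_le(1)[OF _ _ fD(3)]) (use q in auto)
    have afi: "integrable (dmeas j x) (\<lambda>y. a y * f y)" for j x
      using bmo_morrey_mean[OF q(1), where 'n='n and p=p] ab f Lloc1_integrable by blast
    have [measurable]: "P M \<in> borel_measurable borel" "P' M \<in> borel_measurable borel"
      "frac_int \<alpha> f \<in> borel_measurable borel" "frac_int \<alpha> (\<lambda>y. a y * f y) \<in> borel_measurable borel" for M
      using Lloc_convD(1,2)[OF cI] Lloc_convD(1,2)[OF cI'] LlocD(1) by auto
    have [measurable]: "g \<in> borel_measurable borel" unfolding g_def by measurable
    have loc: "integrable (dmeas j x) (\<lambda>y. \<bar>g y\<bar> powr t) \<and> dmean j (\<lambda>y. \<bar>g y\<bar> powr t) x \<le> (C * b * F * 2 powr (real_of_int j * (n / s))) powr t" for j x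
    proof -
      obtain \<sigma> :: "nat \<Rightarrow> nat" where \<sigma>: "AE y in dmeas j x. (\<lambda>k. P (\<sigma> k) y) \<longlonglongrightarrow> frac_int \<alpha> f y \<and> (\<lambda>k. P' (\<sigma> k) y) \<longlonglongrightarrow> frac_int \<alpha> (\<lambda>y. a y * f y) y"
        using Lloc_conv_AE_subseq2[OF cI cI'] by blast
      \<comment> \<open>Division by \<open>D\<close> brings the pointwise bound to the form with
        constant 1 expected by \<open>commutator_mean_bound\<close>.\<close>
      define H where "H k y = (a y * P (\<sigma> k) y - P' (\<sigma> k) y) / D" for k y
      have [measurable]: "H k \<in> borel_measurable borel" for k unfolding H_def by measurable
      have Hb: "\<bar>H k y\<bar> \<le> (\<Sum>i\<in>{- int (\<sigma> k)..int (\<sigma> k) + 1}. 2 powr (- real_of_int i * \<alpha>) * dmean i (\<lambda>z. \<bar>a y - a z\<bar> * \<bar>f z\<bar>) y)" for k y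
        using frac_partial_commutator_bound[OF fi afi a(2), of y \<alpha> "\<sigma> k"] D
        unfolding H_def P_def P'_def D_def[symmetric] abs_divide by (simp add: pos_divide_le_eq mult.commute)
      have H: "integrable (dmeas j x) (\<lambda>y. \<bar>H k y\<bar> powr t) \<and>
         dmean j (\<lambda>y. \<bar>H k y\<bar> powr t) x \<le> (C0 * b * F * 2 powr (real_of_int j * (real CARD('n) / s))) powr t" for k
        by (rule C0(2)[rule_format, OF ab f, of "{- int (\<sigma> k)..int (\<sigma> k) + 1}"]) (use Hb in auto)
      have AE: "AE y in dmeas j x. (\<lambda>k. \<bar>H k y\<bar> powr t) \<longlonglongrightarrow> \<bar>g y / D\<bar> powr t"
        using \<sigma>
      proof eventually_elim
        fix y assume "(\<lambda>k. P (\<sigma> k) y) \<longlonglongrightarrow> frac_int \<alpha> f y \<and> (\<lambda>k. P' (\<sigma> k) y) \<longlonglongrightarrow> frac_int \<alpha> (\<lambda>y. a y * f y) y"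
        then show "(\<lambda>k. \<bar>H k y\<bar> powr t) \<longlonglongrightarrow> \<bar>g y / D\<bar> powr t"
          unfolding H_def g_def using D t1 by (intro tendsto_abs_powr tendsto_intros) auto
      qed
      have F1: "integrable (dmeas j x) (\<lambda>y. \<bar>g y / D\<bar> powr t)"
        and F2: "(\<integral>y. \<bar>g y / D\<bar> powr t \<partial>dmeas j x) \<le> (C0 * b * F * 2 powr (real_of_int j * (n / s))) powr t"
        using Fatou_real[OF _ _ _ _ AE, of "(C0 * b * F * 2 powr (real_of_int j * (n / s))) powr t"] H unfolding dmean_def n_def by auto
      have e: "\<bar>g y\<bar> powr t = D powr t * \<bar>g y / D\<bar> powr t" for y
        using D by (simp add: abs_divide powr_divide)
      have "dmean j (\<lambda>y. \<bar>g y\<bar> powr t) x \<le> D powr t * (C0 * b * F * 2 powr (real_of_int j * (n / s))) powr t"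
        unfolding e dmean_cmult using F2 by (intro mult_left_mono) (auto simp: dmean_def)
      also have "\<dots> = (C * b * F * 2 powr (real_of_int j * (n / s))) powr t"
        using D C0 a(1) fD(1) by (simp add: C_def mult.assoc flip: powr_mult)
      finally show ?thesis unfolding e[abs_def] using F1 by (auto simp flip: e)
    qed
    have pos: "C * b * F > 0" using C a(1) fD(1) by simp
    have gM: "morrey_le s t g (C * b * F)"
      unfolding morrey_le_def
    proof (intro conjI allI)
      fix j x
      have "(dmean j (\<lambda>y. \<bar>g y\<bar> powr t) x) powr (1/t) \<le> ((C * b * F * 2 powr (real_of_int j * (n / s))) powr t) powr (1/t)"
        using loc[of j x] t1 by (intro powr_mono2 dmean_nonneg) auto
      then show "(dmean j (\<lambda>y. \<bar>g y\<bar> powr t) x) powr (1/t) \<le> C * b * F * 2 powr (real_of_int j * (real CARD('n) / s))"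
        using t1 pos by (simp add: powr_powr n_def)
    qed (use loc pos in auto)
    have gi: "integrable (dmeas j x) g" for j x
      by (rule powr_dmean_le(1)[OF t1]) (use loc in auto)
    have gq: "integrable (dmeas j x) (\<lambda>y. \<bar>g y\<bar> powr q)" for j x
      by (rule integrable_powr_mono[of _ _ _ t]) (use loc qt q in auto)
    have cp: "comm_partial a \<alpha> f M y = dmean (int M + 1) g y - dmean (- int M) g y" for M y
      using comm_partial_eq[of a \<alpha> f M y] gi by (simp add: g_def[abs_def])
    have "Lloc_conv q (comm_partial a \<alpha> f) g"
    proof (rule Lloc_convI)
      show "Lloc q g" unfolding Lloc_iff using gq by auto
      show "Lloc q (comm_partial a \<alpha> f M)" for M
      proof (rule Lloc_dlevel[of "int M + 1"])
        show "dlevel (int M + 1) (comm_partial a \<alpha> f M)"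
          unfolding cp[abs_def] by (rule dlevel_comp2[OF dlevel_dmean dlevel_dmean_le, where h="(-)"]) simp
      qed
      fix x
      have sh: "(\<lambda>M. dmean 0 (\<lambda>y. \<bar>dmean (int (Suc M)) g y - g y\<bar> powr q) x) \<longlonglongrightarrow> 0"
        using dmean_tendsto_Lq[of q g 0 x] gq q by (intro LIMSEQ_Suc) auto
      \<comment> \<open>The Haar sums miss the average over the cube of level -M. The Morrey bound
        of \<open>g\<close> makes it vanish in the limit because n/s > 0.\<close>
      have far: "(\<lambda>M. \<bar>dmean (- int M) g x\<bar> powr q) \<longlonglongrightarrow> 0"
      proof -
        have "(\<lambda>M. dmean (- int M) g x) \<longlonglongrightarrow> 0"
        proof (rule Lim_null_comparison)
          have ns: "n / s > 0" using n s0 by simp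
          have "\<bar>dmean (- int M) g x\<bar> \<le> C * b * F * (2 powr (- (n / s))) ^ M" for M
          proof -
            have "\<bar>dmean (- int M) g x\<bar> \<le> C * b * F * 2 powr (real_of_int (- int M) * (n / s))"
              unfolding n_def by (rule order_trans[OF dmean_abs_le morrey_abs_mean_le[OF gM t1]])
            also have "2 powr (real_of_int (- int M) * (n / s)) = (2 powr (- (n / s))) ^ M"
              by (simp add: powr_realpow[symmetric] powr_powr mult.commute)
            finally show ?thesis .
          qed
          then show "\<forall>\<^sub>F M in sequentially. norm (dmean (- int M) g x) \<le> C * b * F * (2 powr (- (n / s))) ^ M"
            by simp
          have "(\<lambda>M. C * b * F * (2 powr (- (n / s))) ^ M) \<longlonglongrightarrow> C * b * F * 0"
            using ns by (intro tendsto_mult tendsto_const LIMSEQ_realpow_zero) (auto simp: powr_less_one)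
          then show "(\<lambda>M. C * b * F * (2 powr (- (n / s))) ^ M) \<longlonglongrightarrow> 0" by simp
        qed
        then have "(\<lambda>M. \<bar>dmean (- int M) g x\<bar> powr q) \<longlonglongrightarrow> \<bar>0\<bar> powr q" using q by (intro tendsto_abs_powr) auto
        then show ?thesis by simp
      qed
      show "(\<lambda>M. dmean 0 (\<lambda>y. \<bar>comm_partial a \<alpha> f M y - g y\<bar> powr q) x) \<longlonglongrightarrow> 0"
      proof (rule tendsto_sandwich[OF _ _ tendsto_const])
        have "(\<lambda>M. 3 powr q * (dmean 0 (\<lambda>y. \<bar>dmean (int (Suc M)) g y - g y\<bar> powr q) x + \<bar>dmean (- int M) g x\<bar> powr q)) \<longlonglongrightarrow> 3 powr q * (0 + 0)"
          by (intro tendsto_intros sh far)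
        then show "(\<lambda>M. 3 powr q * (dmean 0 (\<lambda>y. \<bar>dmean (int (Suc M)) g y - g y\<bar> powr q) x + \<bar>dmean (- int M) g x\<bar> powr q)) \<longlonglongrightarrow> 0"
          by simp
        have di: "integrable (dmeas 0 x) (\<lambda>y. \<bar>dmean i g y - g y\<bar> powr q)" for i
        proof -
          have "integrable (dmeas 0 x) (\<lambda>y. \<bar>dmean i g y\<bar> powr q)"
            by (rule dlevel_integrable[OF dlevel_comp[OF dlevel_dmean]])
          then show ?thesis using integrable_powr_add[of q "dmean i g" "\<lambda>y. - g y" 0 x] gq q by simp
        qed
        have "dmean 0 (\<lambda>y. \<bar>comm_partial a \<alpha> f M y - g y\<bar> powr q) x \<le> 3 powr q * (dmean 0 (\<lambda>y. \<bar>dmean (int (Suc M)) g y - g y\<bar> powr q) x + \<bar>dmean (- int M) g x\<bar> powr q)" for M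
        proof -
          have "dmean 0 (\<lambda>y. \<bar>comm_partial a \<alpha> f M y - g y\<bar> powr q) x \<le> dmean 0 (\<lambda>y. 3 powr q * (\<bar>dmean (int (Suc M)) g y - g y\<bar> powr q + \<bar>dmean (- int M) g x\<bar> powr q)) x"
          proof (rule dmean_mono)
            fix y assume y: "y \<in> dcube 0 x"
            have e1: "dmean (- int M) g y = dmean (- int M) g x"
              using dlevelD[OF dlevel_dmean_le[of "- int M" 0 g] y] by simp
            have e2: "int M + 1 = int (Suc M)" by simp
            have "\<bar>comm_partial a \<alpha> f M y - g y\<bar> powr q \<le> (\<bar>dmean (int (Suc M)) g y - g y\<bar> + \<bar>dmean (- int M) g x\<bar> + 0) powr q"
              unfolding cp e1 e2 using q by (intro powr_mono2) auto
            also have "\<dots> \<le> 3 powr q * (\<bar>dmean (int (Suc M)) g y - g y\<bar> powr q + \<bar>dmean (- int M) g x\<bar> powr q + 0 powr q)"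
              by (rule add3_powr_le) (use q in auto)
            finally show "\<bar>comm_partial a \<alpha> f M y - g y\<bar> powr q \<le> 3 powr q * (\<bar>dmean (int (Suc M)) g y - g y\<bar> powr q + \<bar>dmean (- int M) g x\<bar> powr q)"
              by simp
          qed (use di in \<open>auto simp: cp[abs_def]\<close>)
          then show ?thesis using di by (simp add: dmean_add)
        qed
        then show "\<forall>\<^sub>F M in sequentially. dmean 0 (\<lambda>y. \<bar>comm_partial a \<alpha> f M y - g y\<bar> powr q) x \<le> 3 powr q * (dmean 0 (\<lambda>y. \<bar>dmean (int (Suc M)) g y - g y\<bar> powr q) x + \<bar>dmean (- int M) g x\<bar> powr q)"
          by (intro always_eventually allI)
      qed (auto intro!: always_eventually dmean_nonneg)
    qed (use q in auto)
    with gM show ?thesis unfolding g_def[abs_def] by simp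
  qed
  show ?thesis using C main by (intro exI[of _ C] conjI allI impI) auto
qed

section \<open>The lower bound\<close>

text \<open>Abel summation. For nonnegative averages \<open>d\<close> the signed differences become
  a sum of nonnegative terms, since 2^\<alpha> > 1, plus two boundary terms; such a sum can be
  bounded below by a single term.\<close>

lemma sum_by_parts_dyadic:
  fixes d :: "int \<Rightarrow> real"
  shows "(\<Sum>i\<in>{- int M..int M}. 2 powr (- real_of_int i * \<alpha>) * (d (i+1) - d i))
    = (2 powr \<alpha> - 1) * (\<Sum>i\<in>{- int M..int M}. 2 powr (- real_of_int i * \<alpha>) * d i)
      + 2 powr (- real M * \<alpha>) * d (int M + 1) - 2 powr ((real M + 1) * \<alpha>) * d (- int M)"
proof (induction M)
  case 0
  show ?case by (simp add: algebra_simps)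
next
  case (Suc M)
  define P where "P = 2 powr \<alpha>"
  define u where "u = 2 powr (- (real M + 1) * \<alpha>)"
  define w where "w = 2 powr ((real M + 1) * \<alpha>)"
  have eq: "{- int (Suc M)..int (Suc M)} = insert (- int M - 1) (insert (int M + 1) {- int M..int M})" by auto
  have S: "(\<Sum>i\<in>{- int (Suc M)..int (Suc M)}. h i) = h (- int M - 1) + (h (int M + 1) + (\<Sum>i\<in>{- int M..int M}. h i))" for h :: "int \<Rightarrow> real"
    unfolding eq by (subst sum.insert; simp)+
  have e1: "2 powr (- real_of_int (- int M - 1) * \<alpha>) = w" by (simp add: w_def algebra_simps)
  have e2: "2 powr (- real_of_int (int M + 1) * \<alpha>) = u" by (simp add: u_def algebra_simps)
  have e3: "2 powr (- real M * \<alpha>) = P * u" unfolding P_def u_def powr_add[symmetric] by (simp add: algebra_simps)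
  have e4: "2 powr ((real (Suc M) + 1) * \<alpha>) = P * w" unfolding P_def w_def powr_add[symmetric] by (simp add: algebra_simps)
  have e5: "2 powr (- real (Suc M) * \<alpha>) = u" by (simp add: u_def algebra_simps)
  have e6: "- int M - 1 + 1 = - int M" "int (Suc M) = int M + 1" "- (int M + 1) = - int M - 1" by auto
  show ?case
    unfolding S Suc e1 e2 e3 e4 e5 w_def[symmetric] P_def[symmetric] unfolding e6
    by (simp add: algebra_simps)
qed

lemma dmean_indicator_far:
  fixes x y :: "real^'n::finite"
  assumes "i \<le> j" "x \<in> dcube i y" and [measurable]: "h \<in> borel_measurable borel"
  shows "dmean i (\<lambda>z. indicator (dcube j x) z * h z) y = 2 powr (real_of_int (i - j) * real CARD('n)) * dmean j h x"
  by (rule dmean_indicator_subcube) (use dcube_mono[OF assms(1), of x] dcube_eq[OF assms(2)] in auto)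

lemma dmean_indicator_disjoint:
  assumes "dcube j x \<inter> dcube i y = {}" and [measurable]: "h \<in> borel_measurable borel"
  shows "dmean i (\<lambda>z. indicator (dcube j x) z * h z) y = 0"
proof -
  have "dmean i (\<lambda>z. indicator (dcube j x) z * h z) y = dmean i (\<lambda>z. 0) y"
    by (rule dmean_cong) (use assms in \<open>auto simp: indicator_def\<close>)
  then show ?thesis by simp
qed

lemma sibling_cube:
  fixes x0 :: "real^'n::finite"
  shows "\<exists>x1. x1 \<in> dcube (j-1) x0 \<and> x1 \<notin> dcube j x0"
proof (rule ccontr)
  assume "\<not> ?thesis"
  then have "dcube j x0 = dcube (j-1) x0" using dcube_mono[of "j-1" j x0] by auto
  then have "measure lborel (dcube j x0) = measure lborel (dcube (j-1) x0)" by simp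
  then show False unfolding measure_dcube by (simp add: powr_inj algebra_simps)
qed

text \<open>Test cubes not larger than the given one are harmless because the bound increases with
  the level. For a larger test cube containing it the comparison comes down to n/p <= n/q, and for a
  disjoint one the mean is 0.\<close>

lemma morrey_le_indicator:
  fixes x1 :: "real^'n::finite"
  assumes q: "0 < q" "q \<le> p"
  shows "morrey_le p q (\<lambda>y. 2 powr (real_of_int j * (real CARD('n) / p)) * indicator (dcube j x1) y) 1"
proof -
  define n where "n = real CARD('n)"
  define v where "v = 2 powr (real_of_int j * (n / p))"
  define f where "f y = v * indicator (dcube j x1) y" for y
  have n: "n > 0" by (simp add: n_def)
  have p: "p > 0" using q by simp
  have v: "v > 0" by (simp add: v_def)
  have [measurable]: "f \<in> borel_measurable borel" unfolding f_def by measurable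
  have fq: "\<bar>f y\<bar> powr q = v powr q * (indicator (dcube j x1) y * 1)" for y
    using q v by (auto simp: f_def indicator_def)
  have lf: "dlevel j f" unfolding f_def by (rule dlevel_comp[OF dlevel_indicator])
  have "integrable (dmeas i x) (\<lambda>y. \<bar>f y\<bar> powr q)" for i x
    by (rule dlevel_integrable[OF dlevel_comp[OF lf]])
  moreover have "(dmean i (\<lambda>y. \<bar>f y\<bar> powr q) x) powr (1/q) \<le> 2 powr (real_of_int i * (n / p))" for i x
  proof -
    define D where "D = dmean i (\<lambda>y. indicator (dcube j x1) y * 1) x"
    have D0: "D \<ge> 0" unfolding D_def by (rule dmean_nonneg) simp
    have e: "(dmean i (\<lambda>y. \<bar>f y\<bar> powr q) x) powr (1/q) = v * D powr (1/q)"
      unfolding fq dmean_cmult D_def[symmetric] using v D0 q by (simp add: powr_mult powr_powr)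
    consider "j \<le> i" | "i < j" "x1 \<in> dcube i x" | "i < j" "x1 \<notin> dcube i x" by linarith
    then show ?thesis
    proof cases
      case 1
      have "D \<le> dmean i (\<lambda>y. 1) x" unfolding D_def by (rule dmean_mono) (auto simp: indicator_def)
      then have "D powr (1/q) \<le> 1 powr (1/q)" using D0 q by (intro powr_mono2) auto
      then have "v * D powr (1/q) \<le> v" using v by simp
      also have "v \<le> 2 powr (real_of_int i * (n / p))" unfolding v_def using 1 n p by (intro powr_mono mult_right_mono) auto
      finally show ?thesis unfolding e .
    next
      case 2
      have "D = 2 powr (real_of_int (i - j) * n)"
        unfolding D_def n_def using dmean_indicator_far[of i j x1 x "\<lambda>_. 1"] 2 by simp
      then have "v * D powr (1/q) = 2 powr (real_of_int j * (n / p) + real_of_int (i - j) * (n / q))"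
        unfolding v_def powr_add by (simp add: powr_powr)
      also have "\<dots> \<le> 2 powr (real_of_int i * (n / p))"
      proof (rule powr_mono)
        \<comment> \<open>Since i - j is negative, multiplication by it reverses this inequality in
          the required direction.\<close>
        have "n / p \<le> n / q" using q n by (simp add: frac_le)
        then have "real_of_int (i - j) * (n / q) \<le> real_of_int (i - j) * (n / p)"
          using 2 by (intro mult_left_mono_neg) auto
        then show "real_of_int j * (n / p) + real_of_int (i - j) * (n / q) \<le> real_of_int i * (n / p)"
          by (simp add: algebra_simps)
      qed simp
      finally show ?thesis unfolding e .
    next
      case 3
      have "dcube j x1 \<inter> dcube i x = {}"
        using dcube_disjoint[OF 3(2)] dcube_mono[of i j x1] 3(1) by auto
      then have "D = 0" unfolding D_def by (rule dmean_indicator_disjoint) simp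
      then show ?thesis unfolding e by simp
    qed
  qed
  ultimately have "morrey_le p q f 1" unfolding morrey_le_def n_def by auto
  then show ?thesis unfolding f_def[abs_def] v_def n_def .
qed

text \<open>On a cube, the commutator applied to the normalised indicator of a cube with the same parent
  is the function \<open>a\<close> minus a constant, up to a positive factor: all dyadic cubes that meet
  both contain both.\<close>
lemma commutator_indicator:
  fixes x0 x1 :: "real^'n::finite" and a :: "real^'n \<Rightarrow> real"
  assumes \<alpha>: "0 < \<alpha>" "\<alpha> < real CARD('n) / p" and p: "1 < q" "q \<le> p" and ab: "bmo_le a b"
    and x1: "x1 \<in> dcube (j-1) x0" "x1 \<notin> dcube j x0"
    and f_eq: "f = (\<lambda>y. 2 powr (real_of_int j * (real CARD('n) / p)) * indicator (dcube j x1) y)"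
  shows "AE y in dmeas j x0. (2 powr \<alpha> - 1) * 2 powr (\<alpha> - real CARD('n)) * 2 powr (real_of_int j * (real CARD('n) / p - \<alpha>))
     * \<bar>a y - dmean j a x1\<bar> \<le> \<bar>a y * frac_int \<alpha> f y - frac_int \<alpha> (\<lambda>y. a y * f y) y\<bar>"
proof -
  define n where "n = real CARD('n)"
  define v where "v = 2 powr (real_of_int j * (n / p))"
  define m where "m = dmean j a x1"
  \<comment> \<open>\<open>d i\<close> is the average of \<open>f\<close> at level i, the same at
    every point of the cube of \<open>x0\<close>: for i >= j the averaging cube misses the support
    of \<open>f\<close>, for i < j it contains it.\<close>
  define d where "d i = (if i < j then v * 2 powr (real_of_int (i - j) * n) else 0)" for i
  define \<kappa> where "\<kappa> M = (\<Sum>i\<in>{- int M..int M}. 2 powr (- real_of_int i * \<alpha>) * (d (i+1) - d i))" for M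
  \<comment> \<open>This is the term of level j - 1, the common parent, in the sum produced by
    \<open>sum_by_parts_dyadic\<close>.\<close>
  define c where "c = (2 powr \<alpha> - 1) * 2 powr (\<alpha> - n) * 2 powr (real_of_int j * (n / p - \<alpha>))"
  note a = bmo_leD[OF ab]
  note [measurable] = a(2)
  have p1: "p \<ge> 1" using p by simp
  have n: "n > 0" by (simp add: n_def)
  have an: "\<alpha> < n"
  proof -
    have "n / p \<le> n / 1" using p1 n by (intro divide_left_mono) auto
    then show ?thesis using \<alpha> by (simp add: n_def)
  qed
  have P1: "2 powr \<alpha> - 1 > 0" using \<alpha> by simp
  have v: "v > 0" by (simp add: v_def)
  have d0: "d i \<ge> 0" for i using v by (simp add: d_def)
  have f_def: "f y = v * indicator (dcube j x1) y" for y unfolding f_eq v_def n_def ..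
  have f: "morrey_le p q f 1" unfolding f_eq using morrey_le_indicator[of q p j x1] p by simp
  note fD = morrey_leD[OF f]
  have fi: "integrable (dmeas j x) f" for j x
    using Lloc1_integrable[OF morrey_Lloc1[OF f]] p by simp
  have afi: "integrable (dmeas j x) (\<lambda>y. a y * f y)" for j x
    using bmo_morrey_mean[OF p(1), where 'n='n and p=p] ab f Lloc1_integrable by blast
  have x1in: "x1 \<in> dcube i y" if "y \<in> dcube j x0" "i < j" for i y
  proof -
    have "dcube (j-1) x0 = dcube (j-1) y" using that(1) dcube_mono[of "j-1" j x0] dcube_eq[of y "j-1" x0] by auto
    then show ?thesis using x1(1) dcube_mono[of i "j-1" y] that(2) by auto
  qed
  have disj: "dcube j x1 \<inter> dcube i y = {}" if "y \<in> dcube j x0" "j \<le> i" for i y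
    using dcube_disjoint[OF x1(2)] dcube_mono[OF that(2), of y] dcube_eq[OF that(1)] by auto
  have Df: "dmean i (\<lambda>z. h z * f z) y = dmean j h x1 * d i"
    if y: "y \<in> dcube j x0" and [measurable]: "h \<in> borel_measurable borel" for i y h
  proof -
    have "dmean i (\<lambda>z. h z * f z) y = v * dmean i (\<lambda>z. indicator (dcube j x1) z * h z) y"
      unfolding f_def dmean_cmult[symmetric] by (simp add: mult_ac)
    also have "\<dots> = dmean j h x1 * d i"
    proof (cases "i < j")
      case True
      then show ?thesis using dmean_indicator_far[of i j x1 y h] x1in[OF y True] by (simp add: d_def n_def)
    next
      case False
      then show ?thesis using dmean_indicator_disjoint[OF disj[OF y, of i], of h] by (simp add: d_def)
    qed
    finally show ?thesis .
  qed
  have Pf: "frac_partial \<alpha> f M y = \<kappa> M" and Paf: "frac_partial \<alpha> (\<lambda>y. a y * f y) M y = m * \<kappa> M"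
    if y: "y \<in> dcube j x0" for M y
  proof -
    have "dmean i f y = d i" for i using Df[OF y, of "\<lambda>_. 1" i] by simp
    then show "frac_partial \<alpha> f M y = \<kappa> M" unfolding frac_partial_eq[OF fi] \<kappa>_def by simp
    have "dmean i (\<lambda>y. a y * f y) y = m * d i" for i using Df[OF y, of a i] by (simp add: m_def)
    then show "frac_partial \<alpha> (\<lambda>y. a y * f y) M y = m * \<kappa> M"
      unfolding frac_partial_eq[OF afi] \<kappa>_def sum_distrib_left by (simp add: algebra_simps)
  qed
  \<comment> \<open>Only the parent level is kept. The negative boundary term at level -M decays
    geometrically because \<alpha> < n, and M >= |j| + 1 puts j - 1 into the summation range and
    makes the other boundary term vanish.\<close>
  have \<kappa>_ge: "c - v * 2 powr (\<alpha> - real_of_int j * n) * (2 powr (\<alpha> - n)) ^ M \<le> \<kappa> M" if M: "M \<ge> nat \<bar>j\<bar> + 1" for M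
  proof -
    have dM: "d (int M + 1) = 0" "d (- int M) = v * 2 powr ((- real M - real_of_int j) * n)" using M by (auto simp: d_def)
    have "2 powr (- real_of_int (j-1) * \<alpha>) * d (j-1) \<le> (\<Sum>i\<in>{- int M..int M}. 2 powr (- real_of_int i * \<alpha>) * d i)"
      by (rule member_le_sum) (use M d0 in auto)
    moreover have "2 powr (- real_of_int (j-1) * \<alpha>) * d (j-1) = 2 powr (\<alpha> - n) * 2 powr (real_of_int j * (n / p - \<alpha>))"
    proof -
      have "2 powr (- real_of_int (j-1) * \<alpha>) * d (j-1) = 2 powr (- real_of_int (j-1) * \<alpha> + (real_of_int j * (n / p) + - n))"
        unfolding powr_add by (simp add: d_def v_def)
      also have "- real_of_int (j-1) * \<alpha> + (real_of_int j * (n / p) + - n) = (\<alpha> - n) + real_of_int j * (n / p - \<alpha>)"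
        by (simp add: algebra_simps)
      finally show ?thesis unfolding powr_add .
    qed
    ultimately have 1: "c \<le> (2 powr \<alpha> - 1) * (\<Sum>i\<in>{- int M..int M}. 2 powr (- real_of_int i * \<alpha>) * d i)"
      unfolding c_def mult.assoc using P1 by (intro mult_left_mono) auto
    have 2: "2 powr ((real M + 1) * \<alpha>) * d (- int M) = v * 2 powr (\<alpha> - real_of_int j * n) * (2 powr (\<alpha> - n)) ^ M"
    proof -
      have "(2 powr (\<alpha> - n)) ^ M = 2 powr (real M * (\<alpha> - n))"
        by (simp add: powr_realpow[symmetric] powr_powr mult.commute)
      then have "v * 2 powr (\<alpha> - real_of_int j * n) * (2 powr (\<alpha> - n)) ^ M = v * 2 powr (\<alpha> - real_of_int j * n + real M * (\<alpha> - n))"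
        unfolding powr_add by simp
      also have "\<alpha> - real_of_int j * n + real M * (\<alpha> - n) = (real M + 1) * \<alpha> + (- real M - real_of_int j) * n"
        by (simp add: algebra_simps)
      finally have F: "v * 2 powr (\<alpha> - real_of_int j * n) * (2 powr (\<alpha> - n)) ^ M
        = v * (2 powr ((real M + 1) * \<alpha>) * 2 powr ((- real M - real_of_int j) * n))"
        unfolding powr_add .
      show ?thesis unfolding dM(2) F by (rule mult.left_commute)
    qed
    show ?thesis unfolding \<kappa>_def sum_by_parts_dyadic dM(1) using 1 2 by simp
  qed
  have cI: "Lloc_conv 1 (frac_partial \<alpha> f) (frac_int \<alpha> f)" by (rule frac_int_morrey[OF \<alpha> p(1) f])
  have cI': "Lloc_conv 1 (frac_partial \<alpha> (\<lambda>y. a y * f y)) (frac_int \<alpha> (\<lambda>y. a y * f y))"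
    by (rule frac_int_bmo_mult[OF \<alpha> p(1) ab f])
  obtain \<sigma> :: "nat \<Rightarrow> nat" where \<sigma>: "strict_mono \<sigma>" "AE y in dmeas j x0. (\<lambda>k. frac_partial \<alpha> f (\<sigma> k) y) \<longlonglongrightarrow> frac_int \<alpha> f y \<and> (\<lambda>k. frac_partial \<alpha> (\<lambda>y. a y * f y) (\<sigma> k) y) \<longlonglongrightarrow> frac_int \<alpha> (\<lambda>y. a y * f y) y"
    using Lloc_conv_AE_subseq2[OF cI cI'] by blast
  have low: "(\<lambda>k. c - v * 2 powr (\<alpha> - real_of_int j * n) * (2 powr (\<alpha> - n)) ^ (\<sigma> k)) \<longlonglongrightarrow> c - v * 2 powr (\<alpha> - real_of_int j * n) * 0"
  proof (intro tendsto_intros)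
    have "(\<lambda>M. (2 powr (\<alpha> - n)) ^ M) \<longlonglongrightarrow> (0::real)" using an by (intro LIMSEQ_realpow_zero) (auto simp: powr_less_one)
    then show "(\<lambda>k. (2 powr (\<alpha> - n)) ^ (\<sigma> k)) \<longlonglongrightarrow> (0::real)"
      using LIMSEQ_subseq_LIMSEQ[OF _ \<sigma>(1)] by (simp add: o_def)
  qed
  have "AE y in dmeas j x0. c * \<bar>a y - m\<bar> \<le> \<bar>a y * frac_int \<alpha> f y - frac_int \<alpha> (\<lambda>y. a y * f y) y\<bar>"
    using \<sigma>(2) AE_dmeas[of j x0]
  proof eventually_elim
    fix y
    assume l: "(\<lambda>k. frac_partial \<alpha> f (\<sigma> k) y) \<longlonglongrightarrow> frac_int \<alpha> f y \<and> (\<lambda>k. frac_partial \<alpha> (\<lambda>y. a y * f y) (\<sigma> k) y) \<longlonglongrightarrow> frac_int \<alpha> (\<lambda>y. a y * f y) y"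
      and y: "y \<in> dcube j x0"
    have l1: "(\<lambda>k. \<kappa> (\<sigma> k)) \<longlonglongrightarrow> frac_int \<alpha> f y" using l unfolding Pf[OF y] by simp
    have l2: "(\<lambda>k. m * \<kappa> (\<sigma> k)) \<longlonglongrightarrow> frac_int \<alpha> (\<lambda>y. a y * f y) y" using l unfolding Paf[OF y] by simp
    \<comment> \<open>On this cube both partial sums are constants with ratio m, so the two chosen
      limits inherit the ratio almost everywhere.\<close>
    have e: "frac_int \<alpha> (\<lambda>y. a y * f y) y = m * frac_int \<alpha> f y"
      by (rule LIMSEQ_unique[OF l2 tendsto_mult[OF tendsto_const l1]])
    have "c - v * 2 powr (\<alpha> - real_of_int j * n) * 0 \<le> frac_int \<alpha> f y"
    proof (rule LIMSEQ_le[OF low l1], intro exI allI impI)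
      fix k assume "k \<ge> nat \<bar>j\<bar> + 1"
      then have "\<sigma> k \<ge> nat \<bar>j\<bar> + 1" using seq_suble[OF \<sigma>(1), of k] by linarith
      then show "c - v * 2 powr (\<alpha> - real_of_int j * n) * (2 powr (\<alpha> - n)) ^ (\<sigma> k) \<le> \<kappa> (\<sigma> k)" by (rule \<kappa>_ge)
    qed
    then have ge: "c \<le> frac_int \<alpha> f y" by simp
    have "a y * frac_int \<alpha> f y - frac_int \<alpha> (\<lambda>y. a y * f y) y = frac_int \<alpha> f y * (a y - m)"
      unfolding e by (simp add: algebra_simps)
    then show "c * \<bar>a y - m\<bar> \<le> \<bar>a y * frac_int \<alpha> f y - frac_int \<alpha> (\<lambda>y. a y * f y) y\<bar>"
      using ge by (simp add: abs_mult mult_right_mono)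
  qed
  then show ?thesis unfolding c_def m_def n_def .
qed

lemma bmo_norm_nonneg: "0 \<le> bmo_norm a" if "a \<in> borel_measurable borel" for a :: "real^'n::finite \<Rightarrow> real"
proof (rule ccontr)
  assume no: "\<not> 0 \<le> bmo_norm a"
  have nn: "0 \<le> sharp_dyadic a x" for x
  proof -
    have "0 \<le> ereal (dmean 0 (\<lambda>y. \<bar>a y - dmean 0 a x\<bar>) x)" by (simp add: dmean_nonneg)
    also have "\<dots> \<le> sharp_dyadic a x" unfolding sharp_dyadic_eq[OF that] by (rule SUP_upper) simp
    finally show ?thesis .
  qed
  have no': "\<not> sharp_dyadic a x \<le> bmo_norm a" for x
    using nn[of x] no order_trans by blast
  have "AE x in lborel. sharp_dyadic a x \<le> bmo_norm a" unfolding bmo_norm_def by (rule esssup_AE)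
  then have "AE x::real^'n in lborel. False" by (simp add: no')
  then have "AE x in dmeas 0 (0::real^'n). False" by (rule AE_dmeas_lborel)
  then show False by simp
qed

text \<open>Since \<open>commutator\<close> is defined by choice, the existence of its defining
  limit is asserted together with the two norm inequalities.\<close>

theorem theorem5:
  fixes \<alpha> p q s t :: real
  assumes "0 < \<alpha>" "\<alpha> < real CARD('n::finite)"
    and "1 < q" "q \<le> p" "1 < t" "t \<le> s"
    and "t / s = q / p" "1 / s = 1 / p - \<alpha> / real CARD('n)"
  shows "\<exists>c C. 0 < c \<and> 0 < C \<and>
    (\<forall>a::real^'n \<Rightarrow> real. a \<in> bmo_dyadic \<longrightarrow>
       (\<forall>f\<in>morrey p q. (\<exists>g. Lloc_conv q (comm_partial a \<alpha> f) g)
                         \<and> commutator a \<alpha> q f \<in> morrey s t)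
     \<and> ereal c * bmo_norm a \<le> op_norm_morrey p q s t (commutator a \<alpha> q)
     \<and> op_norm_morrey p q s t (commutator a \<alpha> q) \<le> ereal C * bmo_norm a)"
proof -
  define n where "n = real CARD('n)"
  have n: "n > 0" by (simp add: n_def)
  have s0: "s > 0" and p0: "p > 0" and t1: "t \<ge> 1" and q0: "q > 0" using assms by auto
  have bs: "n / p - \<alpha> = n / s" using assms(8) n unfolding n_def[symmetric] by (simp add: field_simps)
  have ap: "\<alpha> < real CARD('n) / p" using bs n s0 unfolding n_def[symmetric] by (smt (verit) divide_pos_pos)
  obtain C where C: "C > 0" "\<forall>(a::real^'n \<Rightarrow> real) b f F. bmo_le a b \<longrightarrow> morrey_le p q f F \<longrightarrow>
     morrey_le s t (frac_commutator a \<alpha> f) (C * b * F) \<and>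
     Lloc_conv q (comm_partial a \<alpha> f) (frac_commutator a \<alpha> f)"
    using commutator_upper[OF assms(1,3,4,5,6,7,8)] by blast
  define c1 where "c1 = (2 powr \<alpha> - 1) * 2 powr (\<alpha> - n)"
  have c1: "c1 > 0" using assms(1) by (simp add: c1_def)
  have comm: "Lloc_conv q (comm_partial a \<alpha> f) (commutator a \<alpha> q f)"
    "AE y in lborel. commutator a \<alpha> q f y = a y * frac_int \<alpha> f y - frac_int \<alpha> (\<lambda>y. a y * f y) y"
    "morrey_le s t (commutator a \<alpha> q f) (C * b * F)"
    if ab: "bmo_le a b" and f: "morrey_le p q f F" for a f :: "real^'n \<Rightarrow> real" and b F
  proof -
    note g = C(2)[rule_format, OF ab f]
    show L: "Lloc_conv q (comm_partial a \<alpha> f) (commutator a \<alpha> q f)"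
      unfolding commutator_def using g by (intro someI[where P="Lloc_conv q (comm_partial a \<alpha> f)"]) blast
    show ae: "AE y in lborel. commutator a \<alpha> q f y = a y * frac_int \<alpha> f y - frac_int \<alpha> (\<lambda>y. a y * f y) y"
      by (rule Lloc_conv_unique[OF L _ q0]) (use g in blast)
    have "commutator a \<alpha> q f \<in> borel_measurable borel"
      using Lloc_convD(1)[OF L] q0 LlocD(1) by simp
    then show "morrey_le s t (commutator a \<alpha> q f) (C * b * F)"
      using morrey_le_AE_cong[OF conjunct1[OF g] ae] by blast
  qed
  \<comment> \<open>The bound \<open>b\<close> only ensures that the commutator is well defined; the
    conclusion is expressed through \<open>N\<close> alone, so any admissible \<open>b\<close> may
    be used later.\<close>
  have lower: "bmo_norm a \<le> ereal (2 * N / c1)"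
    if ab: "bmo_le a b" and N: "op_norm_morrey p q s t (commutator a \<alpha> q) \<le> ereal N" for a :: "real^'n \<Rightarrow> real" and b N
  proof (rule bmo_norm_leI)
    note a = bmo_leD[OF ab]
    show [measurable]: "a \<in> borel_measurable borel" by (rule a)
    fix j and x0 :: "real^'n"
    obtain x1 where x1: "x1 \<in> dcube (j-1) x0" "x1 \<notin> dcube j x0" using sibling_cube by blast
    define f where "f = (\<lambda>y. 2 powr (real_of_int j * (real CARD('n) / p)) * indicator (dcube j x1) y)"
    define m where "m = dmean j a x1"
    define G where "G = commutator a \<alpha> q f"
    define X where "X = 2 powr (real_of_int j * (n / s))"
    have X: "X > 0" by (simp add: X_def)
    have f: "morrey_le p q f 1" unfolding f_def using morrey_le_indicator[of q p j x1] q0 assms by simp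
    have GM: "morrey_le s t G (C * b * 1)" unfolding G_def by (rule comm(3)[OF ab f])
    note GD = morrey_leD[OF GM]
    note [measurable] = GD(2)
    have "morrey_norm s t G \<le> op_norm_morrey p q s t (commutator a \<alpha> q)"
      unfolding op_norm_morrey_def G_def
      by (rule SUP_upper) (use morrey_le_imp[OF f] in \<open>auto simp: one_ereal_def\<close>)
    also have "\<dots> \<le> ereal N" by (rule N)
    finally have "(dmean j (\<lambda>y. \<bar>G y\<bar> powr t) x0) powr (1/t) \<le> N * X"
      unfolding morrey_norm_le_iff[OF GD(2)] X_def n_def by blast
    then have G1: "dmean j (\<lambda>y. \<bar>G y\<bar>) x0 \<le> N * X"
      using dmean_powr_mono[OF GD(3), of 1 j x0] t1 by (simp add: dmean_nonneg)
    have Gi: "integrable (dmeas j x0) G" by (rule powr_dmean_le(1)[OF t1 _ GD(3)]) simp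
    have ai: "integrable (dmeas j x0) (\<lambda>y. \<bar>a y - m\<bar>)" using a(3) by simp
    have "AE y in dmeas j x0. c1 * X * \<bar>a y - m\<bar> \<le> \<bar>G y\<bar>"
      using commutator_indicator[OF assms(1) ap assms(3,4) ab x1 f_def] AE_dmeas_lborel[OF comm(2)[OF ab f], of j x0]
      by eventually_elim (simp add: G_def c1_def X_def m_def bs flip: n_def)
    then have "dmean j (\<lambda>y. c1 * X * \<bar>a y - m\<bar>) x0 \<le> dmean j (\<lambda>y. \<bar>G y\<bar>) x0"
      unfolding dmean_def using ai Gi by (intro integral_mono_AE) auto
    then have "c1 * X * dmean j (\<lambda>y. \<bar>a y - m\<bar>) x0 \<le> N * X" using G1 by simp
    then have "c1 * dmean j (\<lambda>y. \<bar>a y - m\<bar>) x0 \<le> N" using X by (simp add: mult.commute mult.left_commute)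
    then have am: "dmean j (\<lambda>y. \<bar>a y - m\<bar>) x0 \<le> N / c1" using c1 by (simp add: field_simps)
    \<comment> \<open>Replacing the mean over the sibling by the mean over the cube itself costs a
      factor 2, the origin of c1/2.\<close>
    have "\<bar>dmean j a x0 - m\<bar> \<le> dmean j (\<lambda>y. \<bar>a y - m\<bar>) x0"
      using dmean_abs_le[of j "\<lambda>y. a y - m" x0] a(3) by (simp add: dmean_diff)
    moreover have "dmean j (\<lambda>y. \<bar>a y - dmean j a x0\<bar>) x0 \<le> dmean j (\<lambda>y. \<bar>a y - m\<bar> + \<bar>dmean j a x0 - m\<bar>) x0"
      by (rule dmean_mono) (use ai in auto)
    moreover have "dmean j (\<lambda>y. \<bar>a y - m\<bar> + \<bar>dmean j a x0 - m\<bar>) x0 = dmean j (\<lambda>y. \<bar>a y - m\<bar>) x0 + \<bar>dmean j a x0 - m\<bar>"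
      using ai by (simp add: dmean_add)
    ultimately show "dmean j (\<lambda>y. \<bar>a y - dmean j a x0\<bar>) x0 \<le> 2 * N / c1" using am by simp
  qed
  have upper: "op_norm_morrey p q s t (commutator a \<alpha> q) \<le> ereal (C * b)"
    if ab: "bmo_le a b" for a :: "real^'n \<Rightarrow> real" and b
    unfolding op_norm_morrey_def
  proof (rule SUP_least)
    fix f :: "real^'n \<Rightarrow> real" assume "f \<in> {f \<in> morrey p q. morrey_norm p q f \<le> 1}"
    then have "morrey_le p q f 1" by (intro morrey_leI) (auto simp: one_ereal_def)
    from morrey_le_imp(2)[OF comm(3)[OF ab this]] show "morrey_norm s t (commutator a \<alpha> q f) \<le> ereal (C * b)" by simp
  qed
  show ?thesis
  proof (rule exI[of _ "c1/2"], rule exI[of _ C], intro conjI allI impI ballI)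
    show "0 < c1 / 2" "0 < C" using c1 C by auto
    fix a :: "real^'n \<Rightarrow> real" assume a: "a \<in> bmo_dyadic"
    have am: "a \<in> borel_measurable borel" using a LlocD(1) by (auto simp: bmo_dyadic_def)
    have "bmo_norm a < \<infinity>" "0 \<le> bmo_norm a" using a bmo_norm_nonneg[OF am] by (auto simp: bmo_dyadic_def)
    then obtain B where B: "bmo_norm a = ereal B" "B \<ge> 0" by (cases "bmo_norm a") auto
    have ab: "bmo_le a b" if "b > 0" "b \<ge> B" for b using bmo_leI[OF a] B that by simp
    have ab1: "bmo_le a (B + 1)" using B by (intro ab) auto
    {
      fix f :: "real^'n \<Rightarrow> real" assume f: "f \<in> morrey p q"
      then have "morrey_norm p q f < \<infinity>" by (simp add: morrey_def)
      then obtain F0 where "morrey_norm p q f \<le> ereal F0" by (cases "morrey_norm p q f") auto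
      then have "morrey_norm p q f \<le> ereal (max F0 1)" by (rule order_trans) simp
      then have fm: "morrey_le p q f (max F0 1)" using f by (intro morrey_leI) auto
      show "\<exists>g. Lloc_conv q (comm_partial a \<alpha> f) g" using comm(1)[OF ab1 fm] by blast
      show "commutator a \<alpha> q f \<in> morrey s t" using morrey_le_imp(1)[OF comm(3)[OF ab1 fm]] .
    }
    have up: "op_norm_morrey p q s t (commutator a \<alpha> q) \<le> ereal (C * B)"
    proof (rule ereal_le_epsilon2)
      fix e :: real assume e: "e > 0"
      \<comment> \<open>The norm B may be 0, while \<open>bmo_le\<close> needs a positive bound;
        hence the detour through B + e/C.\<close>
      have "op_norm_morrey p q s t (commutator a \<alpha> q) \<le> ereal (C * (B + e / C))"
        using B C e by (intro upper ab) (auto intro!: add_nonneg_pos)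
      also have "C * (B + e / C) = C * B + e" using C by (simp add: distrib_left)
      finally show "op_norm_morrey p q s t (commutator a \<alpha> q) \<le> ereal (C * B) + ereal e" by simp
    qed
    then show "op_norm_morrey p q s t (commutator a \<alpha> q) \<le> ereal C * bmo_norm a" unfolding B(1) by simp
    show "ereal (c1 / 2) * bmo_norm a \<le> op_norm_morrey p q s t (commutator a \<alpha> q)"
    proof (cases "op_norm_morrey p q s t (commutator a \<alpha> q)")
      case (real N)
      then have "ereal B \<le> ereal (2 * N / c1)" using lower[OF ab1] unfolding B(1) by simp
      then have "c1 / 2 * B \<le> N" using c1 by (simp add: field_simps)
      then show ?thesis unfolding B(1) real by simp
    next
      \<comment> \<open>An operator norm of minus infinity would permit N = -1 in
        \<open>lower\<close> and force a negative BMO norm.\<close>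
      case MInf
      then have "ereal B \<le> ereal (2 * (- 1) / c1)" using lower[OF ab1, of "-1"] unfolding B(1) by simp
      then have "B \<le> - 2 / c1" by simp
      also have "\<dots> < 0" using c1 by simp
      finally have "B < 0" .
      then show ?thesis using B(2) by simp
    qed simp
  qed
qed

end
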